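(* Let $G$ be a group, let $R=\bigoplus_{\sigma\in G}R_\sigma$ and $S=\bigoplus_{\sigma\in G}S_\sigma$ be two $G$-graded rings (with identity), and let $(R,S,{}_RM_S,{}_SN_R,\phi,\psi)$ be a graded Morita context. Put $I=\operatorname{Im}\phi$ and $J=\operatorname{Im}\psi$, which are graded two-sided ideals of $R$ and $S$. Then the quotient categories $R\text{-gr}/\mathcal C_I$ and $S\text{-gr}/\mathcal C_J$ are equivalent via the functors $F':R\text{-gr}\to S\text{-gr}$, $F'(X)=\mathrm{HOM}_R(M,X)$, and $G':S\text{-gr}\to R\text{-gr}$, $G'(Y)=\mathrm{HOM}_S(N,Y)$.
   Context: $R\text{-gr}$ is the category of $G$-graded left $R$-modules with degree-preserving $R$-linear maps. A graded Morita context is a datum $(R,S,{}_RM_S,{}_SN_R,\phi,\psi)$ where $M$ is a graded $R$-$S$-bimodule, $N$ is a graded $S$-$R$-bimodule, $\phi:M\otimes_SN\to R$ is a morphism of graded $R$-$R$-bimodules and $\psi:N\otimes_RM\to S$ is a morphism of graded $S$-$S$-bimodules such that $\phi(m\otimes n)m'=m\psi(n\otimes m')$ and $\psi(n\otimes m)n'=n\phi(m\otimes n')$ for all $m,m'\in M$, $n,n'\in N$. For graded left modules $M,X$ over $R$, $\mathrm{HOM}_R(M,X)=\bigoplus_{\sigma\in G}\mathrm{HOM}_R(M,X)_\sigma$, where $\mathrm{HOM}_R(M,X)_\sigma$ is the set of $R$-linear maps $f$ of degree $\sigma$, i.e. $f(M_\lambda)\subseteq X_{\lambda\sigma}$ for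 all $\lambda\in G$. $\mathcal C_I$ is the smallest localizing subcategory (full subcategory closed under subobjects, factor objects, direct sums and extensions) of $R\text{-gr}$ containing $\{X\in R\text{-gr}\mid IX=0\}$; $\mathcal C_J\subseteq S\text{-gr}$ is defined similarly from $J$. The quotient category by a localizing subcategory $\mathcal L$ is identified with the full subcategory of $\mathcal L$-closed objects: objects $M$ into which no nonzero object of $\mathcal L$ embeds and such that every morphism $X'\to M$ extends along any monomorphism $X'\to X$ with $X/X'\in\mathcal L$; the functors are restricted to these. *)

theory Defs
  imports "HOL-Algebra.Free_Abelian_Groups" "HOL-Algebra.Module" "HOL-Algebra.Ideal"
begin

section \<open>Graded rings, graded modules and graded bimodules\<close>

definition internal_direct_sum ::
    "('a, 'c) ring_scheme \<Rightarrow> 'i set \<Rightarrow> ('i \<Rightarrow> 'a set) \<Rightarrow> bool" where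
  "internal_direct_sum A K D \<longleftrightarrow>
     (\<forall>i\<in>K. subgroup (D i) (add_monoid A)) \<and>
     (\<forall>x\<in>carrier A. \<exists>!f. f \<in> Pi\<^sub>E K D \<and> finite {i \<in> K. f i \<noteq> \<zero>\<^bsub>A\<^esub>} \<and>
        x = (\<Oplus>\<^bsub>A\<^esub>i\<in>{i \<in> K. f i \<noteq> \<zero>\<^bsub>A\<^esub>}. f i))"

record ('g, 'r) gring = "'r ring" +
  rcomp :: "'g \<Rightarrow> 'r set"

text \<open>
  The library record for modules inherits the fields \<open>mult\<close> and \<open>one\<close> from rings; they carry
  no information for modules and nothing below depends on them.  The library locale for
  modules requires a commutative ring of scalars, hence the new locale.
\<close>

record ('g, 'r, 'x) gmodule = "('r, 'x) module" +
  mcomp :: "'g \<Rightarrow> 'x set"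

record ('g, 'r, 's, 'x) gbimodule = "('g, 'r, 'x) gmodule" +
  rsmult :: "'x \<Rightarrow> 's \<Rightarrow> 'x"  (infixl \<open>\<odot>\<^sub>r\<index>\<close> 70)

locale graded_ring = group G + ring R
  for G :: "'g monoid" and R :: "('g, 'r) gring" +
  assumes decomp: "internal_direct_sum R (carrier G) (rcomp R)"
    and mult_comp: "\<lbrakk>\<sigma> \<in> carrier G; \<tau> \<in> carrier G; a \<in> rcomp R \<sigma>; b \<in> rcomp R \<tau>\<rbrakk>
      \<Longrightarrow> a \<otimes>\<^bsub>R\<^esub> b \<in> rcomp R (\<sigma> \<otimes>\<^bsub>G\<^esub> \<tau>)"

locale left_module = ring R + abelian_group X
  for R :: "('r, 'c) ring_scheme" and X :: "('r, 'x, 'd) module_scheme" +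
  assumes smult_closed: "\<lbrakk>a \<in> carrier R; x \<in> carrier X\<rbrakk> \<Longrightarrow> a \<odot>\<^bsub>X\<^esub> x \<in> carrier X"
    and smult_l_distr: "\<lbrakk>a \<in> carrier R; b \<in> carrier R; x \<in> carrier X\<rbrakk>
      \<Longrightarrow> (a \<oplus>\<^bsub>R\<^esub> b) \<odot>\<^bsub>X\<^esub> x = a \<odot>\<^bsub>X\<^esub> x \<oplus>\<^bsub>X\<^esub> b \<odot>\<^bsub>X\<^esub> x"
    and smult_r_distr: "\<lbrakk>a \<in> carrier R; x \<in> carrier X; y \<in> carrier X\<rbrakk>
      \<Longrightarrow> a \<odot>\<^bsub>X\<^esub> (x \<oplus>\<^bsub>X\<^esub> y) = a \<odot>\<^bsub>X\<^esub> x \<oplus>\<^bsub>X\<^esub> a \<odot>\<^bsub>X\<^esub> y"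
    and smult_assoc: "\<lbrakk>a \<in> carrier R; b \<in> carrier R; x \<in> carrier X\<rbrakk>
      \<Longrightarrow> (a \<otimes>\<^bsub>R\<^esub> b) \<odot>\<^bsub>X\<^esub> x = a \<odot>\<^bsub>X\<^esub> (b \<odot>\<^bsub>X\<^esub> x)"
    and smult_one: "x \<in> carrier X \<Longrightarrow> \<one>\<^bsub>R\<^esub> \<odot>\<^bsub>X\<^esub> x = x"

locale graded_module = graded_ring G R + left_module R X
  for G :: "'g monoid" and R :: "('g, 'r) gring" and X :: "('g, 'r, 'x, 'd) gmodule_scheme" +
  assumes module_decomp: "internal_direct_sum X (carrier G) (mcomp X)"
    and smult_comp: "\<lbrakk>\<sigma> \<in> carrier G; \<nu> \<in> carrier G; a \<in> rcomp R \<sigma>; x \<in> mcomp X \<nu>\<rbrakk>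
      \<Longrightarrow> a \<odot>\<^bsub>X\<^esub> x \<in> mcomp X (\<sigma> \<otimes>\<^bsub>G\<^esub> \<nu>)"

locale graded_bimodule = graded_module G R M + S: graded_ring G S
  for G :: "'g monoid" and R :: "('g, 'r) gring" and S :: "('g, 's) gring"
    and M :: "('g, 'r, 's, 'm) gbimodule" +
  assumes rsmult_closed: "\<lbrakk>m \<in> carrier M; s \<in> carrier S\<rbrakk> \<Longrightarrow> m \<odot>\<^sub>r\<^bsub>M\<^esub> s \<in> carrier M"
    and rsmult_r_distr: "\<lbrakk>m \<in> carrier M; s \<in> carrier S; t \<in> carrier S\<rbrakk>
      \<Longrightarrow> m \<odot>\<^sub>r\<^bsub>M\<^esub> (s \<oplus>\<^bsub>S\<^esub> t) = m \<odot>\<^sub>r\<^bsub>M\<^esub> s \<oplus>\<^bsub>M\<^esub> m \<odot>\<^sub>r\<^bsub>M\<^esub> t"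
    and rsmult_l_distr: "\<lbrakk>m \<in> carrier M; m' \<in> carrier M; s \<in> carrier S\<rbrakk>
      \<Longrightarrow> (m \<oplus>\<^bsub>M\<^esub> m') \<odot>\<^sub>r\<^bsub>M\<^esub> s = m \<odot>\<^sub>r\<^bsub>M\<^esub> s \<oplus>\<^bsub>M\<^esub> m' \<odot>\<^sub>r\<^bsub>M\<^esub> s"
    and rsmult_assoc: "\<lbrakk>m \<in> carrier M; s \<in> carrier S; t \<in> carrier S\<rbrakk>
      \<Longrightarrow> m \<odot>\<^sub>r\<^bsub>M\<^esub> (s \<otimes>\<^bsub>S\<^esub> t) = (m \<odot>\<^sub>r\<^bsub>M\<^esub> s) \<odot>\<^sub>r\<^bsub>M\<^esub> t"
    and rsmult_one: "m \<in> carrier M \<Longrightarrow> m \<odot>\<^sub>r\<^bsub>M\<^esub> \<one>\<^bsub>S\<^esub> = m"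
    and smult_rsmult: "\<lbrakk>a \<in> carrier R; m \<in> carrier M; s \<in> carrier S\<rbrakk>
      \<Longrightarrow> (a \<odot>\<^bsub>M\<^esub> m) \<odot>\<^sub>r\<^bsub>M\<^esub> s = a \<odot>\<^bsub>M\<^esub> (m \<odot>\<^sub>r\<^bsub>M\<^esub> s)"
    and rsmult_comp: "\<lbrakk>\<nu> \<in> carrier G; \<sigma> \<in> carrier G; m \<in> mcomp M \<nu>; s \<in> rcomp S \<sigma>\<rbrakk>
      \<Longrightarrow> m \<odot>\<^sub>r\<^bsub>M\<^esub> s \<in> mcomp M (\<nu> \<otimes>\<^bsub>G\<^esub> \<sigma>)"

definition regular_bimodule :: "('g, 'r) gring \<Rightarrow> ('g, 'r, 'r, 'r) gbimodule" where
  "regular_bimodule R = \<lparr>carrier = carrier R, mult = mult R, one = one R,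
     zero = zero R, add = add R, smult = mult R, mcomp = rcomp R, rsmult = mult R\<rparr>"

definition graded_bimodule_hom ::
    "'g monoid \<Rightarrow> ('g, 'r) gring \<Rightarrow> ('g, 's) gring \<Rightarrow> ('g, 'r, 's, 'x) gbimodule \<Rightarrow>
     ('g, 'r, 's, 'y) gbimodule \<Rightarrow> ('x \<Rightarrow> 'y) set" where
  "graded_bimodule_hom G R S X Y = {f \<in> carrier X \<rightarrow> carrier Y.
     (\<forall>x\<in>carrier X. \<forall>x'\<in>carrier X. f (x \<oplus>\<^bsub>X\<^esub> x') = f x \<oplus>\<^bsub>Y\<^esub> f x') \<and>
     (\<forall>a\<in>carrier R. \<forall>x\<in>carrier X. f (a \<odot>\<^bsub>X\<^esub> x) = a \<odot>\<^bsub>Y\<^esub> f x) \<and>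
     (\<forall>x\<in>carrier X. \<forall>s\<in>carrier S. f (x \<odot>\<^sub>r\<^bsub>X\<^esub> s) = f x \<odot>\<^sub>r\<^bsub>Y\<^esub> s) \<and>
     (\<forall>\<nu>\<in>carrier G. f ` mcomp X \<nu> \<subseteq> mcomp Y \<nu>)}"

definition graded_ideal :: "'g monoid \<Rightarrow> ('g, 'r) gring \<Rightarrow> 'r set \<Rightarrow> bool" where
  "graded_ideal G R I \<longleftrightarrow> ideal I R \<and>
     internal_direct_sum (R\<lparr>carrier := I\<rparr>) (carrier G) (\<lambda>\<sigma>. I \<inter> rcomp R \<sigma>)"


section \<open>Tensor products of graded bimodules\<close>

text \<open>
  For an \<open>R\<close>-\<open>S\<close>-bimodule \<open>M\<close> and an \<open>S\<close>-\<open>T\<close>-bimodule \<open>N\<close>, the tensor product over \<open>S\<close> is the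
  quotient of the free abelian group on pairs by the usual relations.
\<close>

abbreviation tensor_free ::
    "('g, 'r, 's, 'm) gbimodule \<Rightarrow> ('g, 's, 't, 'n) gbimodule \<Rightarrow> ('m \<times> 'n \<Rightarrow>\<^sub>0 int) monoid" where
  "tensor_free M N \<equiv> free_Abelian_group (carrier M \<times> carrier N)"

definition tensor_rel ::
    "('g, 's) gring \<Rightarrow> ('g, 'r, 's, 'm) gbimodule \<Rightarrow> ('g, 's, 't, 'n) gbimodule \<Rightarrow>
     ('m \<times> 'n \<Rightarrow>\<^sub>0 int) set" where
  "tensor_rel S M N = generate (tensor_free M N)
     ({frag_of (m \<oplus>\<^bsub>M\<^esub> m', n) - frag_of (m, n) - frag_of (m', n) | m m' n.
         m \<in> carrier M \<and> m' \<in> carrier M \<and> n \<in> carrier N} \<union>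
      {frag_of (m, n \<oplus>\<^bsub>N\<^esub> n') - frag_of (m, n) - frag_of (m, n') | m n n'.
         m \<in> carrier M \<and> n \<in> carrier N \<and> n' \<in> carrier N} \<union>
      {frag_of (m \<odot>\<^sub>r\<^bsub>M\<^esub> s, n) - frag_of (m, s \<odot>\<^bsub>N\<^esub> n) | m s n.
         m \<in> carrier M \<and> s \<in> carrier S \<and> n \<in> carrier N})"

definition pure_tensor ::
    "('g, 's) gring \<Rightarrow> ('g, 'r, 's, 'm) gbimodule \<Rightarrow> ('g, 's, 't, 'n) gbimodule \<Rightarrow>
     'm \<Rightarrow> 'n \<Rightarrow> ('m \<times> 'n \<Rightarrow>\<^sub>0 int) set" where
  "pure_tensor S M N m n = tensor_rel S M N #>\<^bsub>tensor_free M N\<^esub> frag_of (m, n)"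

text \<open>
  The two scalar actions are the maps induced on cosets by \<open>(m, n) \<mapsto> (a m, n)\<close> and
  \<open>(m, n) \<mapsto> (m, n b)\<close>.
\<close>

definition tensor ::
    "'g monoid \<Rightarrow> ('g, 's) gring \<Rightarrow> ('g, 'r, 's, 'm) gbimodule \<Rightarrow> ('g, 's, 't, 'n) gbimodule \<Rightarrow>
     ('g, 'r, 't, ('m \<times> 'n \<Rightarrow>\<^sub>0 int) set) gbimodule" where
  "tensor G S M N =
     (let F = tensor_free M N; K = tensor_rel S M N in
      \<lparr>carrier = carrier (F Mod K), mult = undefined, one = undefined,
       zero = one (F Mod K), add = mult (F Mod K),
       smult = (\<lambda>a t. \<Union>c\<in>t. K #>\<^bsub>F\<^esub> frag_extend (\<lambda>(m, n). frag_of (a \<odot>\<^bsub>M\<^esub> m, n)) c),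
       mcomp = (\<lambda>\<sigma>. generate (F Mod K)
         {pure_tensor S M N m n | m n. \<exists>\<nu>\<in>carrier G. \<exists>\<mu>\<in>carrier G.
            \<nu> \<otimes>\<^bsub>G\<^esub> \<mu> = \<sigma> \<and> m \<in> mcomp M \<nu> \<and> n \<in> mcomp N \<mu>}),
       rsmult = (\<lambda>t b. \<Union>c\<in>t. K #>\<^bsub>F\<^esub> frag_extend (\<lambda>(m, n). frag_of (m, n \<odot>\<^sub>r\<^bsub>N\<^esub> b)) c)\<rparr>)"


section \<open>Graded Morita contexts\<close>

locale graded_Morita_context =
  M: graded_bimodule G R S M + N: graded_bimodule G S R N
  for G :: "'g monoid" and R :: "('g, 'r) gring" and S :: "('g, 's) gring"
    and M :: "('g, 'r, 's, 'm) gbimodule" and N :: "('g, 's, 'r, 'n) gbimodule"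
    and \<phi> :: "('m \<times> 'n \<Rightarrow>\<^sub>0 int) set \<Rightarrow> 'r" and \<psi> :: "('n \<times> 'm \<Rightarrow>\<^sub>0 int) set \<Rightarrow> 's" +
  assumes phi_hom: "\<phi> \<in> graded_bimodule_hom G R R (tensor G S M N) (regular_bimodule R)"
    and psi_hom: "\<psi> \<in> graded_bimodule_hom G S S (tensor G R N M) (regular_bimodule S)"
    and phi_psi: "\<lbrakk>m \<in> carrier M; m' \<in> carrier M; n \<in> carrier N\<rbrakk>
      \<Longrightarrow> \<phi> (pure_tensor S M N m n) \<odot>\<^bsub>M\<^esub> m' = m \<odot>\<^sub>r\<^bsub>M\<^esub> \<psi> (pure_tensor R N M n m')"
    and psi_phi: "\<lbrakk>m \<in> carrier M; n \<in> carrier N; n' \<in> carrier N\<rbrakk>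
      \<Longrightarrow> \<psi> (pure_tensor R N M n m) \<odot>\<^bsub>N\<^esub> n' = n \<odot>\<^sub>r\<^bsub>N\<^esub> \<phi> (pure_tensor S M N m n')"


section \<open>Categories, functors and equivalences\<close>

record ('o, 'a) cat =
  Obj :: "'o set"
  Arr :: "'o \<Rightarrow> 'o \<Rightarrow> 'a set"
  Idt :: "'o \<Rightarrow> 'a"
  Cmp :: "'o \<Rightarrow> 'o \<Rightarrow> 'o \<Rightarrow> 'a \<Rightarrow> 'a \<Rightarrow> 'a"

text \<open>
  \<open>Cmp C X Y Z g f\<close> is the composite of \<open>f : X \<rightarrow> Y\<close> and \<open>g : Y \<rightarrow> Z\<close>.  The action of a functor
  on arrows takes source and target as explicit arguments, since arrows do not record them.
\<close>

record ('o, 'a, 'p, 'b) cfunctor =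
  Fobj :: "'o \<Rightarrow> 'p"
  Farr :: "'o \<Rightarrow> 'o \<Rightarrow> 'a \<Rightarrow> 'b"

definition is_functor ::
    "('o, 'a) cat \<Rightarrow> ('p, 'b) cat \<Rightarrow> ('o, 'a, 'p, 'b) cfunctor \<Rightarrow> bool" where
  "is_functor C D F \<longleftrightarrow>
     (\<forall>X\<in>Obj C. Fobj F X \<in> Obj D) \<and>
     (\<forall>X\<in>Obj C. \<forall>Y\<in>Obj C. \<forall>f\<in>Arr C X Y. Farr F X Y f \<in> Arr D (Fobj F X) (Fobj F Y)) \<and>
     (\<forall>X\<in>Obj C. Farr F X X (Idt C X) = Idt D (Fobj F X)) \<and>
     (\<forall>X\<in>Obj C. \<forall>Y\<in>Obj C. \<forall>Z\<in>Obj C. \<forall>f\<in>Arr C X Y. \<forall>g\<in>Arr C Y Z.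
        Farr F X Z (Cmp C X Y Z g f) =
        Cmp D (Fobj F X) (Fobj F Y) (Fobj F Z) (Farr F Y Z g) (Farr F X Y f))"

definition id_functor :: "('o, 'a, 'o, 'a) cfunctor" where
  "id_functor = \<lparr>Fobj = (\<lambda>X. X), Farr = (\<lambda>X Y f. f)\<rparr>"

definition comp_functor ::
    "('p, 'b, 'q, 'c) cfunctor \<Rightarrow> ('o, 'a, 'p, 'b) cfunctor \<Rightarrow> ('o, 'a, 'q, 'c) cfunctor" where
  "comp_functor H F = \<lparr>Fobj = (\<lambda>X. Fobj H (Fobj F X)),
     Farr = (\<lambda>X Y f. Farr H (Fobj F X) (Fobj F Y) (Farr F X Y f))\<rparr>"

definition is_iso :: "('o, 'a) cat \<Rightarrow> 'o \<Rightarrow> 'o \<Rightarrow> 'a \<Rightarrow> bool" where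
  "is_iso C X Y f \<longleftrightarrow> f \<in> Arr C X Y \<and>
     (\<exists>g\<in>Arr C Y X. Cmp C X Y X g f = Idt C X \<and> Cmp C Y X Y f g = Idt C Y)"

definition naturally_isomorphic ::
    "('o, 'a) cat \<Rightarrow> ('p, 'b) cat \<Rightarrow> ('o, 'a, 'p, 'b) cfunctor \<Rightarrow>
     ('o, 'a, 'p, 'b) cfunctor \<Rightarrow> bool" where
  "naturally_isomorphic C D F H \<longleftrightarrow> (\<exists>\<eta>.
     (\<forall>X\<in>Obj C. is_iso D (Fobj F X) (Fobj H X) (\<eta> X)) \<and>
     (\<forall>X\<in>Obj C. \<forall>Y\<in>Obj C. \<forall>f\<in>Arr C X Y.
        Cmp D (Fobj F X) (Fobj F Y) (Fobj H Y) (\<eta> Y) (Farr F X Y f) =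
        Cmp D (Fobj F X) (Fobj H X) (Fobj H Y) (Farr H X Y f) (\<eta> X)))"

definition equivalence_via ::
    "('o, 'a) cat \<Rightarrow> ('p, 'b) cat \<Rightarrow> ('o, 'a, 'p, 'b) cfunctor \<Rightarrow>
     ('p, 'b, 'o, 'a) cfunctor \<Rightarrow> bool" where
  "equivalence_via C D F H \<longleftrightarrow> is_functor C D F \<and> is_functor D C H \<and>
     naturally_isomorphic C C id_functor (comp_functor H F) \<and>
     naturally_isomorphic D D (comp_functor F H) id_functor"

definition full_subcat :: "('o, 'a) cat \<Rightarrow> 'o set \<Rightarrow> ('o, 'a) cat" where
  "full_subcat C P = C\<lparr>Obj := Obj C \<inter> P\<rparr>"


section \<open>The category of graded modules, localizing subcategories, closed objects\<close>

text \<open>Linear maps are extensional (\<open>undefined\<close> outside the carrier), so that equality of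
  morphisms is equality of functions.\<close>

definition linear_maps ::
    "('g, 'r) gring \<Rightarrow> ('g, 'r, 'x, 'c) gmodule_scheme \<Rightarrow> ('g, 'r, 'y, 'd) gmodule_scheme \<Rightarrow>
     ('x \<Rightarrow> 'y) set" where
  "linear_maps R X Y = {f \<in> carrier X \<rightarrow>\<^sub>E carrier Y.
     (\<forall>x\<in>carrier X. \<forall>x'\<in>carrier X. f (x \<oplus>\<^bsub>X\<^esub> x') = f x \<oplus>\<^bsub>Y\<^esub> f x') \<and>
     (\<forall>a\<in>carrier R. \<forall>x\<in>carrier X. f (a \<odot>\<^bsub>X\<^esub> x) = a \<odot>\<^bsub>Y\<^esub> f x)}"

definition graded_hom ::
    "'g monoid \<Rightarrow> ('g, 'r) gring \<Rightarrow> ('g, 'r, 'x) gmodule \<Rightarrow> ('g, 'r, 'y) gmodule \<Rightarrow>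
     ('x \<Rightarrow> 'y) set" where
  "graded_hom G R X Y = {f \<in> linear_maps R X Y. \<forall>\<nu>\<in>carrier G. f ` mcomp X \<nu> \<subseteq> mcomp Y \<nu>}"

text \<open>
  The type \<open>'u\<close> plays the role of the universe of sets: the objects are all graded left
  modules whose underlying set is a subset of \<open>'u\<close>.
\<close>

definition gr_cat :: "'g monoid \<Rightarrow> ('g, 'r) gring \<Rightarrow> (('g, 'r, 'u) gmodule, 'u \<Rightarrow> 'u) cat" where
  "gr_cat G R = \<lparr>Obj = {X. graded_module G R X}, Arr = graded_hom G R,
     Idt = (\<lambda>X. \<lambda>x\<in>carrier X. x), Cmp = (\<lambda>X Y Z g f. compose (carrier X) g f)\<rparr>"

definition gr_mono :: "'g monoid \<Rightarrow> ('g, 'r) gring \<Rightarrow> ('g, 'r, 'u) gmodule \<Rightarrow>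
    ('g, 'r, 'u) gmodule \<Rightarrow> ('u \<Rightarrow> 'u) set" where
  "gr_mono G R X Y = {f \<in> graded_hom G R X Y. inj_on f (carrier X)}"

definition gr_epi :: "'g monoid \<Rightarrow> ('g, 'r) gring \<Rightarrow> ('g, 'r, 'u) gmodule \<Rightarrow>
    ('g, 'r, 'u) gmodule \<Rightarrow> ('u \<Rightarrow> 'u) set" where
  "gr_epi G R X Y = {f \<in> graded_hom G R X Y. f ` carrier X = carrier Y}"

text \<open>\<open>0 \<rightarrow> X' \<rightarrow> X \<rightarrow> X'' \<rightarrow> 0\<close> is exact.\<close>

definition short_exact :: "'g monoid \<Rightarrow> ('g, 'r) gring \<Rightarrow> ('g, 'r, 'u) gmodule \<Rightarrow>
    ('u \<Rightarrow> 'u) \<Rightarrow> ('g, 'r, 'u) gmodule \<Rightarrow> ('u \<Rightarrow> 'u) \<Rightarrow> ('g, 'r, 'u) gmodule \<Rightarrow> bool" where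
  "short_exact G R X' i X p X'' \<longleftrightarrow> i \<in> gr_mono G R X' X \<and> p \<in> gr_epi G R X X'' \<and>
     i ` carrier X' = {x \<in> carrier X. p x = \<zero>\<^bsub>X''\<^esub>}"

text \<open>
  Closure under direct sums is stated for families indexed by subsets of \<open>'u\<close>.  A direct sum
  living in \<open>'u\<close> has at most as many nonzero summands as \<open>'u\<close> has elements.
\<close>

definition localizing :: "'g monoid \<Rightarrow> ('g, 'r) gring \<Rightarrow> ('g, 'r, 'u) gmodule set \<Rightarrow> bool" where
  "localizing G R L \<longleftrightarrow>
     L \<subseteq> Obj (gr_cat G R) \<and>
     (\<forall>X\<in>L. \<forall>Y\<in>Obj (gr_cat G R). gr_mono G R Y X \<noteq> {} \<longrightarrow> Y \<in> L) \<and>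
     (\<forall>X\<in>L. \<forall>Y\<in>Obj (gr_cat G R). gr_epi G R X Y \<noteq> {} \<longrightarrow> Y \<in> L) \<and>
     (\<forall>(K :: 'u set) X \<iota>. \<forall>D\<in>Obj (gr_cat G R).
        (\<forall>k\<in>K. X k \<in> L \<and> \<iota> k \<in> gr_mono G R (X k) D) \<and>
        internal_direct_sum D K (\<lambda>k. \<iota> k ` carrier (X k)) \<longrightarrow> D \<in> L) \<and>
     (\<forall>X'\<in>L. \<forall>X''\<in>L. \<forall>X\<in>Obj (gr_cat G R). \<forall>i p. short_exact G R X' i X p X'' \<longrightarrow> X \<in> L)"

definition killed_by :: "'g monoid \<Rightarrow> ('g, 'r) gring \<Rightarrow> 'r set \<Rightarrow> ('g, 'r, 'u) gmodule set" where
  "killed_by G R I = {X \<in> Obj (gr_cat G R). \<forall>a\<in>I. \<forall>x\<in>carrier X. a \<odot>\<^bsub>X\<^esub> x = \<zero>\<^bsub>X\<^esub>}"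

definition loc_of_ideal :: "'g monoid \<Rightarrow> ('g, 'r) gring \<Rightarrow> 'r set \<Rightarrow> ('g, 'r, 'u) gmodule set" where
  "loc_of_ideal G R I = \<Inter>{L. localizing G R L \<and> killed_by G R I \<subseteq> L}"

definition closed_objects ::
    "'g monoid \<Rightarrow> ('g, 'r) gring \<Rightarrow> ('g, 'r, 'u) gmodule set \<Rightarrow> ('g, 'r, 'u) gmodule set" where
  "closed_objects G R L = {Q \<in> Obj (gr_cat G R).
     (\<forall>X\<in>L. gr_mono G R X Q \<noteq> {} \<longrightarrow> carrier X = {\<zero>\<^bsub>X\<^esub>}) \<and>
     (\<forall>X'\<in>Obj (gr_cat G R). \<forall>X\<in>Obj (gr_cat G R). \<forall>X''\<in>L. \<forall>i p.
        short_exact G R X' i X p X'' \<longrightarrow>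
        (\<forall>f\<in>graded_hom G R X' Q. \<exists>h\<in>graded_hom G R X Q. compose (carrier X') h i = f))}"

definition quotient_cat ::
    "'g monoid \<Rightarrow> ('g, 'r) gring \<Rightarrow> ('g, 'r, 'u) gmodule set \<Rightarrow>
     (('g, 'r, 'u) gmodule, 'u \<Rightarrow> 'u) cat" where
  "quotient_cat G R L = full_subcat (gr_cat G R) (closed_objects G R L)"


section \<open>The functor HOM\<close>

definition HOM_deg ::
    "'g monoid \<Rightarrow> ('g, 'r) gring \<Rightarrow> ('g, 'r, 's, 'm) gbimodule \<Rightarrow> ('g, 'r, 'x) gmodule \<Rightarrow>
     'g \<Rightarrow> ('m \<Rightarrow> 'x) set" where
  "HOM_deg G R M X \<sigma> = {f \<in> linear_maps R M X.
     \<forall>\<nu>\<in>carrier G. f ` mcomp M \<nu> \<subseteq> mcomp X (\<nu> \<otimes>\<^bsub>G\<^esub> \<sigma>)}"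

text \<open>The left \<open>S\<close>-action on linear maps out of an \<open>R\<close>-\<open>S\<close>-bimodule is \<open>(s f)(m) = f(m s)\<close>.\<close>

definition HOM ::
    "'g monoid \<Rightarrow> ('g, 'r) gring \<Rightarrow> ('g, 'r, 's, 'm) gbimodule \<Rightarrow> ('g, 'r, 'x) gmodule \<Rightarrow>
     ('g, 's, 'm \<Rightarrow> 'x) gmodule" where
  "HOM G R M X = \<lparr>
     carrier = {\<lambda>m\<in>carrier M. \<Oplus>\<^bsub>X\<^esub>\<sigma>\<in>K. h \<sigma> m | K h.
        finite K \<and> K \<subseteq> carrier G \<and> (\<forall>\<sigma>\<in>K. h \<sigma> \<in> HOM_deg G R M X \<sigma>)},
     mult = undefined, one = undefined,
     zero = (\<lambda>m\<in>carrier M. \<zero>\<^bsub>X\<^esub>),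
     add = (\<lambda>f f'. \<lambda>m\<in>carrier M. f m \<oplus>\<^bsub>X\<^esub> f' m),
     smult = (\<lambda>s f. \<lambda>m\<in>carrier M. f (m \<odot>\<^sub>r\<^bsub>M\<^esub> s)),
     mcomp = HOM_deg G R M X\<rparr>"

text \<open>
  The elements of \<open>HOM G R M X\<close> are functions \<open>'m \<Rightarrow> 'u\<close>; to obtain an object over the same
  universe \<open>'u\<close>, the structure is transported along an injective encoding
  \<open>code :: ('m \<Rightarrow> 'u) \<Rightarrow> 'u\<close>.
\<close>

definition transport ::
    "('x \<Rightarrow> 'y) \<Rightarrow> ('g, 's, 'x) gmodule \<Rightarrow> ('g, 's, 'y) gmodule" where
  "transport e A = \<lparr>carrier = e ` carrier A, mult = undefined, one = undefined,
     zero = e \<zero>\<^bsub>A\<^esub>,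
     add = (\<lambda>x y. e (inv_into (carrier A) e x \<oplus>\<^bsub>A\<^esub> inv_into (carrier A) e y)),
     smult = (\<lambda>s x. e (s \<odot>\<^bsub>A\<^esub> inv_into (carrier A) e x)),
     mcomp = (\<lambda>\<sigma>. e ` mcomp A \<sigma>)\<rparr>"

definition HOM_functor ::
    "'g monoid \<Rightarrow> ('g, 'r) gring \<Rightarrow> ('g, 'r, 's, 'm) gbimodule \<Rightarrow> (('m \<Rightarrow> 'u) \<Rightarrow> 'u) \<Rightarrow>
     (('g, 'r, 'u) gmodule, 'u \<Rightarrow> 'u, ('g, 's, 'u) gmodule, 'u \<Rightarrow> 'u) cfunctor" where
  "HOM_functor G R M code = \<lparr>
     Fobj = (\<lambda>X. transport code (HOM G R M X)),
     Farr = (\<lambda>X Y h. \<lambda>y\<in>code ` carrier (HOM G R M X).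
       code (compose (carrier M) h (inv_into (carrier (HOM G R M X)) code y)))\<rparr>"

text \<open>
  The requirements on the universe \<open>'u\<close>: it is infinite, at least as large as the rings \<open>R\<close>
  and \<open>S\<close>, and for each module over it, the maps out of \<open>M\<close> and \<open>N\<close> can be encoded in it.
\<close>

definition adequate_universe ::
    "('g, 'r) gring \<Rightarrow> ('g, 's) gring \<Rightarrow> ('g, 'r, 's, 'm) gbimodule \<Rightarrow>
     ('g, 's, 'r, 'n) gbimodule \<Rightarrow> (('m \<Rightarrow> 'u) \<Rightarrow> 'u) \<Rightarrow> (('n \<Rightarrow> 'u) \<Rightarrow> 'u) \<Rightarrow> bool" where
  "adequate_universe R S M N codeM codeN \<longleftrightarrow>
     infinite (UNIV :: 'u set) \<and>
     (\<exists>e :: 'r \<Rightarrow> 'u. inj_on e (carrier R)) \<and>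
     (\<exists>e :: 's \<Rightarrow> 'u. inj_on e (carrier S)) \<and>
     inj_on codeM (carrier M \<rightarrow>\<^sub>E UNIV) \<and>
     inj_on codeN (carrier N \<rightarrow>\<^sub>E UNIV)"

text \<open>Adequate universes exist, and can be chosen to contain any given type \<open>'z\<close>.\<close>

lemma adequate_universe_exists:
  fixes R :: "('g, 'r) gring" and S :: "('g, 's) gring"
    and M :: "('g, 'r, 's, 'm) gbimodule" and N :: "('g, 's, 'r, 'n) gbimodule"
  shows "\<exists>(codeM :: ('m \<Rightarrow> ('r + 's + 'm + 'n + 'z) list set) \<Rightarrow> ('r + 's + 'm + 'n + 'z) list set)
           codeN. adequate_universe R S M N codeM codeN"
proof -
  let ?code = "\<lambda>c f. {c b # l | b l. l \<in> f b}"
  have inj_code: "inj (?code c)" if "inj c"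
    for c :: "'b \<Rightarrow> 'r + 's + 'm + 'n + 'z"
  proof (rule injI)
    fix f g assume eq: "?code c f = ?code c g"
    have "l \<in> f b \<longleftrightarrow> l \<in> g b" for l b
    proof -
      have "l \<in> f b \<longleftrightarrow> c b # l \<in> ?code c f"
        using that by (auto dest: injD)
      also have "\<dots> \<longleftrightarrow> c b # l \<in> ?code c g"
        by (rule arg_cong[OF eq])
      also have "\<dots> \<longleftrightarrow> l \<in> g b"
        using that by (auto dest: injD)
      finally show ?thesis .
    qed
    then show "f = g"
      by (intro ext Set.set_eqI)
  qed
  have inf: "infinite (UNIV :: ('r + 's + 'm + 'n + 'z) list set set)"
    by (simp add: Finite_Set.finite_set infinite_UNIV_listI)
  have R: "\<exists>e :: 'r \<Rightarrow> ('r + 's + 'm + 'n + 'z) list set. inj_on e (carrier R)"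
    by (rule exI[of _ "\<lambda>r. {[Inl r]}"]) (simp add: inj_on_def)
  have S: "\<exists>e :: 's \<Rightarrow> ('r + 's + 'm + 'n + 'z) list set. inj_on e (carrier S)"
    by (rule exI[of _ "\<lambda>s. {[Inr (Inl s)]}"]) (simp add: inj_on_def)
  have M: "inj_on (?code (\<lambda>m :: 'm. Inr (Inr (Inl m)) :: 'r + 's + 'm + 'n + 'z)) A" for A
    by (rule inj_on_subset[OF inj_code]) (simp_all add: inj_def)
  have N:
    "inj_on (?code (\<lambda>n :: 'n. Inr (Inr (Inr (Inl n))) :: 'r + 's + 'm + 'n + 'z)) A" for A
    by (rule inj_on_subset[OF inj_code]) (simp_all add: inj_def)
  show ?thesis
    unfolding adequate_universe_def
    by (rule exI, rule exI, rule conjI[OF inf conjI[OF R conjI[OF S conjI[OF M N]]]])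
qed

end

(*
  Let I = Im phi. An object Q is closed for C_I exactly when no nonzero element of Q is killed by I
  and every homogeneous linear map I -> Q is right multiplication by an element of Q. For the "if"
  part, C_I is contained in the class of modules that are exhausted by repeatedly adjoining the
  elements that I multiplies into what has been reached so far; a morphism is extended along
  X' -> X by saturating its graph in X x Q in the same way. The "only if" part tests Q on I -> R
  with shifted gradings.

  For such Q every balanced map beta : M x N -> Q is of the form beta(m, n) = phi(m, n) x: the
  element g(a) representing (m, n) |-> beta(m, n a) exists and is unique for a in I, by the
  associativity of the context, and g : I -> Q is multiplication by x. Hence the unit
  Q -> HOM(N, HOM(M, Q)), x |-> (n |-> m |-> phi(m, n) x), is bijective; the same representability
  shows that HOM(M, -) preserves closed objects. The context is symmetric in R and S.
*)
theory Submission
  imports Defs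
begin

section \<open>Internal direct sums\<close>

text \<open>The class C_I is an intersection and is never computed. It is only enclosed: it contains
  the modules killed by I and is contained in a localizing class described by saturation. The lower
  bound supplies the test objects, the upper bound limits the extension problems, and both lead to
  the same description of closed objects. In that description the absence of torsion always yields
  uniqueness and compatibility with degrees, while the condition on maps out of I yields existence.
  Neither I nor M is assumed finitely generated, so a linear map out of them need not be a finite
  sum of homogeneous ones. Existence is therefore obtained for homogeneous data and only then
  carried to finite sums. All objects must live in one type \<open>'u\<close>. This forces coded
  copies of R, I, R/I and of the modules HOM. The codes stay out of the algebra because a coded HOM
  is handled only through its evaluation map.\<close>

inductive_set add_span :: "('a, 'c) ring_scheme \<Rightarrow> 'a set \<Rightarrow> 'a set"
  for A and B where
    zero: "\<zero>\<^bsub>A\<^esub> \<in> add_span A B"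
  | add: "\<lbrakk>b \<in> B; x \<in> add_span A B\<rbrakk> \<Longrightarrow> b \<oplus>\<^bsub>A\<^esub> x \<in> add_span A B"

context abelian_group
begin

lemma add_span_closed:
  assumes "B \<subseteq> carrier G" "x \<in> add_span G B" shows "x \<in> carrier G"
  using assms(2,1) by induct auto

lemma add_span_incl:
  assumes "B \<subseteq> carrier G" "x \<in> B" shows "x \<in> add_span G B"
  using add_span.add[OF assms(2) add_span.zero, of G] assms by auto

lemma add_span_add:
  assumes B: "B \<subseteq> carrier G" and "x \<in> add_span G B" "y \<in> add_span G B"
  shows "x \<oplus> y \<in> add_span G B"
  using assms(2)
proof induct
  case zero
  then show ?case using assms add_span_closed by simp
next
  case (add b x)
  then show ?case
    using assms add_span_closed add_span.add[of b B "x \<oplus> y" G]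
    by (metis a_assoc subsetD)
qed

text \<open>The span is built from sums alone, so that induction adds one generator at a time. It is
  closed under negation once the negatives of the generators lie in it, as happens for the values of
  a pairing, where a sign can be moved into the first argument.\<close>

lemma add_span_neg:
  assumes B: "B \<subseteq> carrier G" and "\<And>b. b \<in> B \<Longrightarrow> \<ominus> b \<in> add_span G B" and "x \<in> add_span G B"
  shows "\<ominus> x \<in> add_span G B"
  using assms(3)
proof induct
  case zero
  have "\<ominus> \<zero> = \<zero>" by (rule minus_equality) simp_all
  then show ?case by (simp only: add_span.zero)
next
  case (add b x)
  then show ?case
    using assms add_span_closed add_span_add by (metis minus_add subsetD)
qed

lemma minus_eq_zero_iff:
  assumes "x \<in> carrier G" "y \<in> carrier G"
  shows "x \<ominus> y = \<zero> \<longleftrightarrow> x = y"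
  using assms by (metis a_minus_def add.inv_closed minus_minus minus_equality r_neg)

end

locale direct_sum = abelian_group A for A (structure) +
  fixes K :: "'i set" and D :: "'i \<Rightarrow> 'a set"
  assumes ids: "internal_direct_sum A K D"
begin

lemma comp_subgroup: "i \<in> K \<Longrightarrow> subgroup (D i) (add_monoid A)"
  using ids by (simp add: internal_direct_sum_def)

lemma comp_carrier: "\<lbrakk>i \<in> K; x \<in> D i\<rbrakk> \<Longrightarrow> x \<in> carrier A"
  using subgroup.mem_carrier[OF comp_subgroup] by simp

lemma comp_zero: "i \<in> K \<Longrightarrow> \<zero> \<in> D i"
  using subgroup.one_closed[OF comp_subgroup] by simp

lemma comp_add: "\<lbrakk>i \<in> K; x \<in> D i; y \<in> D i\<rbrakk> \<Longrightarrow> x \<oplus> y \<in> D i"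
  using subgroup.m_closed[OF comp_subgroup] by simp

lemma comp_neg: "\<lbrakk>i \<in> K; x \<in> D i\<rbrakk> \<Longrightarrow> \<ominus> x \<in> D i"
  using subgroup.m_inv_closed[OF comp_subgroup] by (simp add: a_inv_def)

definition decomposes :: "'a \<Rightarrow> ('i \<Rightarrow> 'a) \<Rightarrow> bool" where
  "decomposes x f \<longleftrightarrow> f \<in> Pi\<^sub>E K D \<and> finite {i \<in> K. f i \<noteq> \<zero>} \<and>
     x = (\<Oplus>i\<in>{i \<in> K. f i \<noteq> \<zero>}. f i)"

definition pr :: "'i \<Rightarrow> 'a \<Rightarrow> 'a" where
  "pr i x = (THE f. decomposes x f) i"

lemma decomposes_ex1: "x \<in> carrier A \<Longrightarrow> \<exists>!f. decomposes x f"
  using ids unfolding internal_direct_sum_def decomposes_def by blast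

lemma decomposes_pr: "x \<in> carrier A \<Longrightarrow> decomposes x (\<lambda>i. pr i x)"
  using theI'[OF decomposes_ex1] by (simp add: pr_def)

lemma pr_eqI: "\<lbrakk>decomposes x f; x \<in> carrier A\<rbrakk> \<Longrightarrow> pr i x = f i"
  using the1_equality[OF decomposes_ex1] by (simp add: pr_def)

text \<open>The definition sums over the exact support, which is not stable under addition. Any
  finite set of indices containing the support gives the same sum, because the extra terms are
  zero.\<close>

lemma decomposesI:
  assumes f: "f \<in> Pi\<^sub>E K D" and F: "finite F" "F \<subseteq> K" "\<And>i. i \<in> K - F \<Longrightarrow> f i = \<zero>"
    and x: "x = (\<Oplus>i\<in>F. f i)"
  shows "decomposes x f"
proof -
  have fc: "f i \<in> carrier A" if "i \<in> F" for i
    using that f F(2) by (intro comp_carrier[of i]) auto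
  have sub: "{i \<in> K. f i \<noteq> \<zero>} \<subseteq> F" using F by auto
  have "(\<Oplus>i\<in>F. f i) = (\<Oplus>i\<in>{i \<in> K. f i \<noteq> \<zero>}. f i)"
    using F sub fc by (intro add.finprod_mono_neutral_cong_right[simplified]) auto
  then show ?thesis
    unfolding decomposes_def using f x finite_subset[OF sub F(1)] by blast
qed

lemma pr_comp: "\<lbrakk>i \<in> K; x \<in> carrier A\<rbrakk> \<Longrightarrow> pr i x \<in> D i"
  using decomposes_pr by (auto simp: decomposes_def)

lemma pr_closed [simp]: "\<lbrakk>i \<in> K; x \<in> carrier A\<rbrakk> \<Longrightarrow> pr i x \<in> carrier A"
  by (meson pr_comp comp_carrier)

text \<open>Every element is a finite sum of its components, so an additive statement need only be
  checked on homogeneous elements. This is the standard way from homogeneous to arbitrary elements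
  below.\<close>

lemma comp_induct [consumes 1, case_names zero comp add]:
  assumes x: "x \<in> carrier A" and "P \<zero>" and P: "\<And>i x. i \<in> K \<Longrightarrow> x \<in> D i \<Longrightarrow> P x"
    and add: "\<And>x y. x \<in> carrier A \<Longrightarrow> y \<in> carrier A \<Longrightarrow> P x \<Longrightarrow> P y \<Longrightarrow> P (x \<oplus> y)"
  shows "P x"
proof -
  have "P (\<Oplus>i\<in>F. pr i x)" if "finite F" "F \<subseteq> K" for F
    using that
  proof induct
    case (insert i F)
    then have "(\<lambda>i. pr i x) \<in> F \<rightarrow> carrier A" using x by auto
    moreover have "P (pr i x)" using insert x by (auto intro: P[of i] pr_comp)
    ultimately show ?case using insert x by (simp add: add)
  qed (simp add: assms)
  then show ?thesis
    using decomposes_pr[OF x] unfolding decomposes_def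
    by (metis (no_types, lifting) mem_Collect_eq subsetI)
qed

lemma decomposes_single:
  assumes "i \<in> K" "x \<in> D i"
  shows "decomposes x (\<lambda>j\<in>K. if j = i then x else \<zero>)"
  using assms by (intro decomposesI[where F = "{i}"]) (auto simp: comp_zero comp_carrier)

lemma pr_same: "\<lbrakk>i \<in> K; x \<in> D i\<rbrakk> \<Longrightarrow> pr i x = x"
  using pr_eqI[OF decomposes_single] by (simp add: comp_carrier)

lemma pr_other: "\<lbrakk>i \<in> K; j \<in> K; x \<in> D j; i \<noteq> j\<rbrakk> \<Longrightarrow> pr i x = \<zero>"
  using pr_eqI[OF decomposes_single] by (simp add: comp_carrier)

text \<open>Both decompositions are written over the union of the two supports and added there.
  Uniqueness of decompositions then identifies the coordinates of the sum, even if some of them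
  cancel.\<close>

lemma pr_add:
  assumes "i \<in> K" "x \<in> carrier A" "y \<in> carrier A"
  shows "pr i (x \<oplus> y) = pr i x \<oplus> pr i y"
proof -
  let ?s = "\<lambda>x. {i \<in> K. pr i x \<noteq> \<zero>}"
  have fin: "finite (?s x \<union> ?s y)"
    using assms decomposes_pr by (simp add: decomposes_def)
  have sum: "z = (\<Oplus>i\<in>?s x \<union> ?s y. pr i z)" if "z \<in> {x, y}" for z
  proof -
    have z: "z \<in> carrier A" using that assms by auto
    have "(\<Oplus>i\<in>?s x \<union> ?s y. pr i z) = (\<Oplus>i\<in>?s z. pr i z)"
      using that fin z by (intro add.finprod_mono_neutral_cong_right[simplified]) auto
    then show ?thesis using decomposes_pr[OF z] by (simp add: decomposes_def)
  qed
  have "x \<oplus> y = (\<Oplus>i\<in>?s x \<union> ?s y. pr i x) \<oplus> (\<Oplus>i\<in>?s x \<union> ?s y. pr i y)"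
    using sum by simp
  also have "\<dots> = (\<Oplus>i\<in>?s x \<union> ?s y. pr i x \<oplus> pr i y)"
    using assms by (intro finsum_addf[symmetric]) auto
  also have "\<dots> = (\<Oplus>i\<in>?s x \<union> ?s y. (\<lambda>i\<in>K. pr i x \<oplus> pr i y) i)"
    using assms by (intro finsum_cong') auto
  finally have "decomposes (x \<oplus> y) (\<lambda>i\<in>K. pr i x \<oplus> pr i y)"
    using fin assms by (intro decomposesI) (auto simp: pr_comp comp_add)
  then show ?thesis using assms pr_eqI[of "x \<oplus> y"] by simp
qed

lemma pr_zero [simp]: "i \<in> K \<Longrightarrow> pr i \<zero> = \<zero>"
  by (simp add: comp_zero pr_same)

lemma pr_eq_zero_imp: 
  assumes "x \<in> carrier A" "\<And>i. i \<in> K \<Longrightarrow> pr i x = \<zero>" shows "x = \<zero>"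
  using decomposes_pr[OF assms(1)] assms(2)
  by (auto simp: decomposes_def cong: conj_cong)

lemma pr_ext:
  assumes x: "x \<in> carrier A" and y: "y \<in> carrier A" and eq: "\<And>i. i \<in> K \<Longrightarrow> pr i x = pr i y"
  shows "x = y"
proof -
  have "pr i (x \<ominus> y) = \<zero>" if "i \<in> K" for i
  proof -
    have "pr i (x \<ominus> y) \<oplus> pr i y = pr i x"
      using that x y by (metis a_minus_def add.inv_solve_right' minus_closed pr_add)
    then show ?thesis using that x y eq
      by (metis add.r_cancel_one minus_closed pr_closed)
  qed
  then show ?thesis
    using pr_eq_zero_imp[of "x \<ominus> y"] x y minus_eq_zero_iff by simp
qed

text \<open>This turns a claim of homogeneity into the vanishing of the other coordinates, which can
  be tested by multiplication when torsion is absent.\<close>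

lemma comp_iff:
  assumes i: "i \<in> K" and x: "x \<in> carrier A"
  shows "x \<in> D i \<longleftrightarrow> (\<forall>j\<in>K. j \<noteq> i \<longrightarrow> pr j x = \<zero>)"
proof
  assume other: "\<forall>j\<in>K. j \<noteq> i \<longrightarrow> pr j x = \<zero>"
  have "x = pr i x"
  proof (rule pr_ext)
    fix j assume "j \<in> K"
    then show "pr j x = pr j (pr i x)"
      using i x other by (cases "j = i") (auto simp: pr_same pr_other pr_comp)
  qed (use i x in auto)
  then show "x \<in> D i" using i x pr_comp by metis
qed (use i pr_other in blast)

lemma span_pr:
  assumes x: "x \<in> carrier A" and B: "B \<subseteq> carrier A" and pr: "\<And>i. i \<in> K \<Longrightarrow> pr i x \<in> B"
  shows "x \<in> add_span A B"
proof -
  have "(\<Oplus>i\<in>F. pr i x) \<in> add_span A B" if "finite F" "F \<subseteq> K" for F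
    using that
  proof induct
    case (insert i F)
    then have "(\<lambda>i. pr i x) \<in> F \<rightarrow> carrier A" using x by auto
    with insert x show ?case by (auto intro!: add_span.add pr)
  qed (simp add: add_span.zero)
  then show ?thesis
    using decomposes_pr[OF x] unfolding decomposes_def
    by (metis (no_types, lifting) mem_Collect_eq subsetI)
qed

end

text \<open>Since \<pi> is injective, distinct components go to distinct components, so no
  cancellation can mix coordinates. Translation of degrees gives the rule for multiplication by a
  homogeneous element, and the identity gives the rule for degree-preserving maps.\<close>

lemma direct_sum_map:
  assumes "direct_sum A K D" "direct_sum B L E"
    and T: "\<And>x. x \<in> carrier A \<Longrightarrow> T x \<in> carrier B"
      "\<And>x y. x \<in> carrier A \<Longrightarrow> y \<in> carrier A \<Longrightarrow> T (x \<oplus>\<^bsub>A\<^esub> y) = T x \<oplus>\<^bsub>B\<^esub> T y"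
      "\<And>i x. i \<in> K \<Longrightarrow> x \<in> D i \<Longrightarrow> T x \<in> E (\<pi> i)"
    and \<pi>: "inj_on \<pi> K" "\<pi> ` K \<subseteq> L" and i: "i \<in> K" and x: "x \<in> carrier A"
  shows "T (direct_sum.pr A K D i x) = direct_sum.pr B L E (\<pi> i) (T x)"
proof -
  interpret A: direct_sum A K D by fact
  interpret B: direct_sum B L E by fact
  have T0: "T \<zero>\<^bsub>A\<^esub> = \<zero>\<^bsub>B\<^esub>"
    using B.add.l_cancel_one[of "T \<zero>\<^bsub>A\<^esub>" "T \<zero>\<^bsub>A\<^esub>"]
    by (metis A.l_zero A.zero_closed T(1,2))
  have \<pi>L: "\<pi> j \<in> L" if "j \<in> K" for j using \<pi>(2) that by auto
  show ?thesis using x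
  proof (induct rule: A.comp_induct)
    case zero
    then show ?case using i T0 \<pi>L by simp
  next
    case (comp j x)
    show ?case
    proof (cases "j = i")
      case True
      then show ?thesis using comp i T \<pi>L by (simp add: A.pr_same B.pr_same)
    next
      case False
      then have "\<pi> j \<noteq> \<pi> i" using \<pi>(1) comp i by (auto dest: inj_onD)
      then show ?thesis
        using comp i T \<pi>L T0 False A.pr_other[of i j x] B.pr_other[of "\<pi> i" "\<pi> j" "T x"] by auto
    qed
  next
    case (add x y)
    then show ?case using i T \<pi>L by (simp add: A.pr_add B.pr_add)
  qed
qed

text \<open>The unique existence in the definition is split: spanning gives existence, and additive
  maps \<open>c i\<close> that act on the components as a Kronecker delta read off the terms of any
  decomposition, which gives uniqueness.\<close>

lemma (in abelian_group) internal_direct_sumI: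
  assumes sub: "\<And>i. i \<in> K \<Longrightarrow> subgroup (D i) (add_monoid G)"
    and span: "\<And>x. x \<in> carrier G \<Longrightarrow> x \<in> add_span G (\<Union>i\<in>K. D i)"
    and c_closed: "\<And>i x. i \<in> K \<Longrightarrow> x \<in> carrier G \<Longrightarrow> c i x \<in> carrier G"
    and c_add: "\<And>i x y. i \<in> K \<Longrightarrow> x \<in> carrier G \<Longrightarrow> y \<in> carrier G \<Longrightarrow> c i (x \<oplus> y) = c i x \<oplus> c i y"
    and c_same: "\<And>i x. i \<in> K \<Longrightarrow> x \<in> D i \<Longrightarrow> c i x = x"
    and c_other: "\<And>i j x. i \<in> K \<Longrightarrow> j \<in> K \<Longrightarrow> i \<noteq> j \<Longrightarrow> x \<in> D j \<Longrightarrow> c i x = \<zero>"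
  shows "internal_direct_sum G K D"
proof -
  have D: "x \<in> carrier G" if "i \<in> K" "x \<in> D i" for i x
    using subgroup.mem_carrier[OF sub] that by simp
  have D0: "\<zero> \<in> D i" if "i \<in> K" for i
    using subgroup.one_closed[OF sub] that by simp
  have Dadd: "x \<oplus> y \<in> D i" if "i \<in> K" "x \<in> D i" "y \<in> D i" for i x y
    using subgroup.m_closed[OF sub] that by simp
  have c0: "c i \<zero> = \<zero>" if "i \<in> K" for i using c_same D0 that by blast
  have DU: "(\<Union>i\<in>K. D i) \<subseteq> carrier G" using D by auto
  have ex: "\<exists>f. f \<in> Pi\<^sub>E K D \<and> finite {i \<in> K. f i \<noteq> \<zero>} \<and> x = (\<Oplus>i\<in>{i \<in> K. f i \<noteq> \<zero>}. f i)"
    if "x \<in> carrier G" for x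
  proof -
    have "\<exists>F f. finite F \<and> F \<subseteq> K \<and> f \<in> Pi\<^sub>E K D \<and> (\<forall>i\<in>K - F. f i = \<zero>) \<and> x = (\<Oplus>i\<in>F. f i)"
      using span[OF that]
    proof induct
      case zero
      then show ?case
        by (intro exI[of _ "{}"] exI[of _ "\<lambda>i\<in>K. \<zero>"]) (auto simp: D0)
    next
      case (add b x)
      then obtain F f j where F: "finite F" "F \<subseteq> K" and f: "f \<in> Pi\<^sub>E K D" "\<forall>i\<in>K - F. f i = \<zero>"
        and x: "x = (\<Oplus>i\<in>F. f i)" and j: "j \<in> K" "b \<in> D j"
        by blast
      have fc: "f i \<in> carrier G" if "i \<in> K" for i using f(1) that D by auto
      have x': "x = (\<Oplus>i\<in>insert j F. f i)"
        unfolding x using F f j fc by (intro add.finprod_mono_neutral_cong_left[simplified]) auto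
      \<comment> \<open>The new generator lies in component \<open>j\<close> and is absorbed there,
        whether or not \<open>j\<close> already belongs to \<open>F\<close>.\<close>
      let ?f = "f(j := b \<oplus> f j)"
      have 1: "(\<Oplus>i\<in>F - {j}. ?f i) = (\<Oplus>i\<in>F - {j}. f i)"
        using F fc by (intro finsum_cong') auto
      have 2: "(\<Oplus>i\<in>insert j F. h i) = h j \<oplus> (\<Oplus>i\<in>F - {j}. h i)"
        if "\<And>i. i \<in> K \<Longrightarrow> h i \<in> carrier G" for h
        using F j that finsum_insert[of "F - {j}" j h] by (auto simp: Pi_iff)
      have "b \<oplus> x = (\<Oplus>i\<in>insert j F. ?f i)"
        unfolding x' using F fc D j
        by (subst (1 2) 2) (auto simp: 1 a_assoc Pi_iff intro!: a_assoc[symmetric] finsum_closed)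
      then show ?case
        using F f j Dadd by (intro exI[of _ "insert j F"] exI[of _ ?f]) (auto simp: PiE_iff extensional_def)
    qed
    then obtain F f where F: "finite F" "F \<subseteq> K" and f: "f \<in> Pi\<^sub>E K D" "\<forall>i\<in>K - F. f i = \<zero>"
      and x: "x = (\<Oplus>i\<in>F. f i)" by blast
    have sub: "{i \<in> K. f i \<noteq> \<zero>} \<subseteq> F" using F f by auto
    have "(\<Oplus>i\<in>F. f i) = (\<Oplus>i\<in>{i \<in> K. f i \<noteq> \<zero>}. f i)"
      using f F sub by (intro add.finprod_mono_neutral_cong_right[simplified]) (auto dest!: D)
    then show ?thesis
      using f x finite_subset[OF sub F(1)] by (intro exI[of _ f]) simp
  qed
  have coord: "c j x = f j"
    if f: "f \<in> Pi\<^sub>E K D" "finite {i \<in> K. f i \<noteq> \<zero>}" and x: "x = (\<Oplus>i\<in>{i \<in> K. f i \<noteq> \<zero>}. f i)"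
      and j: "j \<in> K" for f x j
  proof -
    have fc: "f i \<in> carrier G" if "i \<in> K" for i using f(1) that D by auto
    have "c j (\<Oplus>i\<in>F. f i) = (if j \<in> F then f j else \<zero>)" if "finite F" "F \<subseteq> K" for F
      using that
    proof induct
      case (insert i F)
      have "f i \<in> D i" using insert f by auto
      then have "c j (f i) = (if i = j then f j else \<zero>)"
        using insert j c_same[of i "f i"] c_other[of j i "f i"] by auto
      moreover have "f \<in> F \<rightarrow> carrier G" using insert fc by auto
      ultimately show ?case using insert j fc by (auto simp: c_add)
    qed (use c0 j in simp)
    from this[OF f(2)] show ?thesis using x j by auto
  qed
  show ?thesis
    unfolding internal_direct_sum_def
  proof (intro conjI ballI)
    fix x assume x: "x \<in> carrier G"
    show "\<exists>!f. f \<in> Pi\<^sub>E K D \<and> finite {i \<in> K. f i \<noteq> \<zero>} \<and> x = (\<Oplus>i\<in>{i \<in> K. f i \<noteq> \<zero>}. f i)"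
    proof (rule ex_ex1I[OF ex[OF x]])
      fix f g
      assume f: "f \<in> Pi\<^sub>E K D \<and> finite {i \<in> K. f i \<noteq> \<zero>} \<and> x = (\<Oplus>i\<in>{i \<in> K. f i \<noteq> \<zero>}. f i)"
        and g: "g \<in> Pi\<^sub>E K D \<and> finite {i \<in> K. g i \<noteq> \<zero>} \<and> x = (\<Oplus>i\<in>{i \<in> K. g i \<noteq> \<zero>}. g i)"
      have "f j = g j" if "j \<in> K" for j
        using coord[of f x j] coord[of g x j] f g that by auto
      then show "f = g" using f g by (intro PiE_ext[of f K D g]) auto
    qed
  qed (rule sub)
qed

section \<open>Graded modules\<close>

text \<open>A subset that is closed under the coordinates contains the homogeneous parts of its
  elements. The structure \<open>A'\<close> only has to share its additive data with
  \<open>A\<close>, so the lemma serves both for restricted modules and for an ideal placed as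
  carrier in its ring.\<close>

lemma (in direct_sum) direct_sum_sub:
  fixes A' :: "('a, 'd) ring_scheme"
  assumes A': "carrier A' = B" "zero A' = \<zero>" "add A' = add A"
    and B: "B \<subseteq> carrier A" "\<zero> \<in> B" "\<And>x y. x \<in> B \<Longrightarrow> y \<in> B \<Longrightarrow> x \<oplus> y \<in> B"
      "\<And>x. x \<in> B \<Longrightarrow> \<ominus> x \<in> B" "\<And>i x. i \<in> K \<Longrightarrow> x \<in> B \<Longrightarrow> pr i x \<in> B"
  shows "abelian_group A'" "internal_direct_sum A' K (\<lambda>i. B \<inter> D i)"
proof -
  note [simp] = A'
  have Bc: "x \<in> carrier A" if "x \<in> B" for x using that B by auto
  interpret A': abelian_group A'
  proof (rule abelian_groupI)
    fix x assume "x \<in> carrier A'"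
    then show "\<exists>y\<in>carrier A'. y \<oplus>\<^bsub>A'\<^esub> x = \<zero>\<^bsub>A'\<^esub>"
      using B by (intro bexI[of _ "\<ominus> x"]) (auto simp: l_neg Bc)
  qed (auto simp: B Bc a_assoc intro: a_comm)
  show "abelian_group A'" by (rule A'.abelian_group_axioms)
  have neg: "\<ominus>\<^bsub>A'\<^esub> x = \<ominus> x" if "x \<in> B" for x
    using that B by (intro A'.minus_equality) (auto simp: l_neg Bc)
  show "internal_direct_sum A' K (\<lambda>i. B \<inter> D i)"
  proof (rule A'.internal_direct_sumI[where c = pr])
    fix i assume i: "i \<in> K"
    show "subgroup (B \<inter> D i) (add_monoid A')"
    proof (rule A'.add.subgroupI)
      show "B \<inter> D i \<noteq> {}" using i B comp_zero by auto
    qed (use i B comp_neg comp_add neg in \<open>auto simp: a_inv_def[symmetric]\<close>)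
  next
    fix x assume x: "x \<in> carrier A'"
    \<comment> \<open>A span depends only on zero and addition, which the two structures have in
      common.\<close>
    have "add_span A (\<Union>i\<in>K. B \<inter> D i) = add_span A' (\<Union>i\<in>K. B \<inter> D i)"
      (is "?l = ?r")
    proof (intro Set.set_eqI iffI)
      fix z show "z \<in> ?r" if "z \<in> ?l" using that
        by induct (use add_span.zero[of A'] add_span.add[of _ _ _ A'] in auto)
      show "z \<in> ?l" if "z \<in> ?r" using that
        by induct (use add_span.zero[of A] add_span.add[of _ _ _ A] in auto)
    qed
    moreover have "x \<in> ?l"
    proof (rule span_pr)
      fix i assume i: "i \<in> K"
      then have "pr i x \<in> B \<inter> D i" using x B(5) Bc pr_comp by simp
      then show "pr i x \<in> (\<Union>i\<in>K. B \<inter> D i)" using i by blast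
    qed (use x B Bc in auto)
    ultimately show "x \<in> ?r" by simp
  qed (use B Bc in \<open>auto simp: pr_add pr_same pr_other\<close>)
qed

section \<open>Left modules, submodules and saturation\<close>

locale lmod = R: ring R + X: abelian_group X + left_module R X
  for R :: "('r, 'c) ring_scheme" and X :: "('r, 'x, 'd) module_scheme"

context lmod
begin

lemma smult_zero_r [simp]: "a \<in> carrier R \<Longrightarrow> a \<odot>\<^bsub>X\<^esub> \<zero>\<^bsub>X\<^esub> = \<zero>\<^bsub>X\<^esub>"
  using smult_r_distr[of a "\<zero>\<^bsub>X\<^esub>" "\<zero>\<^bsub>X\<^esub>"] smult_closed[of a "\<zero>\<^bsub>X\<^esub>"]
  by (metis X.add.r_cancel_one X.l_zero X.zero_closed)

lemma smult_zero_l [simp]: "x \<in> carrier X \<Longrightarrow> \<zero>\<^bsub>R\<^esub> \<odot>\<^bsub>X\<^esub> x = \<zero>\<^bsub>X\<^esub>"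
  using smult_l_distr[of "\<zero>\<^bsub>R\<^esub>" "\<zero>\<^bsub>R\<^esub>" x] smult_closed[of "\<zero>\<^bsub>R\<^esub>" x]
  by (metis X.add.r_cancel_one R.l_zero R.zero_closed)

lemma smult_minus_one:
  assumes x: "x \<in> carrier X"
  shows "(\<ominus>\<^bsub>R\<^esub> \<one>\<^bsub>R\<^esub>) \<odot>\<^bsub>X\<^esub> x = \<ominus>\<^bsub>X\<^esub> x"
proof (rule X.minus_equality[symmetric])
  have "(\<ominus>\<^bsub>R\<^esub> \<one>\<^bsub>R\<^esub>) \<odot>\<^bsub>X\<^esub> x \<oplus>\<^bsub>X\<^esub> \<one>\<^bsub>R\<^esub> \<odot>\<^bsub>X\<^esub> x = \<zero>\<^bsub>X\<^esub>"
    using x by (subst smult_l_distr[symmetric]) (auto simp: R.l_neg)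
  then show "(\<ominus>\<^bsub>R\<^esub> \<one>\<^bsub>R\<^esub>) \<odot>\<^bsub>X\<^esub> x \<oplus>\<^bsub>X\<^esub> x = \<zero>\<^bsub>X\<^esub>" using x by (simp add: smult_one)
qed (use x in \<open>auto intro: smult_closed\<close>)

end

text \<open>Negatives are not mentioned because they are multiples by -1; see
  \<open>submodule_neg\<close>.\<close>

definition is_submodule :: "('r, 'c) ring_scheme \<Rightarrow> ('r, 'x, 'd) module_scheme \<Rightarrow> 'x set \<Rightarrow> bool" where
  "is_submodule R X B \<longleftrightarrow> B \<subseteq> carrier X \<and> \<zero>\<^bsub>X\<^esub> \<in> B \<and>
     (\<forall>x\<in>B. \<forall>y\<in>B. x \<oplus>\<^bsub>X\<^esub> y \<in> B) \<and> (\<forall>a\<in>carrier R. \<forall>x\<in>B. a \<odot>\<^bsub>X\<^esub> x \<in> B)"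

lemma is_submoduleD:
  assumes "is_submodule R X B"
  shows "\<And>x. x \<in> B \<Longrightarrow> x \<in> carrier X" "\<zero>\<^bsub>X\<^esub> \<in> B"
    "\<And>x y. x \<in> B \<Longrightarrow> y \<in> B \<Longrightarrow> x \<oplus>\<^bsub>X\<^esub> y \<in> B"
    "\<And>a x. a \<in> carrier R \<Longrightarrow> x \<in> B \<Longrightarrow> a \<odot>\<^bsub>X\<^esub> x \<in> B"
  using assms by (auto simp: is_submodule_def)

lemma (in lmod) submodule_neg: "\<lbrakk>is_submodule R X B; x \<in> B\<rbrakk> \<Longrightarrow> \<ominus>\<^bsub>X\<^esub> x \<in> B"
  using smult_minus_one[of x] is_submoduleD(1,4)[of R X B]
  by (metis R.add.inv_closed R.one_closed a_inv_def)

text \<open>For \<open>B = {0}\<close> this is the \<open>I\<close>-torsion part of \<open>X\<close>.  No transfinite iteration over graded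
  subobjects is needed, because the step is stated for single, not necessarily homogeneous, elements.\<close>

inductive_set saturation :: "'r set \<Rightarrow> ('r, 'x, 'd) module_scheme \<Rightarrow> 'x set \<Rightarrow> 'x set"
  for I X B where
    base: "x \<in> B \<Longrightarrow> x \<in> saturation I X B"
  | step: "\<lbrakk>x \<in> carrier X; \<And>a. a \<in> I \<Longrightarrow> a \<odot>\<^bsub>X\<^esub> x \<in> saturation I X B\<rbrakk> \<Longrightarrow> x \<in> saturation I X B"

text \<open>For a sum x + y the two summands may be reached at different stages. The induction is on
  x with y arbitrary: for a in I the element ax is reached earlier, while ay is still in the
  saturation by \<open>smultI\<close>. The case x in \<open>B\<close> needs its own induction on y,
  which is \<open>add0\<close>. For scalars, a(rx) = (ar)x with ar again in I.\<close>

lemma (in lmod) saturation_submodule: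
  assumes I: "ideal I R" and B: "is_submodule R X B"
  shows "is_submodule R X (saturation I X B)"
proof -
  note Bs = is_submoduleD[OF B]
  have IR: "a \<in> carrier R" if "a \<in> I" for a using ideal.Icarr[OF I that] .
  have carr: "x \<in> carrier X" if "x \<in> saturation I X B" for x
    using that by induct (simp_all add: Bs(1))
  have smultI: "a \<odot>\<^bsub>X\<^esub> x \<in> saturation I X B" if "x \<in> saturation I X B" "a \<in> I" for a x
    using that(1)
  proof cases
    case base
    then show ?thesis using that(2) by (intro saturation.base Bs(4) IR)
  next
    case step
    then show ?thesis using that(2) by blast
  qed
  have add0: "\<And>x. x \<in> B \<Longrightarrow> x \<oplus>\<^bsub>X\<^esub> y \<in> saturation I X B" if "y \<in> saturation I X B" for y
    using that
  proof induct
    case (base y)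
    then show ?case by (intro saturation.base Bs(3))
  next
    case (step y)
    show ?case
    proof (rule saturation.step)
      fix a assume a: "a \<in> I"
      have "a \<odot>\<^bsub>X\<^esub> (x \<oplus>\<^bsub>X\<^esub> y) = a \<odot>\<^bsub>X\<^esub> x \<oplus>\<^bsub>X\<^esub> a \<odot>\<^bsub>X\<^esub> y"
        using step a by (intro smult_r_distr IR) (auto simp: Bs(1))
      then show "a \<odot>\<^bsub>X\<^esub> (x \<oplus>\<^bsub>X\<^esub> y) \<in> saturation I X B"
        using step(3)[OF a Bs(4)[OF IR[OF a] step(4)]] by simp
    qed (use step in \<open>simp add: Bs(1)\<close>)
  qed
  have add: "\<And>y. y \<in> saturation I X B \<Longrightarrow> x \<oplus>\<^bsub>X\<^esub> y \<in> saturation I X B" if "x \<in> saturation I X B" for x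
    using that
  proof induct
    case (base x)
    then show ?case by (intro add0)
  next
    case (step x)
    show ?case
    proof (rule saturation.step)
      fix a assume a: "a \<in> I"
      have "a \<odot>\<^bsub>X\<^esub> (x \<oplus>\<^bsub>X\<^esub> y) = a \<odot>\<^bsub>X\<^esub> x \<oplus>\<^bsub>X\<^esub> a \<odot>\<^bsub>X\<^esub> y"
        using step a by (intro smult_r_distr IR) (auto simp: carr)
      then show "a \<odot>\<^bsub>X\<^esub> (x \<oplus>\<^bsub>X\<^esub> y) \<in> saturation I X B"
        using step(3)[OF a smultI[OF step(4) a]] by simp
    qed (use step in \<open>simp add: carr\<close>)
  qed
  have smult: "r \<odot>\<^bsub>X\<^esub> x \<in> saturation I X B" if "x \<in> saturation I X B" "r \<in> carrier R" for r x
    using that(1)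
  proof cases
    case base
    then show ?thesis using that(2) by (intro saturation.base Bs(4))
  next
    case step
    show ?thesis
    proof (rule saturation.step)
      fix a assume a: "a \<in> I"
      then have "a \<odot>\<^bsub>X\<^esub> (r \<odot>\<^bsub>X\<^esub> x) = (a \<otimes>\<^bsub>R\<^esub> r) \<odot>\<^bsub>X\<^esub> x"
        using that step(1) by (simp add: smult_assoc IR)
      then show "a \<odot>\<^bsub>X\<^esub> (r \<odot>\<^bsub>X\<^esub> x) \<in> saturation I X B"
        using step(2)[OF ideal.I_r_closed[OF I a that(2)]] by simp
    qed (use that step(1) in \<open>simp add: smult_closed\<close>)
  qed
  show ?thesis
    unfolding is_submodule_def using carr add smult saturation.base[OF Bs(2)] by blast
qed

text \<open>This is the home of graphs of partially defined morphisms from X to Y. It carries no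
  grading: graphs are saturated as plain submodules, and degrees are controlled by a separate
  induction.\<close>

definition product_module ::
    "('r, 'x, 'c) module_scheme \<Rightarrow> ('r, 'y, 'd) module_scheme \<Rightarrow> ('r, 'x \<times> 'y) module" where
  "product_module X Y = \<lparr>carrier = carrier X \<times> carrier Y, mult = undefined, one = undefined,
     zero = (\<zero>\<^bsub>X\<^esub>, \<zero>\<^bsub>Y\<^esub>), add = (\<lambda>u v. (fst u \<oplus>\<^bsub>X\<^esub> fst v, snd u \<oplus>\<^bsub>Y\<^esub> snd v)),
     smult = (\<lambda>a u. (a \<odot>\<^bsub>X\<^esub> fst u, a \<odot>\<^bsub>Y\<^esub> snd u))\<rparr>"

lemma product_module_simps [simp]:
  "carrier (product_module X Y) = carrier X \<times> carrier Y"
  "\<zero>\<^bsub>product_module X Y\<^esub> = (\<zero>\<^bsub>X\<^esub>, \<zero>\<^bsub>Y\<^esub>)"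
  "u \<oplus>\<^bsub>product_module X Y\<^esub> v = (fst u \<oplus>\<^bsub>X\<^esub> fst v, snd u \<oplus>\<^bsub>Y\<^esub> snd v)"
  "a \<odot>\<^bsub>product_module X Y\<^esub> u = (a \<odot>\<^bsub>X\<^esub> fst u, a \<odot>\<^bsub>Y\<^esub> snd u)"
  by (simp_all add: product_module_def)

lemma product_module_lmod:
  assumes "lmod R X" "lmod R Y"
  shows "lmod R (product_module X Y)"
proof -
  interpret X: lmod R X by fact
  interpret Y: lmod R Y by fact
  interpret P: abelian_group "product_module X Y"
  proof (rule abelian_groupI)
    fix u assume "u \<in> carrier (product_module X Y)"
    then show "\<exists>v\<in>carrier (product_module X Y). v \<oplus>\<^bsub>product_module X Y\<^esub> u = \<zero>\<^bsub>product_module X Y\<^esub>"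
      by (intro bexI[of _ "(\<ominus>\<^bsub>X\<^esub> fst u, \<ominus>\<^bsub>Y\<^esub> snd u)"]) (auto simp: X.X.l_neg Y.X.l_neg)
  qed (auto simp: X.X.a_assoc Y.X.a_assoc intro: X.X.a_comm Y.X.a_comm)
  show ?thesis
    by unfold_locales
      (auto simp: X.smult_closed Y.smult_closed X.smult_l_distr Y.smult_l_distr X.smult_r_distr
        Y.smult_r_distr X.smult_assoc Y.smult_assoc X.smult_one Y.smult_one)
qed

section \<open>Graded rings and modules with their coordinate maps\<close>

locale grring = G: group G + R: ring R + graded_ring G R
  for G :: "'g monoid" and R :: "('g, 'r) gring"
begin

sublocale R: direct_sum R "carrier G" "rcomp R"
  by unfold_locales (rule decomp)

end

lemma grringI: "graded_ring G R \<Longrightarrow> grring G R"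
  by (simp add: grring_def graded_ring_def)

text \<open>This adds no assumption to \<open>graded_module\<close>, as \<open>grmodI\<close> shows.
  The group, the ring and the module are imported under separate prefixes so that their facts and
  their coordinates \<open>pr\<close> can be told apart.\<close>

locale grmod = grring G R + X: abelian_group X + graded_module G R X
  for G :: "'g monoid" and R :: "('g, 'r) gring" and X :: "('g, 'r, 'x, 'd) gmodule_scheme"
begin

sublocale X: direct_sum X "carrier G" "mcomp X"
  by unfold_locales (rule module_decomp)

sublocale lmod R X
  by unfold_locales

end

lemma grmodI: "graded_module G R X \<Longrightarrow> grmod G R X"
  by (simp add: grmod_def graded_module_def left_module_def grringI)

lemma (in grmod) smult_pr:
  assumes "\<sigma> \<in> carrier G" "\<nu> \<in> carrier G" "a \<in> rcomp R \<sigma>" "x \<in> carrier X"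
  shows "a \<odot>\<^bsub>X\<^esub> X.pr \<nu> x = X.pr (\<sigma> \<otimes>\<^bsub>G\<^esub> \<nu>) (a \<odot>\<^bsub>X\<^esub> x)"
  using assms R.comp_carrier[of \<sigma> a]
  by (intro direct_sum_map[where \<pi> = "\<lambda>\<nu>. \<sigma> \<otimes>\<^bsub>G\<^esub> \<nu>"] X.direct_sum_axioms)
    (auto simp: smult_closed smult_r_distr smult_comp inj_on_def)

text \<open>Let e be the component of the identity in the neutral degree. For r of degree \<sigma>
  the product re is the component of degree \<sigma> of r1 = r, hence re = r. By additivity this
  holds for all r, and r = 1 gives e = 1.\<close>

lemma (in grring) one_comp: "\<one>\<^bsub>R\<^esub> \<in> rcomp R \<one>\<^bsub>G\<^esub>"
proof -
  let ?e = "R.pr \<one>\<^bsub>G\<^esub> \<one>\<^bsub>R\<^esub>"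
  have "r \<otimes>\<^bsub>R\<^esub> ?e = r" if "r \<in> carrier R" for r
    using that
  proof (induct rule: R.comp_induct)
    case (comp \<sigma> r)
    have "r \<otimes>\<^bsub>R\<^esub> ?e = R.pr (\<sigma> \<otimes>\<^bsub>G\<^esub> \<one>\<^bsub>G\<^esub>) (r \<otimes>\<^bsub>R\<^esub> \<one>\<^bsub>R\<^esub>)"
      using comp R.comp_carrier[of \<sigma> r]
      by (intro direct_sum_map[where \<pi> = "\<lambda>\<nu>. \<sigma> \<otimes>\<^bsub>G\<^esub> \<nu>"] R.direct_sum_axioms)
        (auto simp: mult_comp inj_on_def R.r_distr)
    then show ?case using comp R.comp_carrier[of \<sigma> r] by (simp add: R.pr_same)
  qed (auto simp: R.l_distr)
  from this[of "\<one>\<^bsub>R\<^esub>"] show ?thesis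
    using R.pr_comp[of "\<one>\<^bsub>G\<^esub>" "\<one>\<^bsub>R\<^esub>"] by simp
qed

text \<open>The map \<open>h\<close> need not be injective: the last assumption says that
  coordinates descend along \<open>h\<close>, so they can be computed on an arbitrary preimage. This
  treats isomorphic copies and quotients at once.\<close>

lemma graded_module_image:
  fixes X :: "('g, 'r, 'x, 'd) gmodule_scheme" and Y :: "('g, 'r, 'y, 'e) gmodule_scheme"
  assumes "graded_module G R X"
    and h: "carrier Y = h ` carrier X" "\<zero>\<^bsub>Y\<^esub> = h \<zero>\<^bsub>X\<^esub>"
      "\<And>x y. x \<in> carrier X \<Longrightarrow> y \<in> carrier X \<Longrightarrow> h x \<oplus>\<^bsub>Y\<^esub> h y = h (x \<oplus>\<^bsub>X\<^esub> y)"
      "\<And>a x. a \<in> carrier R \<Longrightarrow> x \<in> carrier X \<Longrightarrow> a \<odot>\<^bsub>Y\<^esub> h x = h (a \<odot>\<^bsub>X\<^esub> x)"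
      "\<And>\<nu>. \<nu> \<in> carrier G \<Longrightarrow> mcomp Y \<nu> = h ` mcomp X \<nu>"
    and pr: "\<And>x y \<nu>. x \<in> carrier X \<Longrightarrow> y \<in> carrier X \<Longrightarrow> h x = h y \<Longrightarrow> \<nu> \<in> carrier G \<Longrightarrow>
      h (direct_sum.pr X (carrier G) (mcomp X) \<nu> x) = h (direct_sum.pr X (carrier G) (mcomp X) \<nu> y)"
  shows "graded_module G R Y"
proof -
  interpret X: grmod G R X by (rule grmodI) fact
  interpret Y: abelian_group Y
  proof (rule abelian_groupI)
    fix y assume "y \<in> carrier Y"
    then obtain x where x: "x \<in> carrier X" "y = h x" using h by auto
    then show "\<exists>z\<in>carrier Y. z \<oplus>\<^bsub>Y\<^esub> y = \<zero>\<^bsub>Y\<^esub>"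
      using h by (intro bexI[of _ "h (\<ominus>\<^bsub>X\<^esub> x)"]) (auto simp: X.X.l_neg)
  qed (auto simp: h X.X.a_assoc intro: arg_cong[OF X.X.a_comm, of _ _ h])
  have neg: "\<ominus>\<^bsub>Y\<^esub> h x = h (\<ominus>\<^bsub>X\<^esub> x)" if "x \<in> carrier X" for x
    using that by (intro Y.minus_equality) (auto simp: h X.X.l_neg)
  note Xc = X.X.comp_carrier
  have mY: "mcomp Y \<nu> \<subseteq> carrier Y" if "\<nu> \<in> carrier G" for \<nu> using that h(1,5) Xc by auto
  have "internal_direct_sum Y (carrier G) (mcomp Y)"
  proof (rule Y.internal_direct_sumI[where c = "\<lambda>\<nu> y. h (X.X.pr \<nu> (inv_into (carrier X) h y))"])
    fix \<nu> assume \<nu>: "\<nu> \<in> carrier G"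
    show "subgroup (mcomp Y \<nu>) (add_monoid Y)"
    proof (rule Y.add.subgroupI)
      show "mcomp Y \<nu> \<noteq> {}" using \<nu> X.X.comp_zero[of \<nu>] h by auto
    qed (use \<nu> mY h(3,5) Xc X.X.comp_neg X.X.comp_add neg in \<open>auto simp: a_inv_def[symmetric]\<close>)
  next
    fix y assume "y \<in> carrier Y"
    then obtain x where x: "x \<in> carrier X" "y = h x" using h by auto
    show "y \<in> add_span Y (\<Union>\<nu>\<in>carrier G. mcomp Y \<nu>)"
      unfolding x(2) using x(1)
    proof (induct rule: X.X.comp_induct)
      case zero
      then show ?case using add_span.zero[of Y] by (simp add: h(2))
    next
      case (comp \<nu> x)
      then show ?case using h(1,5) Xc by (intro Y.add_span_incl) auto
    next
      case (add x y)
      then show ?case using Y.add_span_add[of "\<Union>\<nu>\<in>carrier G. mcomp Y \<nu>" "h x" "h y"] mY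
        by (auto simp: h(3))
    qed
  next
    have rep: "inv_into (carrier X) h (h x) \<in> carrier X" "h (inv_into (carrier X) h (h x)) = h x"
      if "x \<in> carrier X" for x
      using that by (auto intro: inv_into_into f_inv_into_f)
    have c: "h (X.X.pr \<nu> (inv_into (carrier X) h (h x))) = h (X.X.pr \<nu> x)"
      if "x \<in> carrier X" "\<nu> \<in> carrier G" for x \<nu>
      using that rep by (intro pr) auto
    show "h (X.X.pr \<nu> (inv_into (carrier X) h y)) \<in> carrier Y"
      if "\<nu> \<in> carrier G" "y \<in> carrier Y" for \<nu> y
      using that by (auto simp: h(1) c)
    show "h (X.X.pr \<nu> (inv_into (carrier X) h (y \<oplus>\<^bsub>Y\<^esub> z))) =
        h (X.X.pr \<nu> (inv_into (carrier X) h y)) \<oplus>\<^bsub>Y\<^esub> h (X.X.pr \<nu> (inv_into (carrier X) h z))"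
      if "\<nu> \<in> carrier G" "y \<in> carrier Y" "z \<in> carrier Y" for \<nu> y z
      using that by (auto simp: h(1,3) c X.X.pr_add)
    show "h (X.X.pr \<nu> (inv_into (carrier X) h y)) = y"
      if "\<nu> \<in> carrier G" "y \<in> mcomp Y \<nu>" for \<nu> y
      using that by (auto simp: h(5) c Xc X.X.pr_same)
    show "h (X.X.pr \<nu> (inv_into (carrier X) h y)) = \<zero>\<^bsub>Y\<^esub>"
      if "\<nu> \<in> carrier G" "\<mu> \<in> carrier G" "\<nu> \<noteq> \<mu>" "y \<in> mcomp Y \<mu>" for \<nu> \<mu> y
      using that by (auto simp: h(2,5) c[OF Xc[of \<mu>]] X.X.pr_other)
  qed
  then show ?thesis
    by unfold_locales
      (auto simp: h(1,3,4,5) X.smult_closed X.smult_l_distr X.smult_r_distr X.smult_assoc X.smult_one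
        Xc X.R.comp_carrier X.smult_comp)
qed

definition graded_submodule ::
    "'g monoid \<Rightarrow> ('g, 'r) gring \<Rightarrow> ('g, 'r, 'x, 'd) gmodule_scheme \<Rightarrow> 'x set \<Rightarrow> bool" where
  "graded_submodule G R X B \<longleftrightarrow> is_submodule R X B \<and>
     (\<forall>\<nu>\<in>carrier G. \<forall>x\<in>B. direct_sum.pr X (carrier G) (mcomp X) \<nu> x \<in> B)"

definition submodule_restrict ::
    "('g, 'r, 'x, 'd) gmodule_scheme \<Rightarrow> 'x set \<Rightarrow> ('g, 'r, 'x, 'd) gmodule_scheme" where
  "submodule_restrict X B = X\<lparr>carrier := B, mcomp := \<lambda>\<nu>. B \<inter> mcomp X \<nu>\<rparr>"

lemma submodule_restrict_simps [simp]:
  "carrier (submodule_restrict X B) = B"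
  "\<zero>\<^bsub>submodule_restrict X B\<^esub> = \<zero>\<^bsub>X\<^esub>"
  "add (submodule_restrict X B) = add X"
  "smult (submodule_restrict X B) = smult X"
  "mcomp (submodule_restrict X B) = (\<lambda>\<nu>. B \<inter> mcomp X \<nu>)"
  by (simp_all add: submodule_restrict_def)

lemma (in grmod) submodule_restrict:
  assumes "graded_submodule G R X B"
  shows "graded_module G R (submodule_restrict X B)"
proof -
  have B: "is_submodule R X B" "\<And>\<nu> x. \<nu> \<in> carrier G \<Longrightarrow> x \<in> B \<Longrightarrow> X.pr \<nu> x \<in> B"
    using assms by (auto simp: graded_submodule_def)
  note Bs = is_submoduleD[OF B(1)]
  have sub: "abelian_group (submodule_restrict X B)"
    "internal_direct_sum (submodule_restrict X B) (carrier G) (\<lambda>\<nu>. B \<inter> mcomp X \<nu>)"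
    by (rule X.direct_sum_sub[of _ B]; use Bs B submodule_neg in auto)+
  interpret B: abelian_group "submodule_restrict X B" by (rule sub)
  show ?thesis
    by unfold_locales
      (use sub(2) in \<open>auto simp: Bs smult_l_distr smult_r_distr smult_assoc smult_one R.comp_carrier smult_comp\<close>)
qed

text \<open>The regular module with degrees shifted so that right multiplication by an element of degree
  \<open>\<sigma>\<close> has degree zero.\<close>

definition shifted_regular :: "'g monoid \<Rightarrow> ('g, 'r) gring \<Rightarrow> 'g \<Rightarrow> ('g, 'r, 'r) gmodule" where
  "shifted_regular G R \<sigma> = \<lparr>carrier = carrier R, mult = undefined, one = undefined,
     zero = \<zero>\<^bsub>R\<^esub>, add = add R, smult = mult R, mcomp = \<lambda>\<nu>. rcomp R (\<nu> \<otimes>\<^bsub>G\<^esub> inv\<^bsub>G\<^esub> \<sigma>)\<rparr>"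

lemma shifted_regular_simps [simp]:
  "carrier (shifted_regular G R \<sigma>) = carrier R"
  "\<zero>\<^bsub>shifted_regular G R \<sigma>\<^esub> = \<zero>\<^bsub>R\<^esub>"
  "add (shifted_regular G R \<sigma>) = add R"
  "smult (shifted_regular G R \<sigma>) = mult R"
  "mcomp (shifted_regular G R \<sigma>) = (\<lambda>\<nu>. rcomp R (\<nu> \<otimes>\<^bsub>G\<^esub> inv\<^bsub>G\<^esub> \<sigma>))"
  by (simp_all add: shifted_regular_def)

context grring
begin

text \<open>Right translation by the inverse of \<sigma> permutes the degrees and commutes with left
  translation, so left multiplication keeps its degrees.\<close>

lemma shifted_regular_graded:
  assumes \<sigma>: "\<sigma> \<in> carrier G"
  shows "graded_module G R (shifted_regular G R \<sigma>)"
    "\<lbrakk>\<nu> \<in> carrier G; a \<in> carrier R\<rbrakk> \<Longrightarrow>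
      direct_sum.pr (shifted_regular G R \<sigma>) (carrier G) (mcomp (shifted_regular G R \<sigma>)) \<nu> a =
      R.pr (\<nu> \<otimes>\<^bsub>G\<^esub> inv\<^bsub>G\<^esub> \<sigma>) a"
proof -
  let ?X = "shifted_regular G R \<sigma>"
  interpret X: abelian_group ?X
  proof (rule abelian_groupI)
    fix x assume "x \<in> carrier ?X"
    then show "\<exists>y\<in>carrier ?X. y \<oplus>\<^bsub>?X\<^esub> x = \<zero>\<^bsub>?X\<^esub>"
      by (intro bexI[of _ "\<ominus>\<^bsub>R\<^esub> x"]) (auto simp: R.l_neg)
  qed (auto simp: R.a_assoc intro: R.a_comm)
  have neg: "\<ominus>\<^bsub>?X\<^esub> x = \<ominus>\<^bsub>R\<^esub> x" if "x \<in> carrier R" for x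
    using that by (intro X.minus_equality) (auto simp: R.l_neg)
  have span: "x \<in> add_span ?X B" if "x \<in> add_span R B" for x B
    using that by induct (use add_span.zero[of ?X] add_span.add[of _ _ _ ?X] in auto)
  have comp_carr: "a \<in> carrier R" if "\<nu> \<in> carrier G" "a \<in> rcomp R (\<nu> \<otimes>\<^bsub>G\<^esub> inv\<^bsub>G\<^esub> \<sigma>)" for \<nu> a
    using that \<sigma> R.comp_carrier[of "\<nu> \<otimes>\<^bsub>G\<^esub> inv\<^bsub>G\<^esub> \<sigma>" a] by simp
  have ids: "internal_direct_sum ?X (carrier G) (mcomp ?X)"
  proof (rule X.internal_direct_sumI[where c = "\<lambda>\<nu>. R.pr (\<nu> \<otimes>\<^bsub>G\<^esub> inv\<^bsub>G\<^esub> \<sigma>)"])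
    fix \<nu> assume \<nu>: "\<nu> \<in> carrier G"
    then have s: "\<nu> \<otimes>\<^bsub>G\<^esub> inv\<^bsub>G\<^esub> \<sigma> \<in> carrier G" using \<sigma> by simp
    show "subgroup (mcomp ?X \<nu>) (add_monoid ?X)"
    proof (rule X.add.subgroupI)
      show "mcomp ?X \<nu> \<noteq> {}" using \<nu> \<sigma> R.comp_zero[of "\<nu> \<otimes>\<^bsub>G\<^esub> inv\<^bsub>G\<^esub> \<sigma>"] by auto
    qed (use R.comp_neg[OF s] R.comp_add[OF s] R.comp_carrier[OF s] neg in \<open>auto simp: a_inv_def[symmetric]\<close>)
  next
    fix x assume x: "x \<in> carrier ?X"
    show "x \<in> add_span ?X (\<Union>\<nu>\<in>carrier G. mcomp ?X \<nu>)"
    proof (rule span, rule R.span_pr)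
      fix \<nu> assume \<nu>: "\<nu> \<in> carrier G"
      \<comment> \<open>The old component of degree \<nu> is the new one of degree \<nu> times
        \<sigma>.\<close>
      then have "\<nu> = (\<nu> \<otimes>\<^bsub>G\<^esub> \<sigma>) \<otimes>\<^bsub>G\<^esub> inv\<^bsub>G\<^esub> \<sigma>" using \<sigma> by (simp add: G.m_assoc)
      then show "R.pr \<nu> x \<in> (\<Union>\<nu>\<in>carrier G. mcomp ?X \<nu>)"
        using R.pr_comp[of \<nu> x] \<nu> \<sigma> x by (auto intro!: bexI[of _ "\<nu> \<otimes>\<^bsub>G\<^esub> \<sigma>"])
    qed (use \<sigma> x comp_carr in auto)
  next
    fix \<nu> \<mu> x assume "\<nu> \<in> carrier G" "\<mu> \<in> carrier G" "\<nu> \<noteq> \<mu>" "x \<in> mcomp ?X \<mu>"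
    then show "R.pr (\<nu> \<otimes>\<^bsub>G\<^esub> inv\<^bsub>G\<^esub> \<sigma>) x = \<zero>\<^bsub>?X\<^esub>"
      using \<sigma> R.pr_other[of "\<nu> \<otimes>\<^bsub>G\<^esub> inv\<^bsub>G\<^esub> \<sigma>" "\<mu> \<otimes>\<^bsub>G\<^esub> inv\<^bsub>G\<^esub> \<sigma>" x] by simp
  qed (use \<sigma> in \<open>auto simp: R.pr_add R.pr_same\<close>)
  show "graded_module G R ?X"
  proof unfold_locales
    fix \<tau> \<nu> a x
    assume "\<tau> \<in> carrier G" "\<nu> \<in> carrier G" "a \<in> rcomp R \<tau>" "x \<in> mcomp ?X \<nu>"
    then show "a \<odot>\<^bsub>?X\<^esub> x \<in> mcomp ?X (\<tau> \<otimes>\<^bsub>G\<^esub> \<nu>)"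
      using \<sigma> mult_comp[of \<tau> "\<nu> \<otimes>\<^bsub>G\<^esub> inv\<^bsub>G\<^esub> \<sigma>" a x] by (simp add: G.m_assoc)
  qed (use ids in \<open>auto simp: R.l_distr R.r_distr R.m_assoc\<close>)
  interpret X: direct_sum ?X "carrier G" "mcomp ?X"
    by unfold_locales (rule ids)
  show "X.pr \<nu> a = R.pr (\<nu> \<otimes>\<^bsub>G\<^esub> inv\<^bsub>G\<^esub> \<sigma>) a" if "\<nu> \<in> carrier G" "a \<in> carrier R"
    using that \<sigma>
    by (intro direct_sum_map[where T = "\<lambda>x. x" and \<pi> = "\<lambda>\<nu>. \<nu> \<otimes>\<^bsub>G\<^esub> inv\<^bsub>G\<^esub> \<sigma>"])
      (use X.direct_sum_axioms in \<open>auto simp: R.direct_sum_axioms inj_on_def\<close>)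
qed

end

section \<open>Transport, graded morphisms and the torsion class of an ideal\<close>

lemma (in direct_sum) pr_minus:
  assumes "i \<in> K" "x \<in> carrier A" "y \<in> carrier A"
  shows "pr i (x \<ominus> y) = pr i x \<ominus> pr i y"
proof -
  have "pr i (x \<ominus> y) \<oplus> pr i y = pr i (x \<ominus> y \<oplus> y)"
    using assms by (simp add: pr_add)
  also have "x \<ominus> y \<oplus> y = x"
    using assms by (simp add: a_minus_def a_assoc l_neg)
  finally have "pr i (x \<ominus> y) \<oplus> pr i y = pr i x" .
  then show ?thesis
    using assms by (metis a_minus_def add.inv_solve_right' minus_closed pr_closed a_inv_def)
qed

lemma (in lmod) smult_minus:
  assumes "a \<in> carrier R" "x \<in> carrier X" "y \<in> carrier X"
  shows "a \<odot>\<^bsub>X\<^esub> (x \<ominus>\<^bsub>X\<^esub> y) = a \<odot>\<^bsub>X\<^esub> x \<ominus>\<^bsub>X\<^esub> a \<odot>\<^bsub>X\<^esub> y"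
proof -
  have "a \<odot>\<^bsub>X\<^esub> (x \<ominus>\<^bsub>X\<^esub> y) \<oplus>\<^bsub>X\<^esub> a \<odot>\<^bsub>X\<^esub> y = a \<odot>\<^bsub>X\<^esub> (x \<ominus>\<^bsub>X\<^esub> y \<oplus>\<^bsub>X\<^esub> y)"
    using assms by (simp add: smult_r_distr)
  also have "x \<ominus>\<^bsub>X\<^esub> y \<oplus>\<^bsub>X\<^esub> y = x"
    using assms by (simp add: a_minus_def X.a_assoc X.l_neg)
  finally have "a \<odot>\<^bsub>X\<^esub> (x \<ominus>\<^bsub>X\<^esub> y) \<oplus>\<^bsub>X\<^esub> a \<odot>\<^bsub>X\<^esub> y = a \<odot>\<^bsub>X\<^esub> x" .
  then show ?thesis
    using assms by (metis a_minus_def X.add.inv_solve_right' X.minus_closed smult_closed a_inv_def)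
qed

lemma (in abelian_group) diff_add:
  assumes "x \<in> carrier G" "y \<in> carrier G" "x' \<in> carrier G" "y' \<in> carrier G"
  shows "(x \<oplus> y) \<ominus> (x' \<oplus> y') = (x \<ominus> x') \<oplus> (y \<ominus> y')"
  using assms by (simp add: a_minus_def minus_add a_ac)

section \<open>Copies and quotients of graded modules inside a given type\<close>

lemma transport_simps [simp]:
  "carrier (transport e A) = e ` carrier A"
  "\<zero>\<^bsub>transport e A\<^esub> = e \<zero>\<^bsub>A\<^esub>"
  "mcomp (transport e A) = (\<lambda>\<sigma>. e ` mcomp A \<sigma>)"
  by (simp_all add: transport_def)

text \<open>For a map \<open>e\<close> whose fibres are the cosets of a submodule, \<open>transport\<close> yields a copy of the
  quotient module, since \<open>inv_into\<close> then chooses coset representatives.\<close>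

lemma transport_quotient:
  fixes X :: "('g, 'r, 'x) gmodule"
  assumes X: "graded_module G R X" and K: "graded_submodule G R X K"
    and e: "\<And>x y. x \<in> carrier X \<Longrightarrow> y \<in> carrier X \<Longrightarrow> e x = e y \<longleftrightarrow> x \<ominus>\<^bsub>X\<^esub> y \<in> K"
  shows "\<And>x y. x \<in> carrier X \<Longrightarrow> y \<in> carrier X \<Longrightarrow> e x \<oplus>\<^bsub>transport e X\<^esub> e y = e (x \<oplus>\<^bsub>X\<^esub> y)"
    and "\<And>a x. a \<in> carrier R \<Longrightarrow> x \<in> carrier X \<Longrightarrow> a \<odot>\<^bsub>transport e X\<^esub> e x = e (a \<odot>\<^bsub>X\<^esub> x)"
    and "graded_module G R (transport e X)"
proof -
  interpret X: grmod G R X by (rule grmodI) fact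
  have sub: "is_submodule R X K" using K by (simp add: graded_submodule_def)
  note Ks = is_submoduleD[OF sub]
  have rep: "inv_into (carrier X) e (e x) \<in> carrier X" "inv_into (carrier X) e (e x) \<ominus>\<^bsub>X\<^esub> x \<in> K"
    if "x \<in> carrier X" for x
  proof -
    have "e (inv_into (carrier X) e (e x)) = e x" "inv_into (carrier X) e (e x) \<in> carrier X"
      using that by (auto intro: inv_into_into f_inv_into_f)
    then show "inv_into (carrier X) e (e x) \<in> carrier X" "inv_into (carrier X) e (e x) \<ominus>\<^bsub>X\<^esub> x \<in> K"
      using e that by auto
  qed
  show add: "e x \<oplus>\<^bsub>transport e X\<^esub> e y = e (x \<oplus>\<^bsub>X\<^esub> y)" if "x \<in> carrier X" "y \<in> carrier X" for x y
    using that rep[OF that(1)] rep[OF that(2)]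
    by (simp add: transport_def e X.X.diff_add Ks(3))
  show smult: "a \<odot>\<^bsub>transport e X\<^esub> e x = e (a \<odot>\<^bsub>X\<^esub> x)" if "a \<in> carrier R" "x \<in> carrier X" for a x
    using that rep[OF that(2)]
    by (simp add: transport_def e X.smult_closed Ks(4) flip: X.smult_minus)
  show "graded_module G R (transport e X)"
  proof (rule graded_module_image[OF X])
    fix x y \<nu> assume *: "x \<in> carrier X" "y \<in> carrier X" "e x = e y" "\<nu> \<in> carrier G"
    then have "X.X.pr \<nu> (x \<ominus>\<^bsub>X\<^esub> y) \<in> K"
      using K e by (auto simp: graded_submodule_def)
    then show "e (X.X.pr \<nu> x) = e (X.X.pr \<nu> y)"
      using * by (simp add: e X.X.pr_minus)
  qed (auto simp: add smult)
qed

lemma (in grmod) zero_graded_submodule: "graded_submodule G R X {\<zero>\<^bsub>X\<^esub>}"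
  by (auto simp: graded_submodule_def is_submodule_def)

text \<open>The fibres of an injective map are the cosets of the zero submodule.\<close>

lemma transport_inj:
  fixes X :: "('g, 'r, 'x) gmodule"
  assumes X: "graded_module G R X" and e: "inj_on e (carrier X)"
  shows "\<And>x y. x \<in> carrier X \<Longrightarrow> y \<in> carrier X \<Longrightarrow> e x \<oplus>\<^bsub>transport e X\<^esub> e y = e (x \<oplus>\<^bsub>X\<^esub> y)"
    and "\<And>a x. a \<in> carrier R \<Longrightarrow> x \<in> carrier X \<Longrightarrow> a \<odot>\<^bsub>transport e X\<^esub> e x = e (a \<odot>\<^bsub>X\<^esub> x)"
    and "graded_module G R (transport e X)"
proof -
  interpret X: grmod G R X by (rule grmodI) fact
  have "e x = e y \<longleftrightarrow> x \<ominus>\<^bsub>X\<^esub> y \<in> {\<zero>\<^bsub>X\<^esub>}" if "x \<in> carrier X" "y \<in> carrier X" for x y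
    using that e by (simp add: inj_on_eq_iff X.X.minus_eq_zero_iff)
  note * = transport_quotient[OF X X.zero_graded_submodule, of e, OF this]
  show "\<And>x y. x \<in> carrier X \<Longrightarrow> y \<in> carrier X \<Longrightarrow> e x \<oplus>\<^bsub>transport e X\<^esub> e y = e (x \<oplus>\<^bsub>X\<^esub> y)"
    "\<And>a x. a \<in> carrier R \<Longrightarrow> x \<in> carrier X \<Longrightarrow> a \<odot>\<^bsub>transport e X\<^esub> e x = e (a \<odot>\<^bsub>X\<^esub> x)"
    "graded_module G R (transport e X)"
    using * by blast+
qed

section \<open>Degree-preserving morphisms\<close>

lemma graded_homI:
  assumes "f \<in> extensional (carrier X)" "\<And>x. x \<in> carrier X \<Longrightarrow> f x \<in> carrier Y"
    "\<And>x y. x \<in> carrier X \<Longrightarrow> y \<in> carrier X \<Longrightarrow> f (x \<oplus>\<^bsub>X\<^esub> y) = f x \<oplus>\<^bsub>Y\<^esub> f y"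
    "\<And>a x. a \<in> carrier R \<Longrightarrow> x \<in> carrier X \<Longrightarrow> f (a \<odot>\<^bsub>X\<^esub> x) = a \<odot>\<^bsub>Y\<^esub> f x"
    "\<And>\<nu> x. \<nu> \<in> carrier G \<Longrightarrow> x \<in> mcomp X \<nu> \<Longrightarrow> f x \<in> mcomp Y \<nu>"
  shows "f \<in> graded_hom G R X Y"
  using assms by (auto simp: graded_hom_def linear_maps_def PiE_iff)

locale grhom = X: grmod G R X + Y: grmod G R Y
  for G :: "'g monoid" and R :: "('g, 'r) gring" and X :: "('g, 'r, 'x) gmodule"
    and Y :: "('g, 'r, 'y) gmodule" +
  fixes f :: "'x \<Rightarrow> 'y"
  assumes graded_hom: "f \<in> graded_hom G R X Y"
begin

lemma hom_closed [simp, intro]: "x \<in> carrier X \<Longrightarrow> f x \<in> carrier Y"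
  using graded_hom by (auto simp: graded_hom_def linear_maps_def)

lemma hom_add [simp]: "\<lbrakk>x \<in> carrier X; y \<in> carrier X\<rbrakk> \<Longrightarrow> f (x \<oplus>\<^bsub>X\<^esub> y) = f x \<oplus>\<^bsub>Y\<^esub> f y"
  using graded_hom by (auto simp: graded_hom_def linear_maps_def)

lemma hom_smult [simp]: "\<lbrakk>a \<in> carrier R; x \<in> carrier X\<rbrakk> \<Longrightarrow> f (a \<odot>\<^bsub>X\<^esub> x) = a \<odot>\<^bsub>Y\<^esub> f x"
  using graded_hom by (auto simp: graded_hom_def linear_maps_def)

lemma hom_comp: "\<lbrakk>\<nu> \<in> carrier G; x \<in> mcomp X \<nu>\<rbrakk> \<Longrightarrow> f x \<in> mcomp Y \<nu>"
  using graded_hom by (auto simp: graded_hom_def linear_maps_def)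

lemma hom_extensional: "f \<in> extensional (carrier X)"
  using graded_hom by (auto simp: graded_hom_def linear_maps_def PiE_def)

lemma hom_zero [simp]: "f \<zero>\<^bsub>X\<^esub> = \<zero>\<^bsub>Y\<^esub>"
  using hom_smult[of "\<zero>\<^bsub>R\<^esub>" "\<zero>\<^bsub>X\<^esub>"] by simp

lemma hom_pr: "\<lbrakk>\<nu> \<in> carrier G; x \<in> carrier X\<rbrakk> \<Longrightarrow> f (X.X.pr \<nu> x) = Y.X.pr \<nu> (f x)"
  by (rule direct_sum_map[where \<pi> = "\<lambda>\<nu>. \<nu>"])
    (auto simp: X.X.direct_sum_axioms Y.X.direct_sum_axioms hom_comp)

end

lemma grhomI:
  "\<lbrakk>graded_module G R X; graded_module G R Y; f \<in> graded_hom G R X Y\<rbrakk> \<Longrightarrow> grhom G R X Y f"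
  by (simp add: grhom_def grhom_axioms_def grmodI)

lemma Obj_gr_cat: "Obj (gr_cat G R) = {X. graded_module G R X}"
  by (simp add: gr_cat_def)

section \<open>The torsion theory attached to an ideal\<close>

definition torsion_free :: "'r set \<Rightarrow> ('g, 'r, 'x) gmodule \<Rightarrow> bool" where
  "torsion_free I X \<longleftrightarrow> (\<forall>x\<in>carrier X. (\<forall>a\<in>I. a \<odot>\<^bsub>X\<^esub> x = \<zero>\<^bsub>X\<^esub>) \<longrightarrow> x = \<zero>\<^bsub>X\<^esub>)"

text \<open>This is a condition of Baer type for the inclusion of I into R, in all degree shifts: a
  map of degree \<sigma> extends to R, and the extension is determined by the image x of 1, which
  has degree \<sigma>. The function \<open>g\<close> is constrained on I only.\<close>

definition ideal_maps_extend ::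
    "'g monoid \<Rightarrow> ('g, 'r) gring \<Rightarrow> 'r set \<Rightarrow> ('g, 'r, 'x) gmodule \<Rightarrow> bool" where
  "ideal_maps_extend G R I X \<longleftrightarrow> (\<forall>\<sigma>\<in>carrier G. \<forall>g.
     (\<forall>a\<in>I. g a \<in> carrier X) \<longrightarrow>
     (\<forall>a\<in>I. \<forall>b\<in>I. g (a \<oplus>\<^bsub>R\<^esub> b) = g a \<oplus>\<^bsub>X\<^esub> g b) \<longrightarrow>
     (\<forall>r\<in>carrier R. \<forall>a\<in>I. g (r \<otimes>\<^bsub>R\<^esub> a) = r \<odot>\<^bsub>X\<^esub> g a) \<longrightarrow>
     (\<forall>\<tau>\<in>carrier G. \<forall>a\<in>I \<inter> rcomp R \<tau>. g a \<in> mcomp X (\<tau> \<otimes>\<^bsub>G\<^esub> \<sigma>)) \<longrightarrow>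
     (\<exists>x\<in>mcomp X \<sigma>. \<forall>a\<in>I. g a = a \<odot>\<^bsub>X\<^esub> x))"

definition torsion_class ::
    "'g monoid \<Rightarrow> ('g, 'r) gring \<Rightarrow> 'r set \<Rightarrow> ('g, 'r, 'x) gmodule set" where
  "torsion_class G R I = {X. graded_module G R X \<and> carrier X \<subseteq> saturation I X {\<zero>\<^bsub>X\<^esub>}}"

lemma saturation_image:
  assumes "x \<in> saturation I X B" "\<And>x. x \<in> B \<Longrightarrow> f x \<in> C"
    "\<And>x. x \<in> carrier X \<Longrightarrow> f x \<in> carrier Y"
    "\<And>a x. a \<in> I \<Longrightarrow> x \<in> carrier X \<Longrightarrow> f (a \<odot>\<^bsub>X\<^esub> x) = a \<odot>\<^bsub>Y\<^esub> f x"
  shows "f x \<in> saturation I Y C"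
  using assms(1)
proof induct
  case (base x)
  then show ?case by (intro saturation.base assms)
next
  case (step x)
  show ?case
  proof (rule saturation.step)
    fix a assume "a \<in> I"
    then show "a \<odot>\<^bsub>Y\<^esub> f x \<in> saturation I Y C"
      using step assms(4)[of a x] by metis
  qed (use step assms(3) in simp)
qed

lemma torsion_free_saturation:
  assumes "torsion_free I X" "x \<in> saturation I X {\<zero>\<^bsub>X\<^esub>}"
  shows "x = \<zero>\<^bsub>X\<^esub>"
  using assms(2) by induct (use assms(1) in \<open>auto simp: torsion_free_def\<close>)

text \<open>The grading of the ideal is expressed by closure under the coordinates of R, the form in
  which it is used. The decomposition demanded by \<open>graded_ideal\<close> is recovered at the
  end.\<close>

locale gideal = grring G R for G :: "'g monoid" and R :: "('g, 'r) gring" +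
  fixes I :: "'r set"
  assumes ideal: "ideal I R" and ideal_pr: "\<And>\<nu> a. \<nu> \<in> carrier G \<Longrightarrow> a \<in> I \<Longrightarrow> R.pr \<nu> a \<in> I"
begin

lemma ideal_carrier [simp]: "a \<in> I \<Longrightarrow> a \<in> carrier R"
  using ideal.Icarr[OF ideal] .

lemma ideal_zero [simp]: "\<zero>\<^bsub>R\<^esub> \<in> I"
  using additive_subgroup.zero_closed[OF ideal.axioms(1)[OF ideal]] .

lemma ideal_add [simp]: "\<lbrakk>a \<in> I; b \<in> I\<rbrakk> \<Longrightarrow> a \<oplus>\<^bsub>R\<^esub> b \<in> I"
  using additive_subgroup.a_closed[OF ideal.axioms(1)[OF ideal]] .

lemma ideal_lmult [simp]: "\<lbrakk>r \<in> carrier R; a \<in> I\<rbrakk> \<Longrightarrow> r \<otimes>\<^bsub>R\<^esub> a \<in> I"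
  using ideal.I_l_closed[OF ideal] by blast

lemma ideal_rmult [simp]: "\<lbrakk>r \<in> carrier R; a \<in> I\<rbrakk> \<Longrightarrow> a \<otimes>\<^bsub>R\<^esub> r \<in> I"
  using ideal.I_r_closed[OF ideal] by blast

lemma ideal_induct [consumes 1, case_names zero comp add]:
  assumes "a \<in> I" "P \<zero>\<^bsub>R\<^esub>" "\<And>\<nu> a. \<nu> \<in> carrier G \<Longrightarrow> a \<in> I \<Longrightarrow> a \<in> rcomp R \<nu> \<Longrightarrow> P a"
    "\<And>a b. a \<in> I \<Longrightarrow> b \<in> I \<Longrightarrow> P a \<Longrightarrow> P b \<Longrightarrow> P (a \<oplus>\<^bsub>R\<^esub> b)"
  shows "P a"
proof -
  let ?B = "\<Union>\<nu>\<in>carrier G. I \<inter> rcomp R \<nu>"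
  have "a \<in> add_span R ?B"
  proof (rule R.span_pr)
    fix \<nu> assume \<nu>: "\<nu> \<in> carrier G"
    then have "R.pr \<nu> a \<in> I \<inter> rcomp R \<nu>"
      using assms(1) by (simp add: ideal_pr R.pr_comp)
    then show "R.pr \<nu> a \<in> ?B" using \<nu> by blast
  qed (use assms(1) in auto)
  then have "a \<in> I \<and> P a"
  proof induct
    case (add b x)
    then show ?case using assms(3)[of _ b] assms(4)[of b x] by auto
  qed (simp add: assms(2))
  then show ?thesis ..
qed

text \<open>Let \<mu> be a degree other than \<nu>, and let a in I have degree \<tau>. Then a times
  the component of x in degree \<mu> is the component of ax in degree \<tau>\<mu>. It vanishes
  because ax has degree \<tau>\<nu>. So I kills that component, which must be zero.\<close>

lemma torsion_free_homogeneous: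
  assumes X: "graded_module G R X" "torsion_free I X" and x: "x \<in> carrier X" and \<nu>: "\<nu> \<in> carrier G"
    and comp: "\<And>\<tau> a. \<tau> \<in> carrier G \<Longrightarrow> a \<in> I \<Longrightarrow> a \<in> rcomp R \<tau> \<Longrightarrow> a \<odot>\<^bsub>X\<^esub> x \<in> mcomp X (\<tau> \<otimes>\<^bsub>G\<^esub> \<nu>)"
  shows "x \<in> mcomp X \<nu>"
proof -
  interpret X: grmod G R X by (rule grmodI) fact
  have "X.X.pr \<mu> x = \<zero>\<^bsub>X\<^esub>" if \<mu>: "\<mu> \<in> carrier G" "\<mu> \<noteq> \<nu>" for \<mu>
  proof -
    have "a \<odot>\<^bsub>X\<^esub> X.X.pr \<mu> x = \<zero>\<^bsub>X\<^esub>" if "a \<in> I" for a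
      using that
    proof (induct rule: ideal_induct)
      case (comp \<tau> a)
      then show ?case
        using \<mu> \<nu> x assms(5)[of \<tau> a] X.X.pr_other[of "\<tau> \<otimes>\<^bsub>G\<^esub> \<mu>" "\<tau> \<otimes>\<^bsub>G\<^esub> \<nu>" "a \<odot>\<^bsub>X\<^esub> x"]
        by (simp add: X.smult_pr)
    qed (use \<mu> x in \<open>auto simp: X.smult_l_distr\<close>)
    then show ?thesis using X(2) \<mu> x by (simp add: torsion_free_def)
  qed
  then show ?thesis using X.X.comp_iff[OF \<nu> x] by blast
qed

text \<open>All closure properties are inductions along a saturation. It is pulled back along
  monomorphisms and pushed forward along epimorphisms. It absorbs direct sums because it is a
  submodule. In an extension it is lifted through \<open>p\<close>, starting from the image of the
  torsion subobject.\<close>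

lemma localizing_torsion_class: "localizing G R (torsion_class G R I :: ('g, 'r, 'u) gmodule set)"
proof -
  let ?L = "torsion_class G R I :: ('g, 'r, 'u) gmodule set"
  have sub: "Y \<in> ?L" if "X \<in> ?L" "graded_module G R Y" "f \<in> graded_hom G R Y X" "inj_on f (carrier Y)" for X Y f
  proof -
    interpret grhom G R Y X f
      using that by (intro grhomI) (auto simp: torsion_class_def)
    \<comment> \<open>The induction runs in the target while the claim concerns all preimages.
      Injectivity is used only over zero.\<close>
    have "\<forall>y\<in>carrier Y. f y = x \<longrightarrow> y \<in> saturation I Y {\<zero>\<^bsub>Y\<^esub>}" if "x \<in> saturation I X {\<zero>\<^bsub>X\<^esub>}" for x
      using that
    proof induct
      case (base x)
      then show ?case
        using \<open>inj_on f (carrier Y)\<close> hom_zero inj_onD[of f "carrier Y" _ "\<zero>\<^bsub>Y\<^esub>"]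
        by (auto intro!: saturation.base)
    next
      case (step x)
      show ?case
      proof (intro ballI impI, rule saturation.step)
        fix y a assume "y \<in> carrier Y" "f y = x" "a \<in> I"
        then show "a \<odot>\<^bsub>Y\<^esub> y \<in> saturation I Y {\<zero>\<^bsub>Y\<^esub>}"
          using step(3)[of a] X.smult_closed[of a y] by simp
      qed
    qed
    moreover have "f y \<in> saturation I X {\<zero>\<^bsub>X\<^esub>}" if "y \<in> carrier Y" for y
      using that \<open>X \<in> ?L\<close> by (auto simp: torsion_class_def)
    ultimately show ?thesis using that by (auto simp: torsion_class_def)
  qed
  have image: "f x \<in> saturation I Y {\<zero>\<^bsub>Y\<^esub>}"
    if "X \<in> ?L" "graded_module G R Y" "f \<in> graded_hom G R X Y" "x \<in> carrier X" for X Y f x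
  proof -
    interpret grhom G R X Y f
      using that by (intro grhomI) (auto simp: torsion_class_def)
    show ?thesis
      by (rule saturation_image[of x I X "{\<zero>\<^bsub>X\<^esub>}"]) (use that in \<open>auto simp: torsion_class_def\<close>)
  qed
  have quot: "Y \<in> ?L" if "X \<in> ?L" "graded_module G R Y" "f \<in> graded_hom G R X Y" "f ` carrier X = carrier Y" for X Y f
  proof -
    have "carrier Y \<subseteq> saturation I Y {\<zero>\<^bsub>Y\<^esub>}"
      unfolding that(4)[symmetric] using image[OF that(1-3)] by (rule image_subsetI)
    then show ?thesis using that by (auto simp: torsion_class_def)
  qed
  have sum: "D \<in> ?L"
    if D: "graded_module G R D" and X: "\<And>k. k \<in> K \<Longrightarrow> X k \<in> ?L \<and> \<iota> k \<in> gr_mono G R (X k) D"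
      and ids: "internal_direct_sum D K (\<lambda>k. \<iota> k ` carrier (X k))" for K :: "'u set" and X \<iota> D
  proof -
    interpret D: grmod G R D by (rule grmodI) fact
    interpret K: direct_sum D K "\<lambda>k. \<iota> k ` carrier (X k)"
      by unfold_locales fact
    have sat: "is_submodule R D (saturation I D {\<zero>\<^bsub>D\<^esub>})"
      using D.zero_graded_submodule by (intro D.saturation_submodule ideal) (simp add: graded_submodule_def)
    have "d \<in> saturation I D {\<zero>\<^bsub>D\<^esub>}" if "d \<in> carrier D" for d
      using that
    proof (induct rule: K.comp_induct)
      case (comp k d)
      then show ?case using X[OF comp(1)] image[OF _ D] by (auto simp: gr_mono_def)
    qed (auto simp: is_submoduleD[OF sat])
    then show ?thesis using D by (auto simp: torsion_class_def)
  qed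
  have ext: "X \<in> ?L"
    if X': "X' \<in> ?L" and X'': "X'' \<in> ?L" and X: "graded_module G R X" and ex: "short_exact G R X' i X p X''"
    for X X' X'' i p
  proof -
    interpret i: grhom G R X' X i
      using that by (intro grhomI) (auto simp: torsion_class_def short_exact_def gr_mono_def)
    interpret p: grhom G R X X'' p
      using that by (intro grhomI) (auto simp: torsion_class_def short_exact_def gr_epi_def)
    \<comment> \<open>Over zero the preimages come from X', whose elements are already known to be
      torsion. Over a later stage, multiplication by I leads to an earlier one.\<close>
    have "\<forall>x\<in>carrier X. p x = z \<longrightarrow> x \<in> saturation I X {\<zero>\<^bsub>X\<^esub>}" if "z \<in> saturation I X'' {\<zero>\<^bsub>X''\<^esub>}" for z
      using that
    proof induct
      case (base z)
      then have "x \<in> i ` carrier X'" if "x \<in> carrier X" "p x = z" for x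
        using that ex by (auto simp: short_exact_def)
      then show ?case
        using image[OF X' X i.graded_hom] by auto
    next
      case (step z)
      show ?case
      proof (intro ballI impI, rule saturation.step)
        fix x a assume "x \<in> carrier X" "p x = z" "a \<in> I"
        then show "a \<odot>\<^bsub>X\<^esub> x \<in> saturation I X {\<zero>\<^bsub>X\<^esub>}"
          using step(3)[of a] i.Y.smult_closed[of a x] by simp
      qed
    qed
    moreover have "p x \<in> saturation I X'' {\<zero>\<^bsub>X''\<^esub>}" if "x \<in> carrier X" for x
      using that X'' by (auto simp: torsion_class_def)
    ultimately show ?thesis using X by (auto simp: torsion_class_def)
  qed
  show ?thesis
    unfolding localizing_def Obj_gr_cat
  proof (intro conjI allI ballI impI)
    show "?L \<subseteq> {X. graded_module G R X}" by (auto simp: torsion_class_def)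
  next
    fix X Y assume "X \<in> ?L" "Y \<in> {X. graded_module G R X}" "gr_mono G R Y X \<noteq> {}"
    then show "Y \<in> ?L" using sub[of X Y] by (auto simp: gr_mono_def)
  next
    fix X Y assume "X \<in> ?L" "Y \<in> {X. graded_module G R X}" "gr_epi G R X Y \<noteq> {}"
    then show "Y \<in> ?L" using quot[of X Y] by (auto simp: gr_epi_def)
  next
    fix K :: "'u set" and X \<iota> D
    assume "D \<in> {X. graded_module G R X}" "(\<forall>k\<in>K. X k \<in> ?L \<and> \<iota> k \<in> gr_mono G R (X k) D) \<and>
      internal_direct_sum D K (\<lambda>k. \<iota> k ` carrier (X k))"
    then show "D \<in> ?L" by (intro sum[of D K X \<iota>]) auto
  next
    fix X' X'' X i p
    assume "X' \<in> ?L" "X'' \<in> ?L" "X \<in> {X. graded_module G R X}" "short_exact G R X' i X p X''"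
    then show "X \<in> ?L" by (intro ext[of X' X'' X i p]) auto
  qed
qed

lemma killed_by_torsion_class: "killed_by G R I \<subseteq> torsion_class G R I"
proof
  fix X :: "('g, 'r, 'x) gmodule" assume "X \<in> killed_by G R I"
  then have X: "graded_module G R X" "\<And>a x. a \<in> I \<Longrightarrow> x \<in> carrier X \<Longrightarrow> a \<odot>\<^bsub>X\<^esub> x = \<zero>\<^bsub>X\<^esub>"
    by (auto simp: killed_by_def gr_cat_def)
  have "x \<in> saturation I X {\<zero>\<^bsub>X\<^esub>}" if "x \<in> carrier X" for x
    by (rule saturation.step) (use that X(2) in \<open>auto intro: saturation.base\<close>)
  then show "X \<in> torsion_class G R I" using X(1) by (auto simp: torsion_class_def)
qed

text \<open>This bound and the next one are all that the characterization of closed objects uses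
  about C_I.\<close>

lemma loc_of_ideal_torsion: "loc_of_ideal G R I \<subseteq> torsion_class G R I"
  using localizing_torsion_class killed_by_torsion_class unfolding loc_of_ideal_def by blast

lemma killed_by_loc: "killed_by G R I \<subseteq> loc_of_ideal G R I"
  unfolding loc_of_ideal_def by blast

end

section \<open>Closed objects\<close>

definition torsion_closed :: "'g monoid \<Rightarrow> ('g, 'r) gring \<Rightarrow> 'r set \<Rightarrow> ('g, 'r, 'x) gmodule \<Rightarrow> bool" where
  "torsion_closed G R I X \<longleftrightarrow> graded_module G R X \<and> torsion_free I X \<and> ideal_maps_extend G R I X"

context gideal
begin

text \<open>The saturated graph \<Gamma> of the partial map sending i x to f x is single-valued and
  respects degrees because Q has no torsion. It is total because X'' is torsion and maps out of I
  into Q are multiplications. The extension is the function with graph \<Gamma>.\<close>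

lemma extend_along_torsion:
  assumes ex: "short_exact G R X' i X p X''" and X: "graded_module G R X'" "graded_module G R X"
    and X'': "X'' \<in> torsion_class G R I" and Q: "torsion_closed G R I Q" and f: "f \<in> graded_hom G R X' Q"
  shows "\<exists>h\<in>graded_hom G R X Q. compose (carrier X') h i = f"
proof -
  have grX'': "graded_module G R X''" and satX'': "carrier X'' \<subseteq> saturation I X'' {\<zero>\<^bsub>X''\<^esub>}"
    using X'' by (auto simp: torsion_class_def)
  have grQ: "graded_module G R Q" and tfQ: "torsion_free I Q" and extQ: "ideal_maps_extend G R I Q"
    using Q by (auto simp: torsion_closed_def)
  interpret X': grmod G R X' by (rule grmodI) fact
  interpret X: grmod G R X by (rule grmodI) fact
  interpret X'': grmod G R X'' by (rule grmodI) fact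
  interpret Q: grmod G R Q by (rule grmodI) fact
  interpret i: grhom G R X' X i
    using ex X by (intro grhomI) (auto simp: short_exact_def gr_mono_def)
  interpret p: grhom G R X X'' p
    using ex X grX'' by (intro grhomI) (auto simp: short_exact_def gr_epi_def)
  interpret f: grhom G R X' Q f
    using X grQ f by (intro grhomI)
  have inj: "inj_on i (carrier X')" using ex by (simp add: short_exact_def gr_mono_def)
  let ?P = "product_module X Q"
  let ?B = "(\<lambda>x. (i x, f x)) ` carrier X'"
  define \<Gamma> where "\<Gamma> = saturation I ?P ?B"
  interpret P: lmod R ?P
    by (rule product_module_lmod) unfold_locales
  have B_add: "u \<oplus>\<^bsub>?P\<^esub> v \<in> ?B" if uv: "u \<in> ?B" "v \<in> ?B" for u v
  proof -
    obtain x y where "x \<in> carrier X'" "y \<in> carrier X'" "u = (i x, f x)" "v = (i y, f y)"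
      using uv by auto
    then show ?thesis by (intro image_eqI[of _ _ "x \<oplus>\<^bsub>X'\<^esub> y"]) auto
  qed
  have B_smult: "a \<odot>\<^bsub>?P\<^esub> u \<in> ?B" if au: "a \<in> carrier R" "u \<in> ?B" for a u
  proof -
    obtain x where "x \<in> carrier X'" "u = (i x, f x)"
      using au by auto
    then show ?thesis using au by (intro image_eqI[of _ _ "a \<odot>\<^bsub>X'\<^esub> x"]) (auto intro: X'.smult_closed)
  qed
  have "is_submodule R ?P ?B"
    unfolding is_submodule_def
  proof (intro conjI ballI)
    show "\<zero>\<^bsub>?P\<^esub> \<in> ?B" by (intro image_eqI[of _ _ "\<zero>\<^bsub>X'\<^esub>"]) auto
  qed (use B_add B_smult in auto)
  then have sub: "is_submodule R ?P \<Gamma>"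
    unfolding \<Gamma>_def by (rule P.saturation_submodule[OF ideal])
  note \<Gamma>s = is_submoduleD[OF sub]
  have carr: "x \<in> carrier X" "q \<in> carrier Q" if "(x, q) \<in> \<Gamma>" for x q
    using \<Gamma>s(1)[OF that] by auto
  \<comment> \<open>In the step case u = (0, q), and every multiple (0, aq) lies in \<Gamma> at an
    earlier stage, so aq = 0 for all a in I. Torsion-freeness gives q = 0.\<close>
  have zero: "fst u = \<zero>\<^bsub>X\<^esub> \<longrightarrow> snd u = \<zero>\<^bsub>Q\<^esub>" if "u \<in> \<Gamma>" for u
    using that unfolding \<Gamma>_def
  proof induct
    case (base u)
    then obtain x where x: "x \<in> carrier X'" "u = (i x, f x)" by auto
    then have "x = \<zero>\<^bsub>X'\<^esub>" if "i x = \<zero>\<^bsub>X\<^esub>"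
      using inj_onD[OF inj, of x "\<zero>\<^bsub>X'\<^esub>"] that by simp
    then show ?case using x by auto
  next
    case (step u)
    show ?case
    proof
      assume "fst u = \<zero>\<^bsub>X\<^esub>"
      then have "a \<odot>\<^bsub>Q\<^esub> snd u = \<zero>\<^bsub>Q\<^esub>" if "a \<in> I" for a
        using step(3)[OF that] that by simp
      then show "snd u = \<zero>\<^bsub>Q\<^esub>" using tfQ step(1) by (auto simp: torsion_free_def)
    qed
  qed
  have unique: "q = q'" if qq: "(x, q) \<in> \<Gamma>" "(x, q') \<in> \<Gamma>" for x q q'
  proof -
    have "(\<ominus>\<^bsub>R\<^esub> \<one>\<^bsub>R\<^esub>) \<odot>\<^bsub>?P\<^esub> (x, q') \<in> \<Gamma>" by (rule \<Gamma>s(4)) (use qq in auto)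
    then have "(x, q) \<oplus>\<^bsub>?P\<^esub> (\<ominus>\<^bsub>X\<^esub> x, \<ominus>\<^bsub>Q\<^esub> q') \<in> \<Gamma>"
      using qq carr by (intro \<Gamma>s(3)) (auto simp: X.smult_minus_one Q.smult_minus_one)
    from zero[OF this] show ?thesis
      using carr[OF qq(1)] carr[OF qq(2)] Q.X.minus_eq_zero_iff[of q q']
      by (simp add: X.X.r_neg a_minus_def)
  qed
  \<comment> \<open>An injective morphism reflects degrees, since it commutes with coordinates; this
    settles the original graph. At later stages the degree of the second entry is detected by
    multiplication with homogeneous elements of I.\<close>
  have deg: "\<forall>\<nu>\<in>carrier G. fst u \<in> mcomp X \<nu> \<longrightarrow> snd u \<in> mcomp Q \<nu>" if "u \<in> \<Gamma>" for u
    using that unfolding \<Gamma>_def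
  proof induct
    case (base u)
    then obtain x where x: "x \<in> carrier X'" "u = (i x, f x)" by auto
    have "x \<in> mcomp X' \<nu>" if "\<nu> \<in> carrier G" "i x \<in> mcomp X \<nu>" for \<nu>
    proof -
      have "i (X'.X.pr \<nu> x) = i x"
        using that x by (simp add: i.hom_pr X.X.pr_same)
      then have "X'.X.pr \<nu> x = x" using that x inj_onD[OF inj] by simp
      then show ?thesis using X'.X.pr_comp[of \<nu> x] that x by simp
    qed
    then show ?case using x f.hom_comp by auto
  next
    case (step u)
    show ?case
    proof (intro ballI impI)
      fix \<nu> assume \<nu>: "\<nu> \<in> carrier G" "fst u \<in> mcomp X \<nu>"
      show "snd u \<in> mcomp Q \<nu>"
      proof (rule torsion_free_homogeneous[OF grQ tfQ])
        fix \<tau> a assume a: "\<tau> \<in> carrier G" "a \<in> I" "a \<in> rcomp R \<tau>"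
        then show "a \<odot>\<^bsub>Q\<^esub> snd u \<in> mcomp Q (\<tau> \<otimes>\<^bsub>G\<^esub> \<nu>)"
          using step(3)[OF a(2)] \<nu> X.smult_comp[of \<tau> \<nu> a "fst u"] by auto
      qed (use \<nu> step(1) in auto)
    qed
  qed
  have dom_add: "\<exists>q. (x \<oplus>\<^bsub>X\<^esub> y, q) \<in> \<Gamma>" if "\<exists>q. (x, q) \<in> \<Gamma>" "\<exists>q. (y, q) \<in> \<Gamma>" for x y
    using that \<Gamma>s(3) by fastforce
  have dom_zero: "\<exists>q. (\<zero>\<^bsub>X\<^esub>, q) \<in> \<Gamma>"
    using \<Gamma>s(2) by auto
  \<comment> \<open>The stages of the saturation of X'' contain inhomogeneous elements, whereas maps
    out of I can be represented only when homogeneous. The claim therefore speaks of homogeneous x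
    lying over a component of \<open>w\<close>.\<close>
  have total: "\<forall>\<nu>\<in>carrier G. \<forall>x\<in>mcomp X \<nu>. p x = X''.X.pr \<nu> w \<longrightarrow> (\<exists>q. (x, q) \<in> \<Gamma>)"
    if "w \<in> saturation I X'' {\<zero>\<^bsub>X''\<^esub>}" for w
    using that
  proof induct
    case (base w)
    show ?case
    proof (intro ballI impI)
      fix \<nu> x assume "\<nu> \<in> carrier G" "x \<in> mcomp X \<nu>" "p x = X''.X.pr \<nu> w"
      then have "x \<in> carrier X" "p x = \<zero>\<^bsub>X''\<^esub>" using base X.X.comp_carrier by auto
      then obtain x' where "x' \<in> carrier X'" "x = i x'"
        using ex unfolding short_exact_def by blast
      then have "(x, f x') \<in> \<Gamma>" unfolding \<Gamma>_def by (intro saturation.base) auto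
      then show "\<exists>q. (x, q) \<in> \<Gamma>" ..
    qed
  next
    case (step w)
    show ?case
    proof (intro ballI impI)
      fix \<nu> x assume \<nu>: "\<nu> \<in> carrier G" and x: "x \<in> mcomp X \<nu>" and px: "p x = X''.X.pr \<nu> w"
      have xc: "x \<in> carrier X" using \<nu> x by (rule X.X.comp_carrier)
      have dom: "\<exists>q. (a \<odot>\<^bsub>X\<^esub> x, q) \<in> \<Gamma>" if "a \<in> I" for a
        using that
      proof (induct rule: ideal_induct)
        case zero
        show ?case using xc dom_zero by simp
      next
        case (comp \<tau> a)
        \<comment> \<open>For homogeneous a the product ax lies over the corresponding component of
          aw, and aw belongs to an earlier stage.\<close>
        have "p (a \<odot>\<^bsub>X\<^esub> x) = X''.X.pr (\<tau> \<otimes>\<^bsub>G\<^esub> \<nu>) (a \<odot>\<^bsub>X''\<^esub> w)"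
          using comp xc px \<nu> step(1) by (simp add: X''.smult_pr)
        then show ?case
          using step(3)[OF comp(2)] comp \<nu> x X.smult_comp[of \<tau> \<nu> a x] by blast
      next
        case (add a b)
        then show ?case using dom_add xc by (simp add: X.smult_l_distr)
      qed
      \<comment> \<open>The values of \<Gamma> at the multiples ax form a homogeneous map from I to
        Q. If it is multiplication by q, then all a(x, q) lie in \<Gamma>, so (x, q) is adjoined by
        one further step.\<close>
      define g where "g a = (THE q. (a \<odot>\<^bsub>X\<^esub> x, q) \<in> \<Gamma>)" for a
      have g: "(a \<odot>\<^bsub>X\<^esub> x, g a) \<in> \<Gamma>" if "a \<in> I" for a
        using theI'[of "\<lambda>q. (a \<odot>\<^bsub>X\<^esub> x, q) \<in> \<Gamma>"] dom[OF that] unique unfolding g_def by blast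
      have g_eq: "g a = q" if "(a \<odot>\<^bsub>X\<^esub> x, q) \<in> \<Gamma>" "a \<in> I" for a q
        using unique[OF g[OF that(2)] that(1)] .
      have "\<exists>q\<in>mcomp Q \<nu>. \<forall>a\<in>I. g a = a \<odot>\<^bsub>Q\<^esub> q"
      proof (rule extQ[unfolded ideal_maps_extend_def, rule_format, OF \<nu>])
        show "g a \<in> carrier Q" if "a \<in> I" for a using carr(2)[OF g[OF that]] .
        show "g (a \<oplus>\<^bsub>R\<^esub> b) = g a \<oplus>\<^bsub>Q\<^esub> g b" if "a \<in> I" "b \<in> I" for a b
          using that \<Gamma>s(3)[OF g[OF that(1)] g[OF that(2)]] xc by (intro g_eq) (auto simp: X.smult_l_distr)
        show "g (r \<otimes>\<^bsub>R\<^esub> a) = r \<odot>\<^bsub>Q\<^esub> g a" if "r \<in> carrier R" "a \<in> I" for r a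
          using that \<Gamma>s(4)[OF that(1) g[OF that(2)]] xc by (intro g_eq) (auto simp: X.smult_assoc)
        show "g a \<in> mcomp Q (\<tau> \<otimes>\<^bsub>G\<^esub> \<nu>)" if "\<tau> \<in> carrier G" "a \<in> I \<inter> rcomp R \<tau>" for \<tau> a
          using that \<nu> x deg[OF g[of a]] X.smult_comp[of \<tau> \<nu> a x] by auto
      qed
      then obtain q where q: "q \<in> mcomp Q \<nu>" "\<And>a. a \<in> I \<Longrightarrow> g a = a \<odot>\<^bsub>Q\<^esub> q" by blast
      have "(x, q) \<in> saturation I ?P ?B"
      proof (rule saturation.step)
        fix a assume "a \<in> I"
        then show "a \<odot>\<^bsub>?P\<^esub> (x, q) \<in> saturation I ?P ?B"
          using g[of a] q(2)[of a] by (simp add: \<Gamma>_def)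
      qed (use xc q \<nu> Q.X.comp_carrier in auto)
      then show "\<exists>q. (x, q) \<in> \<Gamma>" unfolding \<Gamma>_def ..
    qed
  qed
  have total': "\<exists>q. (x, q) \<in> \<Gamma>" if "x \<in> carrier X" for x
    using that
  proof (induct rule: X.X.comp_induct)
    case (comp \<nu> x)
    then have "p x \<in> saturation I X'' {\<zero>\<^bsub>X''\<^esub>}" "p x = X''.X.pr \<nu> (p x)"
      using satX'' X.X.comp_carrier[of \<nu> x] p.hom_comp[of \<nu> x] by (auto simp: X''.X.pr_same)
    then show ?case using total comp by blast
  qed (use dom_zero dom_add in auto)
  define h where "h = (\<lambda>x\<in>carrier X. THE q. (x, q) \<in> \<Gamma>)"
  have h: "(x, h x) \<in> \<Gamma>" if "x \<in> carrier X" for x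
    using theI'[of "\<lambda>q. (x, q) \<in> \<Gamma>"] total'[OF that] unique that unfolding h_def by auto
  have h_eq: "h x = q" if "(x, q) \<in> \<Gamma>" for x q
    using unique[OF h[OF carr(1)[OF that]] that] .
  have "h \<in> graded_hom G R X Q"
  proof (rule graded_homI)
    show "h x \<in> carrier Q" if "x \<in> carrier X" for x using carr(2)[OF h[OF that]] .
    show "h (x \<oplus>\<^bsub>X\<^esub> y) = h x \<oplus>\<^bsub>Q\<^esub> h y" if "x \<in> carrier X" "y \<in> carrier X" for x y
      using \<Gamma>s(3)[OF h[OF that(1)] h[OF that(2)]] by (intro h_eq) simp
    show "h (a \<odot>\<^bsub>X\<^esub> x) = a \<odot>\<^bsub>Q\<^esub> h x" if "a \<in> carrier R" "x \<in> carrier X" for a x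
      using \<Gamma>s(4)[OF that(1) h[OF that(2)]] by (intro h_eq) simp
    show "h x \<in> mcomp Q \<nu>" if "\<nu> \<in> carrier G" "x \<in> mcomp X \<nu>" for \<nu> x
      using that deg[OF h[of x]] X.X.comp_carrier by auto
  qed (simp add: h_def)
  moreover have "compose (carrier X') h i = f"
  proof (rule extensionalityI[of _ "carrier X'"])
    fix x assume x: "x \<in> carrier X'"
    then have "(i x, f x) \<in> \<Gamma>" unfolding \<Gamma>_def by (intro saturation.base) auto
    then show "compose (carrier X') h i x = f x" using x h_eq by (simp add: compose_def)
  qed (auto simp: f.hom_extensional)
  ultimately show ?thesis by blast
qed

text \<open>Both conditions are verified against the larger class \<open>torsion_class\<close>. A
  morphism from a torsion object into a torsion-free one is zero, because saturation is carried
  along.\<close>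

lemma closed_objectI:
  assumes Q: "torsion_closed G R I Q"
  shows "Q \<in> closed_objects G R (loc_of_ideal G R I)"
proof -
  have grQ: "graded_module G R Q" and tfQ: "torsion_free I Q"
    using Q by (auto simp: torsion_closed_def)
  have "carrier X = {\<zero>\<^bsub>X\<^esub>}" if X: "X \<in> loc_of_ideal G R I" "gr_mono G R X Q \<noteq> {}" for X
  proof -
    have tc: "X \<in> torsion_class G R I" using X loc_of_ideal_torsion by blast
    then have grX: "graded_module G R X" by (simp add: torsion_class_def)
    obtain f where f: "f \<in> graded_hom G R X Q" "inj_on f (carrier X)"
      using X by (auto simp: gr_mono_def)
    interpret X: grmod G R X by (rule grmodI) fact
    interpret grhom G R X Q f using grX grQ f by (intro grhomI)
    have "x = \<zero>\<^bsub>X\<^esub>" if "x \<in> carrier X" for x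
    proof -
      have "f x \<in> saturation I Q {\<zero>\<^bsub>Q\<^esub>}"
        by (rule saturation_image[of x I X "{\<zero>\<^bsub>X\<^esub>}"]) (use that tc in \<open>auto simp: torsion_class_def\<close>)
      then have "f x = f \<zero>\<^bsub>X\<^esub>" using torsion_free_saturation[OF tfQ] by simp
      then show ?thesis using inj_onD[OF f(2), of x "\<zero>\<^bsub>X\<^esub>"] that by simp
    qed
    then show ?thesis using X.X.zero_closed by auto
  qed
  moreover have "\<exists>h\<in>graded_hom G R X Q. compose (carrier X') h i = f"
    if "graded_module G R X'" "graded_module G R X" "X'' \<in> loc_of_ideal G R I"
      "short_exact G R X' i X p X''" "f \<in> graded_hom G R X' Q" for X' X X'' i p f
    using that loc_of_ideal_torsion by (intro extend_along_torsion[OF that(4,1,2) _ Q that(5)]) blast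
  ultimately show ?thesis
    unfolding closed_objects_def Obj_gr_cat using grQ by auto
qed

text \<open>The elements killed by I form a graded submodule. It is stable under scalars since I is
  closed under right multiplication, and under coordinates since I is spanned by homogeneous
  elements. It is itself killed by I and embeds in Q, hence is zero.\<close>

lemma closed_object_torsion_free:
  assumes Q: "Q \<in> closed_objects G R (loc_of_ideal G R I)"
  shows "torsion_free I Q"
proof -
  have grQ: "graded_module G R Q" using Q by (simp add: closed_objects_def Obj_gr_cat)
  interpret Q: grmod G R Q by (rule grmodI) fact
  define B where "B = {x \<in> carrier Q. \<forall>a\<in>I. a \<odot>\<^bsub>Q\<^esub> x = \<zero>\<^bsub>Q\<^esub>}"
  have "a \<odot>\<^bsub>Q\<^esub> (r \<odot>\<^bsub>Q\<^esub> x) = \<zero>\<^bsub>Q\<^esub>" if "r \<in> carrier R" "x \<in> B" "a \<in> I" for a r x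
    using that ideal_rmult[of r a] by (simp add: B_def flip: Q.smult_assoc)
  then have sub: "is_submodule R Q B"
    unfolding is_submodule_def by (auto simp: B_def Q.smult_closed Q.smult_r_distr)
  have pr: "Q.X.pr \<nu> x \<in> B" if "\<nu> \<in> carrier G" "x \<in> B" for \<nu> x
  proof -
    have "a \<odot>\<^bsub>Q\<^esub> Q.X.pr \<nu> x = \<zero>\<^bsub>Q\<^esub>" if "a \<in> I" for a
      using that
      by (induct rule: ideal_induct)
        (use \<open>\<nu> \<in> carrier G\<close> \<open>x \<in> B\<close> in \<open>auto simp: B_def Q.smult_pr Q.smult_l_distr\<close>)
    then show ?thesis using that by (auto simp: B_def)
  qed
  let ?X = "submodule_restrict Q B"
  have gr: "graded_module G R ?X"
    using sub pr by (intro Q.submodule_restrict) (auto simp: graded_submodule_def)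
  then have "?X \<in> killed_by G R I" by (auto simp: killed_by_def Obj_gr_cat B_def)
  moreover have "(\<lambda>x\<in>B. x) \<in> gr_mono G R ?X Q"
    unfolding gr_mono_def
    by (auto intro!: graded_homI simp: is_submoduleD[OF sub])
  ultimately have "carrier ?X = {\<zero>\<^bsub>?X\<^esub>}"
    using Q killed_by_loc unfolding closed_objects_def by blast
  then show ?thesis by (auto simp: torsion_free_def B_def)
qed

text \<open>The test sequence is I into R onto R/I, shifted by \<sigma> so that \<open>g\<close>
  preserves degrees; R/I is killed by I. The extension of \<open>g\<close> to R is multiplication by
  its value at 1. All three modules are moved into \<open>'u\<close> along \<open>e\<close>.\<close>

lemma closed_object_ideal_maps:
  fixes Q :: "('g, 'r, 'u) gmodule" and e :: "'r \<Rightarrow> 'u"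
  assumes Q: "Q \<in> closed_objects G R (loc_of_ideal G R I)" and e: "inj_on e (carrier R)"
  shows "ideal_maps_extend G R I Q"
  unfolding ideal_maps_extend_def
proof (intro ballI allI impI)
  fix \<sigma> g
  assume \<sigma>: "\<sigma> \<in> carrier G" and g_closed: "\<forall>a\<in>I. g a \<in> carrier Q"
    and g_add: "\<forall>a\<in>I. \<forall>b\<in>I. g (a \<oplus>\<^bsub>R\<^esub> b) = g a \<oplus>\<^bsub>Q\<^esub> g b"
    and g_smult: "\<forall>r\<in>carrier R. \<forall>a\<in>I. g (r \<otimes>\<^bsub>R\<^esub> a) = r \<odot>\<^bsub>Q\<^esub> g a"
    and g_comp: "\<forall>\<tau>\<in>carrier G. \<forall>a\<in>I \<inter> rcomp R \<tau>. g a \<in> mcomp Q (\<tau> \<otimes>\<^bsub>G\<^esub> \<sigma>)"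
  have grQ: "graded_module G R Q" using Q by (simp add: closed_objects_def Obj_gr_cat)
  let ?R = "shifted_regular G R \<sigma>"
  let ?I = "submodule_restrict ?R I"
  \<comment> \<open>The quotient must have its carrier inside \<open>'u\<close>, so cosets are
    replaced by one chosen representative each, whose code is then taken.\<close>
  define rep where "rep a = (SOME b. b \<in> carrier R \<and> a \<ominus>\<^bsub>R\<^esub> b \<in> I)" for a
  let ?X' = "transport e ?I" and ?X = "transport e ?R" and ?X'' = "transport (\<lambda>a. e (rep a)) ?R"
  have grR: "graded_module G R ?R" by (rule shifted_regular_graded) fact
  interpret SR: grmod G R ?R by (rule grmodI) fact
  have minus: "a \<ominus>\<^bsub>?R\<^esub> b = a \<ominus>\<^bsub>R\<^esub> b" if "a \<in> carrier R" "b \<in> carrier R" for a b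
  proof -
    have "\<ominus>\<^bsub>?R\<^esub> b = \<ominus>\<^bsub>R\<^esub> b"
      using that by (intro SR.X.minus_equality) (auto simp: R.l_neg)
    then show ?thesis by (simp add: a_minus_def)
  qed
  have Isub: "graded_submodule G R ?R I"
    unfolding graded_submodule_def is_submodule_def
    using \<sigma> ideal_pr by (auto simp: shifted_regular_graded(2)[OF \<sigma>, simplified])
  have grI: "graded_module G R ?I" using SR.submodule_restrict[OF Isub] .
  have rep: "rep a \<in> carrier R" "a \<ominus>\<^bsub>R\<^esub> rep a \<in> I" if "a \<in> carrier R" for a
  proof -
    have "\<exists>b. b \<in> carrier R \<and> a \<ominus>\<^bsub>R\<^esub> b \<in> I"
      using that by (intro exI[of _ a]) (simp add: R.r_neg a_minus_def)
    from someI_ex[OF this] show "rep a \<in> carrier R" "a \<ominus>\<^bsub>R\<^esub> rep a \<in> I"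
      unfolding rep_def by blast+
  qed
  have Ineg: "\<ominus>\<^bsub>R\<^esub> a \<in> I" if "a \<in> I" for a
    using additive_subgroup.a_inv_closed[OF ideal.axioms(1)[OF ideal]] that by blast
  have cong: "(a \<ominus>\<^bsub>R\<^esub> c \<in> I) = (b \<ominus>\<^bsub>R\<^esub> c \<in> I)"
    if "a \<ominus>\<^bsub>R\<^esub> b \<in> I" "a \<in> carrier R" "b \<in> carrier R" "c \<in> carrier R" for a b c
  proof -
    have 1: "a \<ominus>\<^bsub>R\<^esub> c = (a \<ominus>\<^bsub>R\<^esub> b) \<oplus>\<^bsub>R\<^esub> (b \<ominus>\<^bsub>R\<^esub> c)"
      and 2: "b \<ominus>\<^bsub>R\<^esub> c = \<ominus>\<^bsub>R\<^esub> (a \<ominus>\<^bsub>R\<^esub> b) \<oplus>\<^bsub>R\<^esub> (a \<ominus>\<^bsub>R\<^esub> c)"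
      using that(2-4) by algebra+
    show ?thesis using ideal_add[OF that(1)] ideal_add[OF Ineg[OF that(1)]] 1 2 by metis
  qed
  have rep_eq: "rep a = rep b \<longleftrightarrow> a \<ominus>\<^bsub>R\<^esub> b \<in> I" if "a \<in> carrier R" "b \<in> carrier R" for a b
  proof
    assume "rep a = rep b"
    then have "(a \<ominus>\<^bsub>R\<^esub> rep b) \<oplus>\<^bsub>R\<^esub> \<ominus>\<^bsub>R\<^esub> (b \<ominus>\<^bsub>R\<^esub> rep b) \<in> I"
      using rep that by (metis Ineg ideal_add)
    moreover have "(a \<ominus>\<^bsub>R\<^esub> rep b) \<oplus>\<^bsub>R\<^esub> \<ominus>\<^bsub>R\<^esub> (b \<ominus>\<^bsub>R\<^esub> rep b) = a \<ominus>\<^bsub>R\<^esub> b"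
      using that rep(1)[OF that(2)] by algebra
    ultimately show "a \<ominus>\<^bsub>R\<^esub> b \<in> I" by simp
  next
    assume "a \<ominus>\<^bsub>R\<^esub> b \<in> I"
    \<comment> \<open>Congruent elements define the same predicate, so the choice operator returns
      the same representative.\<close>
    then have "(\<lambda>c. c \<in> carrier R \<and> a \<ominus>\<^bsub>R\<^esub> c \<in> I) = (\<lambda>c. c \<in> carrier R \<and> b \<ominus>\<^bsub>R\<^esub> c \<in> I)"
      using cong that by blast
    then show "rep a = rep b" by (simp add: rep_def)
  qed
  have quot: "e (rep a) = e (rep b) \<longleftrightarrow> a \<ominus>\<^bsub>?R\<^esub> b \<in> I"
    if "a \<in> carrier ?R" "b \<in> carrier ?R" for a b
    using that e rep by (simp add: inj_on_eq_iff rep_eq minus)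
  note X'' = transport_quotient[OF grR Isub quot]
  have eR: "inj_on e (carrier ?R)" and eI: "inj_on e (carrier ?I)"
    using e inj_on_subset[OF e, of I] by (simp_all add: subset_iff)
  note X = transport_inj[OF grR eR]
  note X' = transport_inj[OF grI eI]
  have e_iff: "e a = e b \<longleftrightarrow> a = b" if "a \<in> carrier R" "b \<in> carrier R" for a b
    using e that by (simp add: inj_on_eq_iff)
  let ?inv = "inv_into (carrier R) e"
  have inv [simp]: "?inv (e a) = a" if "a \<in> carrier R" for a
    using e that by simp
  let ?i = "\<lambda>x\<in>e ` I. x" and ?p = "\<lambda>x\<in>e ` carrier R. e (rep (?inv x))"
  let ?f = "\<lambda>x\<in>e ` I. g (?inv x)"
  have compI: "a \<in> I \<Longrightarrow> \<nu> \<in> carrier G \<Longrightarrow> a \<in> rcomp R (\<nu> \<otimes>\<^bsub>G\<^esub> inv\<^bsub>G\<^esub> \<sigma>) \<Longrightarrow> g a \<in> mcomp Q \<nu>" for a \<nu>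
    using bspec[OF g_comp, of "\<nu> \<otimes>\<^bsub>G\<^esub> inv\<^bsub>G\<^esub> \<sigma>"] \<sigma> by (simp add: G.m_assoc)
  have compR: "a \<in> carrier R" if "\<nu> \<in> carrier G" "a \<in> rcomp R (\<nu> \<otimes>\<^bsub>G\<^esub> inv\<^bsub>G\<^esub> \<sigma>)" for \<nu> a
    using that \<sigma> R.comp_carrier[of "\<nu> \<otimes>\<^bsub>G\<^esub> inv\<^bsub>G\<^esub> \<sigma>" a] by simp
  have i: "?i \<in> gr_mono G R ?X' ?X"
    unfolding gr_mono_def
    using X' X by (auto intro!: graded_homI simp: SR.X.a_closed)
  have p: "?p \<in> gr_epi G R ?X ?X''"
    unfolding gr_epi_def mem_Collect_eq
  proof
    have pe: "?p (e a) = e (rep a)" if "a \<in> carrier R" for a using that by simp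
    show "?p \<in> graded_hom G R ?X ?X''"
    proof (rule graded_homI)
      fix x y assume "x \<in> carrier ?X" "y \<in> carrier ?X"
      then obtain a b where ab: "a \<in> carrier R" "b \<in> carrier R" "x = e a" "y = e b" by auto
      then have "x \<oplus>\<^bsub>?X\<^esub> y = e (a \<oplus>\<^bsub>R\<^esub> b)" using X(1)[of a b] by simp
      then show "?p (x \<oplus>\<^bsub>?X\<^esub> y) = ?p x \<oplus>\<^bsub>?X''\<^esub> ?p y"
        using X''(1)[of a b] ab by simp
    next
      fix r x assume r: "r \<in> carrier R" and "x \<in> carrier ?X"
      then obtain a where a: "a \<in> carrier R" "x = e a" by auto
      then have "r \<odot>\<^bsub>?X\<^esub> x = e (r \<otimes>\<^bsub>R\<^esub> a)" using X(2)[of r a] r by simp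
      then show "?p (r \<odot>\<^bsub>?X\<^esub> x) = r \<odot>\<^bsub>?X''\<^esub> ?p x"
        using X''(2)[of r a] a r by simp
    next
      fix \<nu> x assume "\<nu> \<in> carrier G" "x \<in> mcomp ?X \<nu>"
      then obtain a where a: "a \<in> rcomp R (\<nu> \<otimes>\<^bsub>G\<^esub> inv\<^bsub>G\<^esub> \<sigma>)" "x = e a" "a \<in> carrier R"
        using compR by auto
      then have "?p x = e (rep a)" using pe by simp
      then show "?p x \<in> mcomp ?X'' \<nu>" using a(1) by simp
    qed auto
    show "?p ` carrier ?X = carrier ?X''" by (force simp: image_iff)
  qed
  have f: "?f \<in> graded_hom G R ?X' Q"
    by (rule graded_homI) (use X' g_closed g_add g_smult compI in \<open>auto simp: e_iff\<close>)
  have rep0: "rep a = rep \<zero>\<^bsub>R\<^esub> \<longleftrightarrow> a \<in> I" if "a \<in> carrier R" for a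
    using rep_eq[of a "\<zero>\<^bsub>R\<^esub>"] that by (simp add: a_minus_def)
  have "{x \<in> carrier ?X. ?p x = \<zero>\<^bsub>?X''\<^esub>} = e ` I"
    using rep by (auto simp: e_iff rep0)
  then have exact: "short_exact G R ?X' ?i ?X ?p ?X''"
    using i p by (simp add: short_exact_def)
  have "?X'' \<in> killed_by G R I"
  proof -
    have "a \<odot>\<^bsub>?X''\<^esub> e (rep b) = \<zero>\<^bsub>?X''\<^esub>" if "a \<in> I" "b \<in> carrier R" for a b
      using X''(2)[of a b] that rep0[of "a \<otimes>\<^bsub>R\<^esub> b"] by simp
    then show ?thesis using X''(3) by (auto simp: killed_by_def Obj_gr_cat)
  qed
  then have "?X'' \<in> loc_of_ideal G R I" using killed_by_loc by blast
  then obtain h where h: "h \<in> graded_hom G R ?X Q" "compose (carrier ?X') h ?i = ?f"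
    using Q X(3) X'(3) exact f unfolding closed_objects_def Obj_gr_cat by blast
  interpret h: grhom G R ?X Q h using X(3) grQ h(1) by (rule grhomI)
  have g_h: "g a = h (e a)" if "a \<in> I" for a
    using fun_cong[OF h(2), of "e a"] that by (simp add: compose_def)
  \<comment> \<open>In the shifted module the identity has degree \<sigma>, which places the
    multiplier in the required component.\<close>
  have "\<one>\<^bsub>R\<^esub> \<in> rcomp R (\<sigma> \<otimes>\<^bsub>G\<^esub> inv\<^bsub>G\<^esub> \<sigma>)" using \<sigma> one_comp by simp
  then have "h (e \<one>\<^bsub>R\<^esub>) \<in> mcomp Q \<sigma>" by (intro h.hom_comp \<sigma>) simp
  moreover have "g a = a \<odot>\<^bsub>Q\<^esub> h (e \<one>\<^bsub>R\<^esub>)" if "a \<in> I" for a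
    using h.hom_smult[of a "e \<one>\<^bsub>R\<^esub>"] X(2)[of a "\<one>\<^bsub>R\<^esub>"] that by (simp add: g_h)
  ultimately show "\<exists>x\<in>mcomp Q \<sigma>. \<forall>a\<in>I. g a = a \<odot>\<^bsub>Q\<^esub> x" by blast
qed

lemma closed_objects_iff:
  fixes Q :: "('g, 'r, 'u) gmodule" and e :: "'r \<Rightarrow> 'u"
  assumes "inj_on e (carrier R)"
  shows "Q \<in> closed_objects G R (loc_of_ideal G R I) \<longleftrightarrow> torsion_closed G R I Q"
proof
  assume Q: "Q \<in> closed_objects G R (loc_of_ideal G R I)"
  then have "graded_module G R Q" by (simp add: closed_objects_def Obj_gr_cat)
  then show "torsion_closed G R I Q"
    using closed_object_torsion_free[OF Q] closed_object_ideal_maps[OF Q assms]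
    by (simp add: torsion_closed_def)
qed (rule closed_objectI)

end

section \<open>The graded module HOM\<close>

locale bimod = M: grmod G R M + S: grring G S + graded_bimodule G R S M
  for G :: "'g monoid" and R :: "('g, 'r) gring" and S :: "('g, 's) gring"
    and M :: "('g, 'r, 's, 'm) gbimodule"

lemma bimodI: "graded_bimodule G R S M \<Longrightarrow> bimod G R S M"
  by (simp add: bimod_def graded_bimodule_def grmodI grringI)

locale hom_context = bimod G R S M + X: grmod G R X
  for G :: "'g monoid" and R :: "('g, 'r) gring" and S :: "('g, 's) gring"
    and M :: "('g, 'r, 's, 'm) gbimodule" and X :: "('g, 'r, 'x) gmodule"
begin

abbreviation "H \<equiv> HOM G R M X"

lemma HOM_simps [simp]:
  "\<zero>\<^bsub>H\<^esub> = (\<lambda>m\<in>carrier M. \<zero>\<^bsub>X\<^esub>)"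
  "f \<oplus>\<^bsub>H\<^esub> f' = (\<lambda>m\<in>carrier M. f m \<oplus>\<^bsub>X\<^esub> f' m)"
  "s \<odot>\<^bsub>H\<^esub> f = (\<lambda>m\<in>carrier M. f (m \<odot>\<^sub>r\<^bsub>M\<^esub> s))"
  "mcomp H = HOM_deg G R M X"
  by (simp_all add: HOM_def)

lemma linear_mapsI:
  assumes "f \<in> extensional (carrier M)" "\<And>m. m \<in> carrier M \<Longrightarrow> f m \<in> carrier X"
    "\<And>m m'. m \<in> carrier M \<Longrightarrow> m' \<in> carrier M \<Longrightarrow> f (m \<oplus>\<^bsub>M\<^esub> m') = f m \<oplus>\<^bsub>X\<^esub> f m'"
    "\<And>a m. a \<in> carrier R \<Longrightarrow> m \<in> carrier M \<Longrightarrow> f (a \<odot>\<^bsub>M\<^esub> m) = a \<odot>\<^bsub>X\<^esub> f m"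
  shows "f \<in> linear_maps R M X"
  using assms by (auto simp: linear_maps_def PiE_iff)

lemma linear_mapsD:
  assumes "f \<in> linear_maps R M X"
  shows "f \<in> extensional (carrier M)" "\<And>m. m \<in> carrier M \<Longrightarrow> f m \<in> carrier X"
    "\<And>m m'. m \<in> carrier M \<Longrightarrow> m' \<in> carrier M \<Longrightarrow> f (m \<oplus>\<^bsub>M\<^esub> m') = f m \<oplus>\<^bsub>X\<^esub> f m'"
    "\<And>a m. a \<in> carrier R \<Longrightarrow> m \<in> carrier M \<Longrightarrow> f (a \<odot>\<^bsub>M\<^esub> m) = a \<odot>\<^bsub>X\<^esub> f m"
  using assms by (auto simp: linear_maps_def PiE_iff)

lemma HOM_degI:
  assumes "f \<in> linear_maps R M X"
    "\<And>\<nu> m. \<nu> \<in> carrier G \<Longrightarrow> m \<in> mcomp M \<nu> \<Longrightarrow> f m \<in> mcomp X (\<nu> \<otimes>\<^bsub>G\<^esub> \<sigma>)"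
  shows "f \<in> HOM_deg G R M X \<sigma>"
  using assms by (auto simp: HOM_deg_def)

lemma HOM_deg_linear: "f \<in> HOM_deg G R M X \<sigma> \<Longrightarrow> f \<in> linear_maps R M X"
  by (simp add: HOM_deg_def)

lemma HOM_deg_comp:
  "\<lbrakk>f \<in> HOM_deg G R M X \<sigma>; \<nu> \<in> carrier G; m \<in> mcomp M \<nu>\<rbrakk> \<Longrightarrow> f m \<in> mcomp X (\<nu> \<otimes>\<^bsub>G\<^esub> \<sigma>)"
  by (auto simp: HOM_deg_def)

lemma linear_zero: "(\<lambda>m\<in>carrier M. \<zero>\<^bsub>X\<^esub>) \<in> linear_maps R M X"
  by (rule linear_mapsI) (auto intro: M.smult_closed)

lemma linear_add:
  assumes "f \<in> linear_maps R M X" "f' \<in> linear_maps R M X"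
  shows "(\<lambda>m\<in>carrier M. f m \<oplus>\<^bsub>X\<^esub> f' m) \<in> linear_maps R M X"
  using linear_mapsD[OF assms(1)] linear_mapsD[OF assms(2)]
  by (intro linear_mapsI) (auto simp: M.smult_closed X.smult_r_distr X.X.a_ac)

lemma linear_neg:
  assumes "f \<in> linear_maps R M X"
  shows "(\<lambda>m\<in>carrier M. \<ominus>\<^bsub>X\<^esub> f m) \<in> linear_maps R M X"
proof -
  have "\<ominus>\<^bsub>X\<^esub> (a \<odot>\<^bsub>X\<^esub> x) = a \<odot>\<^bsub>X\<^esub> (\<ominus>\<^bsub>X\<^esub> x)" if "a \<in> carrier R" "x \<in> carrier X" for a x
    using that X.smult_minus[of a "\<zero>\<^bsub>X\<^esub>" x] by (simp add: a_minus_def X.smult_closed)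
  then show ?thesis
    using linear_mapsD[OF assms]
    by (intro linear_mapsI) (auto simp: M.smult_closed X.X.minus_add)
qed

lemma linear_smult:
  assumes "f \<in> linear_maps R M X" "s \<in> carrier S"
  shows "(\<lambda>m\<in>carrier M. f (m \<odot>\<^sub>r\<^bsub>M\<^esub> s)) \<in> linear_maps R M X"
  using linear_mapsD[OF assms(1)] assms(2)
  by (intro linear_mapsI) (auto simp: M.smult_closed rsmult_closed rsmult_l_distr smult_rsmult)

lemma HOM_deg_zero: "\<sigma> \<in> carrier G \<Longrightarrow> (\<lambda>m\<in>carrier M. \<zero>\<^bsub>X\<^esub>) \<in> HOM_deg G R M X \<sigma>"
  by (intro HOM_degI linear_zero) (auto simp: M.X.comp_carrier X.X.comp_zero)

lemma HOM_deg_add: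
  assumes "\<sigma> \<in> carrier G" "f \<in> HOM_deg G R M X \<sigma>" "f' \<in> HOM_deg G R M X \<sigma>"
  shows "(\<lambda>m\<in>carrier M. f m \<oplus>\<^bsub>X\<^esub> f' m) \<in> HOM_deg G R M X \<sigma>"
  using assms by (intro HOM_degI linear_add) (auto simp: HOM_deg_linear M.X.comp_carrier X.X.comp_add HOM_deg_comp)

lemma HOM_deg_neg:
  assumes "\<sigma> \<in> carrier G" "f \<in> HOM_deg G R M X \<sigma>"
  shows "(\<lambda>m\<in>carrier M. \<ominus>\<^bsub>X\<^esub> f m) \<in> HOM_deg G R M X \<sigma>"
  using assms by (intro HOM_degI linear_neg) (auto simp: HOM_deg_linear M.X.comp_carrier X.X.comp_neg HOM_deg_comp)

text \<open>Degrees of maps multiply on the right and (s f)(m) = f(m s), so the degree \<nu> of m is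
  first multiplied by \<tau> and then by \<sigma>. The degrees of s and f thus combine in the order
  required of a left module.\<close>

lemma HOM_deg_smult:
  assumes "\<sigma> \<in> carrier G" "\<tau> \<in> carrier G" "f \<in> HOM_deg G R M X \<sigma>" "s \<in> rcomp S \<tau>"
  shows "(\<lambda>m\<in>carrier M. f (m \<odot>\<^sub>r\<^bsub>M\<^esub> s)) \<in> HOM_deg G R M X (\<tau> \<otimes>\<^bsub>G\<^esub> \<sigma>)"
proof (intro HOM_degI linear_smult)
  fix \<nu> m assume \<nu>: "\<nu> \<in> carrier G" "m \<in> mcomp M \<nu>"
  then have "f (m \<odot>\<^sub>r\<^bsub>M\<^esub> s) \<in> mcomp X (\<nu> \<otimes>\<^bsub>G\<^esub> \<tau> \<otimes>\<^bsub>G\<^esub> \<sigma>)"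
    using assms rsmult_comp[of \<nu> \<tau> m s] by (intro HOM_deg_comp) auto
  then show "(\<lambda>m\<in>carrier M. f (m \<odot>\<^sub>r\<^bsub>M\<^esub> s)) m \<in> mcomp X (\<nu> \<otimes>\<^bsub>G\<^esub> (\<tau> \<otimes>\<^bsub>G\<^esub> \<sigma>))"
    using \<nu> assms M.X.comp_carrier by (simp add: M.G.m_assoc)
qed (use assms S.R.comp_carrier in \<open>auto simp: HOM_deg_linear\<close>)

lemma HOM_carrierE:
  assumes "f \<in> carrier H"
  obtains K h where "finite K" "K \<subseteq> carrier G" "\<And>\<sigma>. \<sigma> \<in> K \<Longrightarrow> h \<sigma> \<in> HOM_deg G R M X \<sigma>"
    "f = (\<lambda>m\<in>carrier M. \<Oplus>\<^bsub>X\<^esub>\<sigma>\<in>K. h \<sigma> m)"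
  using assms that unfolding HOM_def partial_object.select_convs mem_Collect_eq by blast

lemma HOM_carrierI:
  assumes "finite K" "K \<subseteq> carrier G" "\<And>\<sigma>. \<sigma> \<in> K \<Longrightarrow> h \<sigma> \<in> HOM_deg G R M X \<sigma>"
    "f = (\<lambda>m\<in>carrier M. \<Oplus>\<^bsub>X\<^esub>\<sigma>\<in>K. h \<sigma> m)"
  shows "f \<in> carrier H"
  using assms unfolding HOM_def partial_object.select_convs mem_Collect_eq by blast

lemma HOM_zero_closed: "(\<lambda>m\<in>carrier M. \<zero>\<^bsub>X\<^esub>) \<in> carrier H"
  by (rule HOM_carrierI[of "{}" "\<lambda>_. undefined"]) simp_all

lemma HOM_deg_closed:
  assumes "\<sigma> \<in> carrier G" "f \<in> HOM_deg G R M X \<sigma>" shows "f \<in> carrier H"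
proof (rule HOM_carrierI[of "{\<sigma>}" "\<lambda>_. f"])
  show "f = (\<lambda>m\<in>carrier M. \<Oplus>\<^bsub>X\<^esub>\<sigma>\<in>{\<sigma>}. f m)"
  proof (rule extensionalityI[of _ "carrier M"])
    fix m assume m: "m \<in> carrier M"
    then have "f m \<in> carrier X" using linear_mapsD(2)[OF HOM_deg_linear[OF assms(2)]] by simp
    then show "f m = (\<lambda>m\<in>carrier M. \<Oplus>\<^bsub>X\<^esub>\<sigma>\<in>{\<sigma>}. f m) m" using m by simp
  qed (use linear_mapsD(1)[OF HOM_deg_linear[OF assms(2)]] in auto)
qed (use assms in auto)

text \<open>The two families of homogeneous maps are padded with the zero map to the union of their
  index sets and added degree by degree.\<close>

lemma HOM_add_closed:
  assumes "f \<in> carrier H" "f' \<in> carrier H"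
  shows "(\<lambda>m\<in>carrier M. f m \<oplus>\<^bsub>X\<^esub> f' m) \<in> carrier H"
proof -
  obtain K h where K: "finite K" "K \<subseteq> carrier G" "\<And>\<sigma>. \<sigma> \<in> K \<Longrightarrow> h \<sigma> \<in> HOM_deg G R M X \<sigma>"
    and f: "f = (\<lambda>m\<in>carrier M. \<Oplus>\<^bsub>X\<^esub>\<sigma>\<in>K. h \<sigma> m)"
    using assms(1) by (elim HOM_carrierE that)
  obtain K' h' where K': "finite K'" "K' \<subseteq> carrier G" "\<And>\<sigma>. \<sigma> \<in> K' \<Longrightarrow> h' \<sigma> \<in> HOM_deg G R M X \<sigma>"
    and f': "f' = (\<lambda>m\<in>carrier M. \<Oplus>\<^bsub>X\<^esub>\<sigma>\<in>K'. h' \<sigma> m)"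
    using assms(2) by (elim HOM_carrierE that)
  define e where "e K h \<sigma> = (if \<sigma> \<in> K then h \<sigma> else (\<lambda>m\<in>carrier M. \<zero>\<^bsub>X\<^esub>))"
    for K :: "'g set" and h :: "'g \<Rightarrow> 'm \<Rightarrow> 'x" and \<sigma>
  have e: "e K h \<sigma> \<in> HOM_deg G R M X \<sigma>" "e K' h' \<sigma> \<in> HOM_deg G R M X \<sigma>" if "\<sigma> \<in> carrier G" for \<sigma>
    using that K(3) K'(3) HOM_deg_zero by (auto simp: e_def)
  have ec: "e K h \<sigma> m \<in> carrier X" "e K' h' \<sigma> m \<in> carrier X" if "\<sigma> \<in> K \<union> K'" "m \<in> carrier M" for \<sigma> m
    using that K(2) K'(2) e linear_mapsD(2)[OF HOM_deg_linear] by blast+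
  have sum: "(\<Oplus>\<^bsub>X\<^esub>\<sigma>\<in>L. h \<sigma> m) = (\<Oplus>\<^bsub>X\<^esub>\<sigma>\<in>K \<union> K'. e L h \<sigma> m)"
    if "L \<subseteq> K \<union> K'" "\<And>\<sigma>. \<sigma> \<in> K \<union> K' \<Longrightarrow> e L h \<sigma> m \<in> carrier X" "m \<in> carrier M" for L h m
    using that K(1) K'(1) by (intro X.X.add.finprod_mono_neutral_cong_left[simplified]) (auto simp: e_def)
  show ?thesis
  proof (rule HOM_carrierI)
    show "(\<lambda>m\<in>carrier M. e K h \<sigma> m \<oplus>\<^bsub>X\<^esub> e K' h' \<sigma> m) \<in> HOM_deg G R M X \<sigma>" if "\<sigma> \<in> K \<union> K'" for \<sigma>
      using that K(2) K'(2) e by (intro HOM_deg_add) auto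
    show "(\<lambda>m\<in>carrier M. f m \<oplus>\<^bsub>X\<^esub> f' m) =
      (\<lambda>m\<in>carrier M. \<Oplus>\<^bsub>X\<^esub>\<sigma>\<in>K \<union> K'. (\<lambda>m\<in>carrier M. e K h \<sigma> m \<oplus>\<^bsub>X\<^esub> e K' h' \<sigma> m) m)"
    proof (rule restrict_ext)
      fix m assume m: "m \<in> carrier M"
      have "f m \<oplus>\<^bsub>X\<^esub> f' m = (\<Oplus>\<^bsub>X\<^esub>\<sigma>\<in>K \<union> K'. e K h \<sigma> m) \<oplus>\<^bsub>X\<^esub> (\<Oplus>\<^bsub>X\<^esub>\<sigma>\<in>K \<union> K'. e K' h' \<sigma> m)"
        using m ec sum[of K h m] sum[of K' h' m] by (simp add: f f')
      also have "\<dots> = (\<Oplus>\<^bsub>X\<^esub>\<sigma>\<in>K \<union> K'. e K h \<sigma> m \<oplus>\<^bsub>X\<^esub> e K' h' \<sigma> m)"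
        using m ec by (intro X.X.finsum_addf[symmetric]) auto
      finally show "f m \<oplus>\<^bsub>X\<^esub> f' m = (\<Oplus>\<^bsub>X\<^esub>\<sigma>\<in>K \<union> K'. (\<lambda>m\<in>carrier M. e K h \<sigma> m \<oplus>\<^bsub>X\<^esub> e K' h' \<sigma> m) m)"
        using m by simp
    qed
  qed (use K K' in auto)
qed

text \<open>This induction replaces the explicit finite sums in the carrier: homogeneous maps and
  closure under addition are enough.\<close>

lemma HOM_induct [consumes 1, case_names zero deg add]:
  assumes "f \<in> carrier H" and zero: "P (\<lambda>m\<in>carrier M. \<zero>\<^bsub>X\<^esub>)"
    and deg: "\<And>\<sigma> f. \<sigma> \<in> carrier G \<Longrightarrow> f \<in> HOM_deg G R M X \<sigma> \<Longrightarrow> P f"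
    and add: "\<And>f f'. f \<in> carrier H \<Longrightarrow> f' \<in> carrier H \<Longrightarrow> P f \<Longrightarrow> P f' \<Longrightarrow> P (\<lambda>m\<in>carrier M. f m \<oplus>\<^bsub>X\<^esub> f' m)"
  shows "P f"
proof -
  obtain K h where K: "finite K" "K \<subseteq> carrier G" "\<And>\<sigma>. \<sigma> \<in> K \<Longrightarrow> h \<sigma> \<in> HOM_deg G R M X \<sigma>"
    and f: "f = (\<lambda>m\<in>carrier M. \<Oplus>\<^bsub>X\<^esub>\<sigma>\<in>K. h \<sigma> m)"
    using assms(1) by (elim HOM_carrierE that)
  show ?thesis
    unfolding f using K
  proof (induct K)
    case empty
    show ?case using zero by (simp only: X.X.finsum_empty)
  next
    case (insert \<sigma> K)
    let ?r = "\<lambda>m\<in>carrier M. \<Oplus>\<^bsub>X\<^esub>\<tau>\<in>K. h \<tau> m"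
    have c: "h \<tau> m \<in> carrier X" if "\<tau> \<in> insert \<sigma> K" "m \<in> carrier M" for \<tau> m
      using that insert(5) linear_mapsD(2)[OF HOM_deg_linear] by blast
    have eq: "(\<lambda>m\<in>carrier M. \<Oplus>\<^bsub>X\<^esub>\<tau>\<in>insert \<sigma> K. h \<tau> m) = (\<lambda>m\<in>carrier M. h \<sigma> m \<oplus>\<^bsub>X\<^esub> ?r m)"
      using insert(1,2) c by (intro restrict_ext) (simp add: X.X.finsum_insert Pi_iff)
    show ?case
      unfolding eq
    proof (rule add)
      show "?r \<in> carrier H" using insert by (intro HOM_carrierI) auto
      show "h \<sigma> \<in> carrier H" using insert by (intro HOM_deg_closed) auto
      show "P (h \<sigma>)" using insert deg by auto
      show "P ?r" by (rule insert(3)) (use insert in auto)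
    qed
  qed
qed

lemma HOM_linear: "f \<in> carrier H \<Longrightarrow> f \<in> linear_maps R M X"
  by (induct rule: HOM_induct) (rule linear_zero, erule HOM_deg_linear, rule linear_add)

lemmas HOM_D = linear_mapsD[OF HOM_linear]

lemma HOM_ext:
  assumes "f \<in> linear_maps R M X" "f' \<in> linear_maps R M X"
    and eq: "\<And>\<nu> m. \<nu> \<in> carrier G \<Longrightarrow> m \<in> mcomp M \<nu> \<Longrightarrow> f m = f' m"
  shows "f = f'"
proof (rule extensionalityI[of _ "carrier M"])
  note f = linear_mapsD[OF assms(1)] and f' = linear_mapsD[OF assms(2)]
  have "f \<zero>\<^bsub>M\<^esub> = f' \<zero>\<^bsub>M\<^esub>"
    using eq[of "\<one>\<^bsub>G\<^esub>" "\<zero>\<^bsub>M\<^esub>"] M.X.comp_zero[of "\<one>\<^bsub>G\<^esub>"] by simp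
  show "f m = f' m" if "m \<in> carrier M" for m
    using that by (induct rule: M.X.comp_induct) (auto simp: \<open>f \<zero>\<^bsub>M\<^esub> = f' \<zero>\<^bsub>M\<^esub>\<close> eq f f')
qed (use linear_mapsD(1) assms in auto)

lemma HOM_neg_closed: "f \<in> carrier H \<Longrightarrow> (\<lambda>m\<in>carrier M. \<ominus>\<^bsub>X\<^esub> f m) \<in> carrier H"
proof (induct rule: HOM_induct)
  case zero
  have "\<ominus>\<^bsub>X\<^esub> \<zero>\<^bsub>X\<^esub> = \<zero>\<^bsub>X\<^esub>" by (rule X.X.minus_equality) auto
  then have "(\<lambda>m\<in>carrier M. \<ominus>\<^bsub>X\<^esub> (\<lambda>m\<in>carrier M. \<zero>\<^bsub>X\<^esub>) m) = (\<lambda>m\<in>carrier M. \<zero>\<^bsub>X\<^esub>)"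
    by (intro restrict_ext) simp
  then show ?case by (simp only: HOM_zero_closed)
next
  case (deg \<sigma> f)
  then show ?case using HOM_deg_closed HOM_deg_neg by blast
next
  case (add f f')
  have "(\<lambda>m\<in>carrier M. \<ominus>\<^bsub>X\<^esub> (\<lambda>m\<in>carrier M. f m \<oplus>\<^bsub>X\<^esub> f' m) m) =
    (\<lambda>m\<in>carrier M. (\<lambda>m\<in>carrier M. \<ominus>\<^bsub>X\<^esub> f m) m \<oplus>\<^bsub>X\<^esub> (\<lambda>m\<in>carrier M. \<ominus>\<^bsub>X\<^esub> f' m) m)"
    by (intro restrict_ext) (simp add: X.X.minus_add HOM_D(2)[OF add(1)] HOM_D(2)[OF add(2)])
  then show ?case by (simp only: HOM_add_closed[OF add(3,4)])
qed

text \<open>A homogeneous f and a homogeneous s give a homogeneous map, so both are decomposed, f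
  first and then s.\<close>

lemma HOM_smult_closed:
  assumes "f \<in> carrier H" "s \<in> carrier S" shows "(\<lambda>m\<in>carrier M. f (m \<odot>\<^sub>r\<^bsub>M\<^esub> s)) \<in> carrier H"
  using assms(1)
proof (induct rule: HOM_induct)
  case zero
  have "(\<lambda>m\<in>carrier M. (\<lambda>m\<in>carrier M. \<zero>\<^bsub>X\<^esub>) (m \<odot>\<^sub>r\<^bsub>M\<^esub> s)) = (\<lambda>m\<in>carrier M. \<zero>\<^bsub>X\<^esub>)"
    using assms(2) by (intro restrict_ext) (simp add: rsmult_closed)
  then show ?case by (simp only: HOM_zero_closed)
next
  case (add f f')
  have "(\<lambda>m\<in>carrier M. (\<lambda>m\<in>carrier M. f m \<oplus>\<^bsub>X\<^esub> f' m) (m \<odot>\<^sub>r\<^bsub>M\<^esub> s)) =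
    (\<lambda>m\<in>carrier M. (\<lambda>m\<in>carrier M. f (m \<odot>\<^sub>r\<^bsub>M\<^esub> s)) m \<oplus>\<^bsub>X\<^esub> (\<lambda>m\<in>carrier M. f' (m \<odot>\<^sub>r\<^bsub>M\<^esub> s)) m)"
    using assms(2) by (intro restrict_ext) (simp add: rsmult_closed)
  then show ?case by (simp only: HOM_add_closed[OF add(3,4)])
next
  case (deg \<sigma> f)
  note f = linear_mapsD[OF HOM_deg_linear[OF deg(2)]]
  show ?case using assms(2)
  proof (induct rule: S.R.comp_induct)
    case zero
    have "f \<zero>\<^bsub>M\<^esub> = \<zero>\<^bsub>X\<^esub>"
      using f(4)[of "\<zero>\<^bsub>R\<^esub>" "\<zero>\<^bsub>M\<^esub>"] f(2)[of "\<zero>\<^bsub>M\<^esub>"] by simp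
    moreover have "m \<odot>\<^sub>r\<^bsub>M\<^esub> \<zero>\<^bsub>S\<^esub> = \<zero>\<^bsub>M\<^esub>" if "m \<in> carrier M" for m
      using rsmult_r_distr[OF that, of "\<zero>\<^bsub>S\<^esub>" "\<zero>\<^bsub>S\<^esub>"] rsmult_closed[OF that, of "\<zero>\<^bsub>S\<^esub>"]
      by (metis M.X.add.r_cancel_one S.R.l_zero S.R.zero_closed)
    ultimately have "(\<lambda>m\<in>carrier M. f (m \<odot>\<^sub>r\<^bsub>M\<^esub> \<zero>\<^bsub>S\<^esub>)) = (\<lambda>m\<in>carrier M. \<zero>\<^bsub>X\<^esub>)"
      by (intro restrict_ext) simp
    then show ?case by (simp only: HOM_zero_closed)
  next
    case (comp \<tau> s)
    show ?case by (rule HOM_deg_closed[OF _ HOM_deg_smult[OF deg(1) comp(1) deg(2) comp(2)]]) (use deg comp in auto)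
  next
    case (add s t)
    have "(\<lambda>m\<in>carrier M. f (m \<odot>\<^sub>r\<^bsub>M\<^esub> (s \<oplus>\<^bsub>S\<^esub> t))) =
      (\<lambda>m\<in>carrier M. (\<lambda>m\<in>carrier M. f (m \<odot>\<^sub>r\<^bsub>M\<^esub> s)) m \<oplus>\<^bsub>X\<^esub> (\<lambda>m\<in>carrier M. f (m \<odot>\<^sub>r\<^bsub>M\<^esub> t)) m)"
      using add by (intro restrict_ext) (simp add: rsmult_closed rsmult_r_distr f)
    then show ?case by (simp only: HOM_add_closed[OF add(3,4)])
  qed
qed

text \<open>The component is prescribed only on homogeneous elements, where it is given by a
  coordinate of X and determines a linear map. Existence follows by additivity in f, which avoids
  proving linearity of a formula for inhomogeneous m.\<close>

lemma HOM_component: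
  assumes \<sigma>: "\<sigma> \<in> carrier G" and f: "f \<in> carrier H"
  shows "\<exists>g\<in>HOM_deg G R M X \<sigma>. \<forall>\<nu>\<in>carrier G. \<forall>m\<in>mcomp M \<nu>. g m = X.X.pr (\<nu> \<otimes>\<^bsub>G\<^esub> \<sigma>) (f m)"
  using f
proof (induct rule: HOM_induct)
  case zero
  show ?case using \<sigma> by (intro bexI[OF _ HOM_deg_zero]) (auto simp: M.X.comp_carrier)
next
  case (deg \<tau> f)
  show ?case
  proof (cases "\<tau> = \<sigma>")
    case True
    then show ?thesis using deg HOM_deg_comp[OF deg(2)] by (intro bexI[of _ f]) (auto simp: X.X.pr_same)
  next
    case False
    have "X.X.pr (\<nu> \<otimes>\<^bsub>G\<^esub> \<sigma>) (f m) = \<zero>\<^bsub>X\<^esub>" if "\<nu> \<in> carrier G" "m \<in> mcomp M \<nu>" for \<nu> m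
      using that \<sigma> False deg(1) HOM_deg_comp[OF deg(2) that]
      by (intro X.X.pr_other[of _ "\<nu> \<otimes>\<^bsub>G\<^esub> \<tau>"]) auto
    then show ?thesis using \<sigma> by (intro bexI[OF _ HOM_deg_zero]) (auto simp: M.X.comp_carrier)
  qed
next
  case (add f f')
  then obtain g g' where g: "g \<in> HOM_deg G R M X \<sigma>" "g' \<in> HOM_deg G R M X \<sigma>"
    "\<And>\<nu> m. \<nu> \<in> carrier G \<Longrightarrow> m \<in> mcomp M \<nu> \<Longrightarrow> g m = X.X.pr (\<nu> \<otimes>\<^bsub>G\<^esub> \<sigma>) (f m)"
    "\<And>\<nu> m. \<nu> \<in> carrier G \<Longrightarrow> m \<in> mcomp M \<nu> \<Longrightarrow> g' m = X.X.pr (\<nu> \<otimes>\<^bsub>G\<^esub> \<sigma>) (f' m)"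
    by blast
  then show ?case
    using \<sigma> HOM_D(2)[OF add(1)] HOM_D(2)[OF add(2)]
    by (intro bexI[OF _ HOM_deg_add[OF \<sigma> g(1,2)]]) (auto simp: M.X.comp_carrier X.X.pr_add)
qed

lemma HOM_graded_module: "graded_module G S H"
proof -
  interpret H: abelian_group H
  proof (rule abelian_groupI)
    fix f g assume fg: "f \<in> carrier H" "g \<in> carrier H"
    show "f \<oplus>\<^bsub>H\<^esub> g \<in> carrier H" using HOM_add_closed fg by simp
    show "f \<oplus>\<^bsub>H\<^esub> g = g \<oplus>\<^bsub>H\<^esub> f"
      by (simp, intro restrict_ext) (simp add: X.X.a_comm HOM_D(2)[OF fg(1)] HOM_D(2)[OF fg(2)])
    fix h assume h: "h \<in> carrier H"
    show "f \<oplus>\<^bsub>H\<^esub> g \<oplus>\<^bsub>H\<^esub> h = f \<oplus>\<^bsub>H\<^esub> (g \<oplus>\<^bsub>H\<^esub> h)"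
      by (simp, intro restrict_ext)
        (simp add: X.X.a_assoc HOM_D(2)[OF fg(1)] HOM_D(2)[OF fg(2)] HOM_D(2)[OF h])
  next
    fix f assume f: "f \<in> carrier H"
    show "\<zero>\<^bsub>H\<^esub> \<oplus>\<^bsub>H\<^esub> f = f"
      by (rule extensionalityI[of _ "carrier M"]) (use HOM_D(1,2)[OF f] in auto)
    have "(\<lambda>m\<in>carrier M. \<ominus>\<^bsub>X\<^esub> f m) \<oplus>\<^bsub>H\<^esub> f = \<zero>\<^bsub>H\<^esub>"
      by (simp, intro restrict_ext) (simp add: X.X.l_neg HOM_D(2)[OF f])
    then show "\<exists>g\<in>carrier H. g \<oplus>\<^bsub>H\<^esub> f = \<zero>\<^bsub>H\<^esub>" using HOM_neg_closed[OF f] by blast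
  qed (use HOM_zero_closed in simp)
  have neg: "\<ominus>\<^bsub>H\<^esub> f = (\<lambda>m\<in>carrier M. \<ominus>\<^bsub>X\<^esub> f m)" if f: "f \<in> carrier H" for f
  proof (rule H.minus_equality)
    show "(\<lambda>m\<in>carrier M. \<ominus>\<^bsub>X\<^esub> f m) \<oplus>\<^bsub>H\<^esub> f = \<zero>\<^bsub>H\<^esub>"
      by (simp, intro restrict_ext) (simp add: X.X.l_neg HOM_D(2)[OF f])
  qed (use f HOM_neg_closed in auto)
  \<comment> \<open>The coordinate maps of HOM are chosen by their values on homogeneous elements.
    Since these values determine a linear map, \<open>c_eq\<close> reduces all requirements on
    \<open>c\<close> to coordinates in X.\<close>
  define c where "c \<sigma> f = (SOME g. g \<in> HOM_deg G R M X \<sigma> \<and>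
    (\<forall>\<nu>\<in>carrier G. \<forall>m\<in>mcomp M \<nu>. g m = X.X.pr (\<nu> \<otimes>\<^bsub>G\<^esub> \<sigma>) (f m)))" for \<sigma> f
  have c: "c \<sigma> f \<in> HOM_deg G R M X \<sigma>"
    "\<And>\<nu> m. \<nu> \<in> carrier G \<Longrightarrow> m \<in> mcomp M \<nu> \<Longrightarrow> c \<sigma> f m = X.X.pr (\<nu> \<otimes>\<^bsub>G\<^esub> \<sigma>) (f m)"
    if "\<sigma> \<in> carrier G" "f \<in> carrier H" for \<sigma> f
  proof -
    have "\<exists>g. g \<in> HOM_deg G R M X \<sigma> \<and>
        (\<forall>\<nu>\<in>carrier G. \<forall>m\<in>mcomp M \<nu>. g m = X.X.pr (\<nu> \<otimes>\<^bsub>G\<^esub> \<sigma>) (f m))"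
      using HOM_component[OF that] by blast
    from someI_ex[OF this]
    show "c \<sigma> f \<in> HOM_deg G R M X \<sigma>"
      "\<And>\<nu> m. \<nu> \<in> carrier G \<Longrightarrow> m \<in> mcomp M \<nu> \<Longrightarrow> c \<sigma> f m = X.X.pr (\<nu> \<otimes>\<^bsub>G\<^esub> \<sigma>) (f m)"
      unfolding c_def by blast+
  qed
  have c_eq: "c \<sigma> f = g"
    if "\<sigma> \<in> carrier G" "f \<in> carrier H" "g \<in> linear_maps R M X"
      "\<And>\<nu> m. \<nu> \<in> carrier G \<Longrightarrow> m \<in> mcomp M \<nu> \<Longrightarrow> g m = X.X.pr (\<nu> \<otimes>\<^bsub>G\<^esub> \<sigma>) (f m)" for \<sigma> f g
  proof (rule HOM_ext)
    show "c \<sigma> f \<in> linear_maps R M X" by (rule HOM_deg_linear[OF c(1)[OF that(1,2)]])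
  qed (use that c(2) in auto)
  have degU: "(\<Union>\<sigma>\<in>carrier G. HOM_deg G R M X \<sigma>) \<subseteq> carrier H" using HOM_deg_closed by blast
  have ids: "internal_direct_sum H (carrier G) (mcomp H)"
  proof (rule H.internal_direct_sumI[where c = c])
    fix \<sigma> assume \<sigma>: "\<sigma> \<in> carrier G"
    show "subgroup (mcomp H \<sigma>) (add_monoid H)"
    proof (rule H.add.subgroupI)
      show "mcomp H \<sigma> \<noteq> {}" using HOM_deg_zero[OF \<sigma>] by auto
      show "\<ominus>\<^bsub>H\<^esub> f \<in> mcomp H \<sigma>" if "f \<in> mcomp H \<sigma>" for f
        using that neg[OF HOM_deg_closed[OF \<sigma>]] HOM_deg_neg[OF \<sigma>] by simp
    qed (use \<sigma> HOM_deg_closed HOM_deg_add in auto)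
    show "c \<sigma> f \<in> carrier H" if f: "f \<in> carrier H" for f using c(1)[OF \<sigma> f] HOM_deg_closed[OF \<sigma>] by blast
    show "c \<sigma> (f \<oplus>\<^bsub>H\<^esub> g) = c \<sigma> f \<oplus>\<^bsub>H\<^esub> c \<sigma> g" if fg: "f \<in> carrier H" "g \<in> carrier H" for f g
      using \<sigma> fg c(2) HOM_deg_linear[OF c(1)[OF \<sigma> fg(1)]] HOM_deg_linear[OF c(1)[OF \<sigma> fg(2)]]
        HOM_D(2)[OF fg(1)] HOM_D(2)[OF fg(2)]
      by (intro c_eq) (auto simp: HOM_add_closed HOM_deg_linear M.X.comp_carrier X.X.pr_add intro!: linear_add)
    show "c \<sigma> f = f" if f: "f \<in> mcomp H \<sigma>" for f
      using \<sigma> f HOM_deg_closed[OF \<sigma>] HOM_deg_comp by (intro c_eq) (auto simp: HOM_deg_linear X.X.pr_same)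
    show "c \<sigma> f = \<zero>\<^bsub>H\<^esub>" if \<tau>: "\<tau> \<in> carrier G" "\<sigma> \<noteq> \<tau>" "f \<in> mcomp H \<tau>" for \<tau> f
    proof -
      have "X.X.pr (\<nu> \<otimes>\<^bsub>G\<^esub> \<sigma>) (f m) = \<zero>\<^bsub>X\<^esub>" if "\<nu> \<in> carrier G" "m \<in> mcomp M \<nu>" for \<nu> m
        using that \<sigma> \<tau> HOM_deg_comp[of f \<tau> \<nu> m]
        by (intro X.X.pr_other[of _ "\<nu> \<otimes>\<^bsub>G\<^esub> \<tau>"]) auto
      then show ?thesis
        using \<sigma> \<tau> HOM_deg_closed[of \<tau> f] by (intro c_eq) (auto simp: linear_zero M.X.comp_carrier)
    qed
  next
    fix f assume "f \<in> carrier H"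
    then show "f \<in> add_span H (\<Union>\<sigma>\<in>carrier G. mcomp H \<sigma>)"
    proof (induct rule: HOM_induct)
      case zero
      show ?case using add_span.zero[of H] by (simp only: HOM_simps)
    next
      case (deg \<sigma> f)
      then show ?case using degU by (intro H.add_span_incl) auto
    next
      case (add f f')
      have "f \<oplus>\<^bsub>H\<^esub> f' \<in> add_span H (\<Union>\<sigma>\<in>carrier G. mcomp H \<sigma>)"
        by (rule H.add_span_add[OF _ add(3,4)]) (use degU in simp)
      then show ?case by (simp only: HOM_simps)
    qed
  qed
  show ?thesis
  proof unfold_locales
    fix s f assume s: "s \<in> carrier S" and f: "f \<in> carrier H"
    show "s \<odot>\<^bsub>H\<^esub> f \<in> carrier H" using HOM_smult_closed s f by simp
    note f' = HOM_D[OF f]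
    show "(s \<oplus>\<^bsub>S\<^esub> t) \<odot>\<^bsub>H\<^esub> f = s \<odot>\<^bsub>H\<^esub> f \<oplus>\<^bsub>H\<^esub> t \<odot>\<^bsub>H\<^esub> f" if "t \<in> carrier S" for t
      by (simp, intro restrict_ext) (use that s in \<open>simp add: rsmult_r_distr rsmult_closed f'\<close>)
    show "s \<odot>\<^bsub>H\<^esub> (f \<oplus>\<^bsub>H\<^esub> g) = s \<odot>\<^bsub>H\<^esub> f \<oplus>\<^bsub>H\<^esub> s \<odot>\<^bsub>H\<^esub> g" if "g \<in> carrier H" for g
      by (simp, intro restrict_ext) (use s in \<open>simp add: rsmult_closed\<close>)
    show "(s \<otimes>\<^bsub>S\<^esub> t) \<odot>\<^bsub>H\<^esub> f = s \<odot>\<^bsub>H\<^esub> (t \<odot>\<^bsub>H\<^esub> f)" if "t \<in> carrier S" for t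
      by (simp, intro restrict_ext) (use that s in \<open>simp add: rsmult_closed rsmult_assoc\<close>)
  next
    show "\<one>\<^bsub>S\<^esub> \<odot>\<^bsub>H\<^esub> f = f" if f: "f \<in> carrier H" for f
      by (rule extensionalityI[of _ "carrier M"]) (use HOM_D[OF f] in \<open>auto simp: rsmult_one\<close>)
  qed (use ids HOM_deg_smult in auto)
qed

end

section \<open>Pairings and representability\<close>

context bimod
begin

lemma rsmult_zero_r [simp]: "m \<in> carrier M \<Longrightarrow> m \<odot>\<^sub>r\<^bsub>M\<^esub> \<zero>\<^bsub>S\<^esub> = \<zero>\<^bsub>M\<^esub>"
  using rsmult_r_distr[of m "\<zero>\<^bsub>S\<^esub>" "\<zero>\<^bsub>S\<^esub>"] rsmult_closed[of m "\<zero>\<^bsub>S\<^esub>"]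
  by (metis M.X.add.r_cancel_one S.R.l_zero S.R.zero_closed)

end

text \<open>The module \<open>Y\<close> with the evaluation map \<open>ap\<close> is a model of \<open>HOM G R M X\<close> (up to isomorphism).\<close>

locale hom_object = M: grmod G R M + S: grring G S + B: bimod G R S M + X: grmod G R X + Y: grmod G S Y
  for G :: "'g monoid" and R :: "('g, 'r) gring" and S :: "('g, 's) gring"
    and M :: "('g, 'r, 's, 'm) gbimodule" and X :: "('g, 'r, 'x) gmodule"
    and Y :: "('g, 's, 'y) gmodule" +
  fixes ap :: "'y \<Rightarrow> 'm \<Rightarrow> 'x"
  assumes ap_closed: "\<lbrakk>y \<in> carrier Y; m \<in> carrier M\<rbrakk> \<Longrightarrow> ap y m \<in> carrier X"
    and ap_add: "\<lbrakk>y \<in> carrier Y; y' \<in> carrier Y; m \<in> carrier M\<rbrakk> \<Longrightarrow> ap (y \<oplus>\<^bsub>Y\<^esub> y') m = ap y m \<oplus>\<^bsub>X\<^esub> ap y' m"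
    and ap_add_r: "\<lbrakk>y \<in> carrier Y; m \<in> carrier M; m' \<in> carrier M\<rbrakk> \<Longrightarrow> ap y (m \<oplus>\<^bsub>M\<^esub> m') = ap y m \<oplus>\<^bsub>X\<^esub> ap y m'"
    and ap_smult_r: "\<lbrakk>y \<in> carrier Y; m \<in> carrier M; a \<in> carrier R\<rbrakk> \<Longrightarrow> ap y (a \<odot>\<^bsub>M\<^esub> m) = a \<odot>\<^bsub>X\<^esub> ap y m"
    and ap_smult: "\<lbrakk>y \<in> carrier Y; m \<in> carrier M; s \<in> carrier S\<rbrakk> \<Longrightarrow> ap (s \<odot>\<^bsub>Y\<^esub> y) m = ap y (m \<odot>\<^sub>r\<^bsub>M\<^esub> s)"
    and ap_comp: "\<lbrakk>\<sigma> \<in> carrier G; \<nu> \<in> carrier G; y \<in> mcomp Y \<sigma>; m \<in> mcomp M \<nu>\<rbrakk> \<Longrightarrow> ap y m \<in> mcomp X (\<nu> \<otimes>\<^bsub>G\<^esub> \<sigma>)"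
    and ap_ext: "\<lbrakk>y \<in> carrier Y; y' \<in> carrier Y; \<And>m. m \<in> carrier M \<Longrightarrow> ap y m = ap y' m\<rbrakk> \<Longrightarrow> y = y'"
    and ap_surj: "\<lbrakk>\<sigma> \<in> carrier G; f \<in> HOM_deg G R M X \<sigma>\<rbrakk> \<Longrightarrow> \<exists>y\<in>mcomp Y \<sigma>. \<forall>m\<in>carrier M. ap y m = f m"
begin

lemma ap_zero [simp]: "m \<in> carrier M \<Longrightarrow> ap \<zero>\<^bsub>Y\<^esub> m = \<zero>\<^bsub>X\<^esub>"
  using ap_add[of "\<zero>\<^bsub>Y\<^esub>" "\<zero>\<^bsub>Y\<^esub>" m] ap_closed[of "\<zero>\<^bsub>Y\<^esub>" m]
  by (metis X.X.add.r_cancel_one Y.X.l_zero Y.X.zero_closed)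

text \<open>The function \<open>f\<close> may be given by a formula on the whole type; its
  restriction to the carrier of M is the extensional map that is represented.\<close>

lemma ap_ex:
  assumes \<sigma>: "\<sigma> \<in> carrier G" and f: "\<And>m. m \<in> carrier M \<Longrightarrow> f m \<in> carrier X"
    "\<And>m m'. m \<in> carrier M \<Longrightarrow> m' \<in> carrier M \<Longrightarrow> f (m \<oplus>\<^bsub>M\<^esub> m') = f m \<oplus>\<^bsub>X\<^esub> f m'"
    "\<And>a m. a \<in> carrier R \<Longrightarrow> m \<in> carrier M \<Longrightarrow> f (a \<odot>\<^bsub>M\<^esub> m) = a \<odot>\<^bsub>X\<^esub> f m"
    "\<And>\<nu> m. \<nu> \<in> carrier G \<Longrightarrow> m \<in> mcomp M \<nu> \<Longrightarrow> f m \<in> mcomp X (\<nu> \<otimes>\<^bsub>G\<^esub> \<sigma>)"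
  shows "\<exists>y\<in>mcomp Y \<sigma>. \<forall>m\<in>carrier M. ap y m = f m"
proof -
  have "(\<lambda>m\<in>carrier M. f m) \<in> HOM_deg G R M X \<sigma>"
    using f M.smult_closed M.X.comp_carrier
    by (auto simp: HOM_deg_def linear_maps_def)
  from ap_surj[OF \<sigma> this] show ?thesis by auto
qed

end

text \<open>The morphisms out of the tensor products are replaced by the balanced maps
  \<open>p\<close> and \<open>q\<close> that they induce on pairs. From here on no cosets occur, and
  the data are symmetric under exchange of the two rings.\<close>

locale pairing_context = R: grring G R + S: grring G S + M: grmod G R M + N: grmod G S N +
    MB: bimod G R S M + NB: bimod G S R N
  for G :: "'g monoid" and R :: "('g, 'r) gring" and S :: "('g, 's) gring"
    and M :: "('g, 'r, 's, 'm) gbimodule" and N :: "('g, 's, 'r, 'n) gbimodule" +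
  fixes p :: "'m \<Rightarrow> 'n \<Rightarrow> 'r" and q :: "'n \<Rightarrow> 'm \<Rightarrow> 's"
  assumes p_closed: "\<lbrakk>m \<in> carrier M; n \<in> carrier N\<rbrakk> \<Longrightarrow> p m n \<in> carrier R"
    and p_add_l: "\<lbrakk>m \<in> carrier M; m' \<in> carrier M; n \<in> carrier N\<rbrakk> \<Longrightarrow> p (m \<oplus>\<^bsub>M\<^esub> m') n = p m n \<oplus>\<^bsub>R\<^esub> p m' n"
    and p_add_r: "\<lbrakk>m \<in> carrier M; n \<in> carrier N; n' \<in> carrier N\<rbrakk> \<Longrightarrow> p m (n \<oplus>\<^bsub>N\<^esub> n') = p m n \<oplus>\<^bsub>R\<^esub> p m n'"
    and p_balanced: "\<lbrakk>m \<in> carrier M; n \<in> carrier N; s \<in> carrier S\<rbrakk> \<Longrightarrow> p (m \<odot>\<^sub>r\<^bsub>M\<^esub> s) n = p m (s \<odot>\<^bsub>N\<^esub> n)"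
    and p_smult: "\<lbrakk>m \<in> carrier M; n \<in> carrier N; a \<in> carrier R\<rbrakk> \<Longrightarrow> p (a \<odot>\<^bsub>M\<^esub> m) n = a \<otimes>\<^bsub>R\<^esub> p m n"
    and p_rsmult: "\<lbrakk>m \<in> carrier M; n \<in> carrier N; a \<in> carrier R\<rbrakk> \<Longrightarrow> p m (n \<odot>\<^sub>r\<^bsub>N\<^esub> a) = p m n \<otimes>\<^bsub>R\<^esub> a"
    and p_comp: "\<lbrakk>\<nu> \<in> carrier G; \<mu> \<in> carrier G; m \<in> mcomp M \<nu>; n \<in> mcomp N \<mu>\<rbrakk> \<Longrightarrow> p m n \<in> rcomp R (\<nu> \<otimes>\<^bsub>G\<^esub> \<mu>)"
    and q_closed: "\<lbrakk>n \<in> carrier N; m \<in> carrier M\<rbrakk> \<Longrightarrow> q n m \<in> carrier S"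
    and q_add_l: "\<lbrakk>n \<in> carrier N; n' \<in> carrier N; m \<in> carrier M\<rbrakk> \<Longrightarrow> q (n \<oplus>\<^bsub>N\<^esub> n') m = q n m \<oplus>\<^bsub>S\<^esub> q n' m"
    and q_add_r: "\<lbrakk>n \<in> carrier N; m \<in> carrier M; m' \<in> carrier M\<rbrakk> \<Longrightarrow> q n (m \<oplus>\<^bsub>M\<^esub> m') = q n m \<oplus>\<^bsub>S\<^esub> q n m'"
    and q_balanced: "\<lbrakk>n \<in> carrier N; m \<in> carrier M; a \<in> carrier R\<rbrakk> \<Longrightarrow> q (n \<odot>\<^sub>r\<^bsub>N\<^esub> a) m = q n (a \<odot>\<^bsub>M\<^esub> m)"
    and q_smult: "\<lbrakk>n \<in> carrier N; m \<in> carrier M; s \<in> carrier S\<rbrakk> \<Longrightarrow> q (s \<odot>\<^bsub>N\<^esub> n) m = s \<otimes>\<^bsub>S\<^esub> q n m"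
    and q_rsmult: "\<lbrakk>n \<in> carrier N; m \<in> carrier M; s \<in> carrier S\<rbrakk> \<Longrightarrow> q n (m \<odot>\<^sub>r\<^bsub>M\<^esub> s) = q n m \<otimes>\<^bsub>S\<^esub> s"
    and q_comp: "\<lbrakk>\<nu> \<in> carrier G; \<mu> \<in> carrier G; n \<in> mcomp N \<nu>; m \<in> mcomp M \<mu>\<rbrakk> \<Longrightarrow> q n m \<in> rcomp S (\<nu> \<otimes>\<^bsub>G\<^esub> \<mu>)"
    and p_q: "\<lbrakk>m \<in> carrier M; m' \<in> carrier M; n \<in> carrier N\<rbrakk> \<Longrightarrow> p m n \<odot>\<^bsub>M\<^esub> m' = m \<odot>\<^sub>r\<^bsub>M\<^esub> q n m'"
    and q_p: "\<lbrakk>m \<in> carrier M; n \<in> carrier N; n' \<in> carrier N\<rbrakk> \<Longrightarrow> q n m \<odot>\<^bsub>N\<^esub> n' = n \<odot>\<^sub>r\<^bsub>N\<^esub> p m n'"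

lemma pairing_context_swap:
  assumes "pairing_context G R S M N p q" shows "pairing_context G S R N M q p"
proof -
  interpret pairing_context G R S M N p q by fact
  show ?thesis
    by unfold_locales
      (simp_all add: p_closed p_add_l p_add_r p_balanced p_smult p_rsmult p_comp
        q_closed q_add_l q_add_r q_balanced q_smult q_rsmult q_comp p_q q_p)
qed

context pairing_context
begin

text \<open>This is the image of the morphism from the tensor product to R. Sums of values suffice,
  since signs and ring multiples can be moved into the arguments of \<open>p\<close>.\<close>

definition trace_ideal :: "'r set" where
  "trace_ideal = add_span R {p m n | m n. m \<in> carrier M \<and> n \<in> carrier N}"

abbreviation "I \<equiv> trace_ideal"

lemma p_zero_l [simp]: "n \<in> carrier N \<Longrightarrow> p \<zero>\<^bsub>M\<^esub> n = \<zero>\<^bsub>R\<^esub>"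
  using p_smult[of "\<zero>\<^bsub>M\<^esub>" n "\<zero>\<^bsub>R\<^esub>"] p_closed[of "\<zero>\<^bsub>M\<^esub>" n] by simp

lemma p_zero_r [simp]: "m \<in> carrier M \<Longrightarrow> p m \<zero>\<^bsub>N\<^esub> = \<zero>\<^bsub>R\<^esub>"
  using p_rsmult[of m "\<zero>\<^bsub>N\<^esub>" "\<zero>\<^bsub>R\<^esub>"] p_closed[of m "\<zero>\<^bsub>N\<^esub>"] by simp

lemma gens_carrier: "{p m n | m n. m \<in> carrier M \<and> n \<in> carrier N} \<subseteq> carrier R"
  using p_closed by auto

lemma p_in_trace: "\<lbrakk>m \<in> carrier M; n \<in> carrier N\<rbrakk> \<Longrightarrow> p m n \<in> I"
  unfolding trace_ideal_def by (rule R.R.add_span_incl[OF gens_carrier]) auto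

lemma trace_carrier: "a \<in> I \<Longrightarrow> a \<in> carrier R"
  unfolding trace_ideal_def by (rule R.R.add_span_closed[OF gens_carrier])

lemma trace_add: "\<lbrakk>a \<in> I; b \<in> I\<rbrakk> \<Longrightarrow> a \<oplus>\<^bsub>R\<^esub> b \<in> I"
  unfolding trace_ideal_def by (rule R.R.add_span_add[OF gens_carrier])

lemma trace_zero: "\<zero>\<^bsub>R\<^esub> \<in> I"
  unfolding trace_ideal_def by (rule add_span.zero)

lemma trace_induct [consumes 1, case_names zero add]:
  assumes "a \<in> I" and "P \<zero>\<^bsub>R\<^esub>"
    and "\<And>m n a. m \<in> carrier M \<Longrightarrow> n \<in> carrier N \<Longrightarrow> a \<in> I \<Longrightarrow> P a \<Longrightarrow> P (p m n \<oplus>\<^bsub>R\<^esub> a)"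
  shows "P a"
proof -
  have "P a \<and> a \<in> I"
    using assms(1)[unfolded trace_ideal_def]
  proof induct
    case zero
    then show ?case using assms(2) trace_zero by simp
  next
    case (add b a)
    then obtain m n where "m \<in> carrier M" "n \<in> carrier N" "b = p m n" by auto
    then show ?case using add assms(3) p_in_trace trace_add by auto
  qed
  then show ?thesis ..
qed

text \<open>Left and right multiples of \<open>p m n\<close> are absorbed by m and n. For
  homogeneous m and n the value is homogeneous, so each of its components is the value itself or
  zero; additivity in both arguments gives closure under coordinates.\<close>

lemma trace_gideal: "gideal G R I"
proof (intro gideal.intro gideal_axioms.intro R.grring_axioms)
  show "ideal I R"
  proof (rule idealI)
    show "subgroup I (add_monoid R)"
    proof (rule R.R.add.subgroupI)
      show "\<ominus>\<^bsub>R\<^esub> a \<in> I" if "a \<in> I" for a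
      proof -
        have "\<ominus>\<^bsub>R\<^esub> p m n \<in> I" if "m \<in> carrier M" "n \<in> carrier N" for m n
        proof -
          have "\<ominus>\<^bsub>R\<^esub> p m n = p ((\<ominus>\<^bsub>R\<^esub> \<one>\<^bsub>R\<^esub>) \<odot>\<^bsub>M\<^esub> m) n"
            using that p_smult[of m n "\<ominus>\<^bsub>R\<^esub> \<one>\<^bsub>R\<^esub>"] p_closed[of m n] by (simp add: R.R.l_minus)
          then show ?thesis using that p_in_trace M.smult_closed by simp
        qed
        then show ?thesis
          using that R.R.add_span_neg[OF gens_carrier] unfolding trace_ideal_def by blast
      qed
    qed (use trace_carrier trace_add trace_zero in auto)
  next
    fix a r assume a: "a \<in> I" and r: "r \<in> carrier R"
    show "r \<otimes>\<^bsub>R\<^esub> a \<in> I" using a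
    proof (induct rule: trace_induct)
      case (add m n a)
      then have "r \<otimes>\<^bsub>R\<^esub> (p m n \<oplus>\<^bsub>R\<^esub> a) = p (r \<odot>\<^bsub>M\<^esub> m) n \<oplus>\<^bsub>R\<^esub> r \<otimes>\<^bsub>R\<^esub> a"
        using r by (simp add: R.R.r_distr p_closed trace_carrier p_smult)
      then show ?case using add r by (simp add: trace_add p_in_trace M.smult_closed)
    qed (use r trace_zero in auto)
    show "a \<otimes>\<^bsub>R\<^esub> r \<in> I" using a
    proof (induct rule: trace_induct)
      case (add m n a)
      then have "(p m n \<oplus>\<^bsub>R\<^esub> a) \<otimes>\<^bsub>R\<^esub> r = p m (n \<odot>\<^sub>r\<^bsub>N\<^esub> r) \<oplus>\<^bsub>R\<^esub> a \<otimes>\<^bsub>R\<^esub> r"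
        using r by (simp add: R.R.l_distr p_closed trace_carrier p_rsmult)
      then show ?case using add r by (simp add: trace_add p_in_trace NB.rsmult_closed)
    qed (use r trace_zero in auto)
  qed (rule R.R.ring_axioms)
next
  fix \<nu> a assume \<nu>: "\<nu> \<in> carrier G" and a: "a \<in> I"
  have p: "R.R.pr \<nu> (p m n) \<in> I" if "m \<in> carrier M" "n \<in> carrier N" for m n
    using that
  proof (induct arbitrary: n rule: M.X.comp_induct)
    case (comp \<tau> m)
    have m: "m \<in> carrier M" using comp M.X.comp_carrier by blast
    show ?case using \<open>n \<in> carrier N\<close>
    proof (induct rule: N.X.comp_induct)
      case (comp \<mu> n)
      then have n: "n \<in> carrier N" using N.X.comp_carrier by blast
      have "p m n \<in> rcomp R (\<tau> \<otimes>\<^bsub>G\<^esub> \<mu>)" using comp \<open>\<tau> \<in> carrier G\<close> \<open>m \<in> mcomp M \<tau>\<close> by (intro p_comp)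
      then show ?case
        using \<nu> comp(1) \<open>\<tau> \<in> carrier G\<close> p_in_trace[OF m n] R.R.pr_same[of \<nu> "p m n"]
          R.R.pr_other[of \<nu> "\<tau> \<otimes>\<^bsub>G\<^esub> \<mu>" "p m n"] trace_zero by (cases "\<nu> = \<tau> \<otimes>\<^bsub>G\<^esub> \<mu>") auto
    qed (use m \<nu> in \<open>auto simp: p_add_r R.R.pr_add p_closed trace_add trace_zero\<close>)
  qed (use \<nu> in \<open>auto simp: p_add_l R.R.pr_add p_closed trace_add trace_zero\<close>)
  show "R.R.pr \<nu> a \<in> I" using a
    by (induct rule: trace_induct)
      (use \<nu> in \<open>auto simp: R.R.pr_add p_closed trace_add trace_zero trace_carrier p\<close>)
qed

text \<open>The difference is killed by the generators of the trace ideal and hence by the whole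
  ideal. Below, elements of a torsion-free module are identified by their multiples with the values
  of \<open>p\<close>.\<close>

lemma torsion_free_ext:
  assumes X: "graded_module G R X" "torsion_free I X" and xy: "x \<in> carrier X" "y \<in> carrier X"
    and eq: "\<And>m n. m \<in> carrier M \<Longrightarrow> n \<in> carrier N \<Longrightarrow> p m n \<odot>\<^bsub>X\<^esub> x = p m n \<odot>\<^bsub>X\<^esub> y"
  shows "x = y"
proof -
  interpret X: grmod G R X by (rule grmodI) fact
  have "a \<odot>\<^bsub>X\<^esub> x = a \<odot>\<^bsub>X\<^esub> y" if "a \<in> I" for a
    using that
    by (induct rule: trace_induct) (use xy in \<open>auto simp: X.smult_l_distr p_closed trace_carrier eq\<close>)
  then have "a \<odot>\<^bsub>X\<^esub> (x \<ominus>\<^bsub>X\<^esub> y) = \<zero>\<^bsub>X\<^esub>" if "a \<in> I" for a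
    using that xy by (simp add: X.smult_minus trace_carrier X.X.minus_eq_zero_iff X.smult_closed)
  then have "x \<ominus>\<^bsub>X\<^esub> y = \<zero>\<^bsub>X\<^esub>" using X(2) xy by (simp add: torsion_free_def)
  then show ?thesis using xy X.X.minus_eq_zero_iff by simp
qed

text \<open>Sending \<open>p m n\<close> to \<open>\<beta> m n\<close> should define a map on the
  trace ideal, but an element of the ideal has many expressions as a sum of such values. The image
  g(a) is therefore characterized by its products with all values of \<open>p\<close>, a condition
  that involves no expression of a and that torsion-freeness makes unique.\<close>

lemma balanced_map_representable:
  assumes X: "torsion_closed G R I X" and \<sigma>: "\<sigma> \<in> carrier G"
    and closed: "\<And>m n. m \<in> carrier M \<Longrightarrow> n \<in> carrier N \<Longrightarrow> \<beta> m n \<in> carrier X"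
    and add_l: "\<And>m m' n. m \<in> carrier M \<Longrightarrow> m' \<in> carrier M \<Longrightarrow> n \<in> carrier N \<Longrightarrow>
      \<beta> (m \<oplus>\<^bsub>M\<^esub> m') n = \<beta> m n \<oplus>\<^bsub>X\<^esub> \<beta> m' n"
    and add_r: "\<And>m n n'. m \<in> carrier M \<Longrightarrow> n \<in> carrier N \<Longrightarrow> n' \<in> carrier N \<Longrightarrow>
      \<beta> m (n \<oplus>\<^bsub>N\<^esub> n') = \<beta> m n \<oplus>\<^bsub>X\<^esub> \<beta> m n'"
    and smult: "\<And>m n a. m \<in> carrier M \<Longrightarrow> n \<in> carrier N \<Longrightarrow> a \<in> carrier R \<Longrightarrow>
      \<beta> (a \<odot>\<^bsub>M\<^esub> m) n = a \<odot>\<^bsub>X\<^esub> \<beta> m n"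
    and balanced: "\<And>m n s. m \<in> carrier M \<Longrightarrow> n \<in> carrier N \<Longrightarrow> s \<in> carrier S \<Longrightarrow>
      \<beta> (m \<odot>\<^sub>r\<^bsub>M\<^esub> s) n = \<beta> m (s \<odot>\<^bsub>N\<^esub> n)"
    and comp: "\<And>\<nu> \<mu> m n. \<nu> \<in> carrier G \<Longrightarrow> \<mu> \<in> carrier G \<Longrightarrow> m \<in> mcomp M \<nu> \<Longrightarrow> n \<in> mcomp N \<mu> \<Longrightarrow>
      \<beta> m n \<in> mcomp X (\<nu> \<otimes>\<^bsub>G\<^esub> \<mu> \<otimes>\<^bsub>G\<^esub> \<sigma>)"
  shows "\<exists>x\<in>mcomp X \<sigma>. \<forall>m\<in>carrier M. \<forall>n\<in>carrier N. \<beta> m n = p m n \<odot>\<^bsub>X\<^esub> x"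
proof -
  have grX: "graded_module G R X" and tfX: "torsion_free I X" and extX: "ideal_maps_extend G R I X"
    using X by (auto simp: torsion_closed_def)
  interpret X: grmod G R X by (rule grmodI) fact
  note ext = torsion_free_ext[OF grX tfX]
  have zero_r: "\<beta> m \<zero>\<^bsub>N\<^esub> = \<zero>\<^bsub>X\<^esub>" if "m \<in> carrier M" for m
    using add_r[of m "\<zero>\<^bsub>N\<^esub>" "\<zero>\<^bsub>N\<^esub>"] closed[of m "\<zero>\<^bsub>N\<^esub>"] that
    by (metis N.X.l_zero N.X.zero_closed X.X.add.r_cancel_one)
  \<comment> \<open>Move \<open>p m n\<close> into the first argument, rewrite \<open>p m n\<close>
    times m' as m times \<open>q n m'\<close>, pass \<open>q n m'\<close> to the second argument by
    balancedness, and rewrite it there as n times \<open>p m' n'\<close>. Both associativity laws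
    are used.\<close>
  have assoc: "p m n \<odot>\<^bsub>X\<^esub> \<beta> m' n' = \<beta> m (n \<odot>\<^sub>r\<^bsub>N\<^esub> p m' n')"
    if "m \<in> carrier M" "m' \<in> carrier M" "n \<in> carrier N" "n' \<in> carrier N" for m m' n n'
  proof -
    have "p m n \<odot>\<^bsub>X\<^esub> \<beta> m' n' = \<beta> (m \<odot>\<^sub>r\<^bsub>M\<^esub> q n m') n'"
      using that by (simp add: p_closed flip: smult p_q)
    also have "\<dots> = \<beta> m (n \<odot>\<^sub>r\<^bsub>N\<^esub> p m' n')"
      using that by (simp add: balanced q_closed q_p)
    finally show ?thesis .
  qed
  have ex: "\<exists>y\<in>carrier X. \<forall>m\<in>carrier M. \<forall>n\<in>carrier N. p m n \<odot>\<^bsub>X\<^esub> y = \<beta> m (n \<odot>\<^sub>r\<^bsub>N\<^esub> a)"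
    if "a \<in> I" for a
    using that
  proof (induct rule: trace_induct)
    case zero
    then show ?case by (intro bexI[of _ "\<zero>\<^bsub>X\<^esub>"]) (auto simp: p_closed zero_r)
  next
    case (add m n a)
    then obtain y where y: "y \<in> carrier X"
      "\<And>m n. m \<in> carrier M \<Longrightarrow> n \<in> carrier N \<Longrightarrow> p m n \<odot>\<^bsub>X\<^esub> y = \<beta> m (n \<odot>\<^sub>r\<^bsub>N\<^esub> a)" by blast
    show ?case
      using y add(1-3)
      \<comment> \<open>By \<open>assoc\<close> the value \<open>\<beta> m n\<close> represents the
        generator \<open>p m n\<close>.\<close>
      by (intro bexI[of _ "\<beta> m n \<oplus>\<^bsub>X\<^esub> y"])
        (auto simp: X.smult_r_distr p_closed closed assoc NB.rsmult_r_distr trace_carrier NB.rsmult_closed add_r)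
  qed
  define g where "g a = (THE y. y \<in> carrier X \<and>
    (\<forall>m\<in>carrier M. \<forall>n\<in>carrier N. p m n \<odot>\<^bsub>X\<^esub> y = \<beta> m (n \<odot>\<^sub>r\<^bsub>N\<^esub> a)))" for a
  have g_eq: "g a = y" if "y \<in> carrier X"
    "\<And>m n. m \<in> carrier M \<Longrightarrow> n \<in> carrier N \<Longrightarrow> p m n \<odot>\<^bsub>X\<^esub> y = \<beta> m (n \<odot>\<^sub>r\<^bsub>N\<^esub> a)" for a y
    unfolding g_def
  proof (rule the_equality)
    fix y'
    assume y': "y' \<in> carrier X \<and>
      (\<forall>m\<in>carrier M. \<forall>n\<in>carrier N. p m n \<odot>\<^bsub>X\<^esub> y' = \<beta> m (n \<odot>\<^sub>r\<^bsub>N\<^esub> a))"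
    show "y' = y" by (rule ext) (use y' that in auto)
  qed (use that in auto)
  have g: "g a \<in> carrier X"
    "\<And>m n. m \<in> carrier M \<Longrightarrow> n \<in> carrier N \<Longrightarrow> p m n \<odot>\<^bsub>X\<^esub> g a = \<beta> m (n \<odot>\<^sub>r\<^bsub>N\<^esub> a)" if aI: "a \<in> I" for a
  proof -
    obtain y where y: "y \<in> carrier X"
      "\<And>m n. m \<in> carrier M \<Longrightarrow> n \<in> carrier N \<Longrightarrow> p m n \<odot>\<^bsub>X\<^esub> y = \<beta> m (n \<odot>\<^sub>r\<^bsub>N\<^esub> a)"
      using ex[OF aI] by blast
    have "g a = y" by (rule g_eq) (use y in auto)
    then show "g a \<in> carrier X"
      "\<And>m n. m \<in> carrier M \<Longrightarrow> n \<in> carrier N \<Longrightarrow> p m n \<odot>\<^bsub>X\<^esub> g a = \<beta> m (n \<odot>\<^sub>r\<^bsub>N\<^esub> a)"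
      using y by auto
  qed
  have "\<exists>x\<in>mcomp X \<sigma>. \<forall>a\<in>I. g a = a \<odot>\<^bsub>X\<^esub> x"
  proof (rule extX[unfolded ideal_maps_extend_def, rule_format, OF \<sigma>])
    show "g a \<in> carrier X" if "a \<in> I" for a using g that by blast
    show "g (a \<oplus>\<^bsub>R\<^esub> b) = g a \<oplus>\<^bsub>X\<^esub> g b" if "a \<in> I" "b \<in> I" for a b
      using that g
      by (intro g_eq) (auto simp: X.smult_r_distr p_closed NB.rsmult_r_distr trace_carrier add_r NB.rsmult_closed)
    show "g (r \<otimes>\<^bsub>R\<^esub> a) = r \<odot>\<^bsub>X\<^esub> g a" if "r \<in> carrier R" "a \<in> I" for r a
    proof (rule g_eq)
      fix m n assume mn: "m \<in> carrier M" "n \<in> carrier N"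
      have "p m n \<odot>\<^bsub>X\<^esub> (r \<odot>\<^bsub>X\<^esub> g a) = p m (n \<odot>\<^sub>r\<^bsub>N\<^esub> r) \<odot>\<^bsub>X\<^esub> g a"
        using mn that g by (simp add: p_rsmult X.smult_assoc p_closed)
      then show "p m n \<odot>\<^bsub>X\<^esub> (r \<odot>\<^bsub>X\<^esub> g a) = \<beta> m (n \<odot>\<^sub>r\<^bsub>N\<^esub> (r \<otimes>\<^bsub>R\<^esub> a))"
        using mn that by (simp add: g NB.rsmult_closed NB.rsmult_assoc trace_carrier)
    qed (use that g X.smult_closed in auto)
    show "g a \<in> mcomp X (\<tau> \<otimes>\<^bsub>G\<^esub> \<sigma>)" if \<tau>: "\<tau> \<in> carrier G" and "a \<in> I \<inter> rcomp R \<tau>" for \<tau> a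
    proof -
      have a: "a \<in> I" "a \<in> rcomp R \<tau>" using that by auto
      \<comment> \<open>For m of degree \<nu> and n of degree \<mu>, multiplying this component by
        \<open>p m n\<close> gives the component in degree \<nu>\<mu>\<kappa> of \<beta>(m, na).
        That element has degree \<nu>\<mu>\<tau>\<sigma>, which is different.\<close>
      have "X.X.pr \<kappa> (g a) = \<zero>\<^bsub>X\<^esub>" if \<kappa>: "\<kappa> \<in> carrier G" "\<kappa> \<noteq> \<tau> \<otimes>\<^bsub>G\<^esub> \<sigma>" for \<kappa>
      proof (rule ext)
        fix m n assume "m \<in> carrier M" "n \<in> carrier N"
        then show "p m n \<odot>\<^bsub>X\<^esub> X.X.pr \<kappa> (g a) = p m n \<odot>\<^bsub>X\<^esub> \<zero>\<^bsub>X\<^esub>"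
        proof (induct arbitrary: n rule: M.X.comp_induct)
          case (comp \<nu> m)
          then have m: "m \<in> carrier M" using M.X.comp_carrier by blast
          show ?case using \<open>n \<in> carrier N\<close>
          proof (induct rule: N.X.comp_induct)
            case (comp \<mu> n)
            then have n: "n \<in> carrier N" using N.X.comp_carrier by blast
            have 1: "p m n \<odot>\<^bsub>X\<^esub> X.X.pr \<kappa> (g a) = X.X.pr (\<nu> \<otimes>\<^bsub>G\<^esub> \<mu> \<otimes>\<^bsub>G\<^esub> \<kappa>) (\<beta> m (n \<odot>\<^sub>r\<^bsub>N\<^esub> a))"
              using X.smult_pr[of "\<nu> \<otimes>\<^bsub>G\<^esub> \<mu>" \<kappa> "p m n" "g a"] p_comp[of \<nu> \<mu> m n]
                \<open>\<nu> \<in> carrier G\<close> \<open>m \<in> mcomp M \<nu>\<close> comp m n a \<kappa> g(1)[OF a(1)] g(2)[OF a(1) m n] by simp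
            have "\<beta> m (n \<odot>\<^sub>r\<^bsub>N\<^esub> a) \<in> mcomp X (\<nu> \<otimes>\<^bsub>G\<^esub> (\<mu> \<otimes>\<^bsub>G\<^esub> \<tau>) \<otimes>\<^bsub>G\<^esub> \<sigma>)"
              using \<open>\<nu> \<in> carrier G\<close> \<open>m \<in> mcomp M \<nu>\<close> comp a \<tau> NB.rsmult_comp[of \<mu> \<tau> n a] by (intro assms(8)) auto
            moreover have "\<nu> \<otimes>\<^bsub>G\<^esub> (\<mu> \<otimes>\<^bsub>G\<^esub> \<tau>) \<otimes>\<^bsub>G\<^esub> \<sigma> = \<nu> \<otimes>\<^bsub>G\<^esub> \<mu> \<otimes>\<^bsub>G\<^esub> (\<tau> \<otimes>\<^bsub>G\<^esub> \<sigma>)"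
              using \<open>\<nu> \<in> carrier G\<close> \<open>\<mu> \<in> carrier G\<close> \<tau> \<sigma> by (simp add: R.G.m_assoc)
            ultimately have "X.X.pr (\<nu> \<otimes>\<^bsub>G\<^esub> \<mu> \<otimes>\<^bsub>G\<^esub> \<kappa>) (\<beta> m (n \<odot>\<^sub>r\<^bsub>N\<^esub> a)) = \<zero>\<^bsub>X\<^esub>"
              using \<open>\<nu> \<in> carrier G\<close> \<open>\<mu> \<in> carrier G\<close> \<tau> \<sigma> \<kappa>
              by (intro X.X.pr_other[of _ "\<nu> \<otimes>\<^bsub>G\<^esub> \<mu> \<otimes>\<^bsub>G\<^esub> (\<tau> \<otimes>\<^bsub>G\<^esub> \<sigma>)"]) auto
            then show ?case using 1 m n by (simp add: p_closed)
          qed (use m a g \<kappa> in \<open>auto simp: p_add_r X.smult_l_distr p_closed\<close>)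
        qed (use a g \<kappa> in \<open>auto simp: p_add_l X.smult_l_distr p_closed\<close>)
      qed (use a g \<kappa> in auto)
      then show ?thesis using X.X.comp_iff[of "\<tau> \<otimes>\<^bsub>G\<^esub> \<sigma>" "g a"] \<tau> \<sigma> g a by simp
    qed
  qed
  then obtain x where x: "x \<in> mcomp X \<sigma>" "\<And>a. a \<in> I \<Longrightarrow> g a = a \<odot>\<^bsub>X\<^esub> x" by blast
  \<comment> \<open>The identity \<open>assoc\<close> says that g takes the value
    \<open>\<beta> m n\<close> at \<open>p m n\<close>.\<close>
  have "\<beta> m n = p m n \<odot>\<^bsub>X\<^esub> x" if "m \<in> carrier M" "n \<in> carrier N" for m n
    using that x(2)[OF p_in_trace[OF that]] g_eq[of "\<beta> m n" "p m n"] closed assoc by simp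
  then show ?thesis using x(1) by blast
qed

end

section \<open>Preservation of closed objects and the unit\<close>

context pairing_context
begin

text \<open>Maps out of \<open>J = Im q\<close> into \<open>HOM(M, X)\<close> are handled by applying representability to the
  balanced map \<open>(m', n) \<mapsto> g (q n m) m'\<close> for each fixed \<open>m\<close>.\<close>

lemma hom_object_torsion_closed:
  assumes X: "torsion_closed G R I X" and Y: "hom_object G R S M X Y ap"
  shows "torsion_closed G S (pairing_context.trace_ideal S N M q) Y"
proof -
  interpret swap: pairing_context G S R N M q p
    by (rule pairing_context_swap) unfold_locales
  interpret Y: hom_object G R S M X Y ap by (rule Y)
  have grX: "graded_module G R X" and tfX: "torsion_free I X"
    using X by (auto simp: torsion_closed_def)
  have grY: "graded_module G S Y" by unfold_locales
  note ext = torsion_free_ext[OF grX tfX]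
  have "torsion_free swap.I Y"
    unfolding torsion_free_def
  proof (intro ballI impI)
    fix y assume y: "y \<in> carrier Y" and ann: "\<forall>b\<in>swap.I. b \<odot>\<^bsub>Y\<^esub> y = \<zero>\<^bsub>Y\<^esub>"
    show "y = \<zero>\<^bsub>Y\<^esub>"
    proof (rule Y.ap_ext)
      fix m assume m: "m \<in> carrier M"
      show "ap y m = ap \<zero>\<^bsub>Y\<^esub> m"
      proof (rule ext)
        fix m' n assume m': "m' \<in> carrier M" and n: "n \<in> carrier N"
        \<comment> \<open>Linearity moves \<open>p m' n\<close> into the argument, where it becomes
          right multiplication of m' by \<open>q n m\<close>, which is the action of
          \<open>q n m\<close> on y. So an annihilator of the other trace ideal has values killed by
          this one.\<close>
        have "p m' n \<odot>\<^bsub>X\<^esub> ap y m = ap (q n m \<odot>\<^bsub>Y\<^esub> y) m'"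
          using y m m' n by (simp add: Y.ap_smult q_closed p_closed flip: Y.ap_smult_r p_q)
        then show "p m' n \<odot>\<^bsub>X\<^esub> ap y m = p m' n \<odot>\<^bsub>X\<^esub> ap \<zero>\<^bsub>Y\<^esub> m"
          using ann swap.p_in_trace[OF n m] m m' n by (simp add: p_closed)
      qed (use y m Y.ap_closed in auto)
    qed (use y in auto)
  qed
  moreover have "ideal_maps_extend G S swap.I Y"
    unfolding ideal_maps_extend_def
  proof (intro ballI allI impI)
    fix \<sigma> g
    assume \<sigma>: "\<sigma> \<in> carrier G" and "\<forall>b\<in>swap.I. g b \<in> carrier Y"
      and "\<forall>a\<in>swap.I. \<forall>b\<in>swap.I. g (a \<oplus>\<^bsub>S\<^esub> b) = g a \<oplus>\<^bsub>Y\<^esub> g b"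
      and "\<forall>r\<in>carrier S. \<forall>a\<in>swap.I. g (r \<otimes>\<^bsub>S\<^esub> a) = r \<odot>\<^bsub>Y\<^esub> g a"
      and "\<forall>\<tau>\<in>carrier G. \<forall>a\<in>swap.I \<inter> rcomp S \<tau>. g a \<in> mcomp Y (\<tau> \<otimes>\<^bsub>G\<^esub> \<sigma>)"
    then have g: "\<And>b. b \<in> swap.I \<Longrightarrow> g b \<in> carrier Y"
      "\<And>a b. a \<in> swap.I \<Longrightarrow> b \<in> swap.I \<Longrightarrow> g (a \<oplus>\<^bsub>S\<^esub> b) = g a \<oplus>\<^bsub>Y\<^esub> g b"
      "\<And>r a. r \<in> carrier S \<Longrightarrow> a \<in> swap.I \<Longrightarrow> g (r \<otimes>\<^bsub>S\<^esub> a) = r \<odot>\<^bsub>Y\<^esub> g a"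
      "\<And>\<tau> a. \<tau> \<in> carrier G \<Longrightarrow> a \<in> swap.I \<Longrightarrow> a \<in> rcomp S \<tau> \<Longrightarrow> g a \<in> mcomp Y (\<tau> \<otimes>\<^bsub>G\<^esub> \<sigma>)"
      by auto
    note qI = swap.p_in_trace
    have gq: "g (q n m) \<in> carrier Y" if "n \<in> carrier N" "m \<in> carrier M" for n m
      using that g(1) qI by blast
    have g0: "g \<zero>\<^bsub>S\<^esub> = \<zero>\<^bsub>Y\<^esub>"
      using g(3)[of "\<zero>\<^bsub>S\<^esub>" "\<zero>\<^bsub>S\<^esub>"] g(1)[of "\<zero>\<^bsub>S\<^esub>"] swap.trace_zero by simp
    \<comment> \<open>The auxiliary map (m', n) to g(q(n, m))(m') is homogeneous only for
      homogeneous m, of degree \<nu> say. Its degree is then \<nu>\<sigma>, exactly what a map of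
      degree \<sigma> assigns to m.\<close>
    have homogeneous: "\<exists>x\<in>mcomp X (\<nu> \<otimes>\<^bsub>G\<^esub> \<sigma>). \<forall>m'\<in>carrier M. \<forall>n\<in>carrier N. ap (g (q n m)) m' = p m' n \<odot>\<^bsub>X\<^esub> x"
      if \<nu>: "\<nu> \<in> carrier G" and m: "m \<in> mcomp M \<nu>" for \<nu> m
    proof (rule balanced_map_representable[OF X])
      have mc: "m \<in> carrier M" using \<nu> m by (rule M.X.comp_carrier)
      show "ap (g (q n m)) m' \<in> carrier X" if "m' \<in> carrier M" "n \<in> carrier N" for m' n
        using that mc by (intro Y.ap_closed gq)
      show "ap (g (q n m)) (m1 \<oplus>\<^bsub>M\<^esub> m2) = ap (g (q n m)) m1 \<oplus>\<^bsub>X\<^esub> ap (g (q n m)) m2"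
        if "m1 \<in> carrier M" "m2 \<in> carrier M" "n \<in> carrier N" for m1 m2 n
        using that mc by (intro Y.ap_add_r gq)
      show "ap (g (q (n \<oplus>\<^bsub>N\<^esub> n') m)) m' = ap (g (q n m)) m' \<oplus>\<^bsub>X\<^esub> ap (g (q n' m)) m'"
        if "m' \<in> carrier M" "n \<in> carrier N" "n' \<in> carrier N" for m' n n'
        using that mc by (simp add: q_add_l g(2) qI gq Y.ap_add)
      show "ap (g (q n m)) (a \<odot>\<^bsub>M\<^esub> m') = a \<odot>\<^bsub>X\<^esub> ap (g (q n m)) m'"
        if "m' \<in> carrier M" "n \<in> carrier N" "a \<in> carrier R" for m' n a
        using that mc by (intro Y.ap_smult_r gq)
      show "ap (g (q n m)) (m' \<odot>\<^sub>r\<^bsub>M\<^esub> s) = ap (g (q (s \<odot>\<^bsub>N\<^esub> n) m)) m'"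
        if "m' \<in> carrier M" "n \<in> carrier N" "s \<in> carrier S" for m' n s
        using that mc by (simp add: q_smult g(3) qI gq Y.ap_smult)
      show "ap (g (q n m)) m' \<in> mcomp X (\<nu>' \<otimes>\<^bsub>G\<^esub> \<mu> \<otimes>\<^bsub>G\<^esub> (\<nu> \<otimes>\<^bsub>G\<^esub> \<sigma>))"
        if "\<nu>' \<in> carrier G" "\<mu> \<in> carrier G" "m' \<in> mcomp M \<nu>'" "n \<in> mcomp N \<mu>" for \<nu>' \<mu> m' n
      proof -
        have "g (q n m) \<in> mcomp Y (\<mu> \<otimes>\<^bsub>G\<^esub> \<nu> \<otimes>\<^bsub>G\<^esub> \<sigma>)"
          using that \<nu> m mc N.X.comp_carrier by (intro g(4) q_comp qI) auto
        then have "ap (g (q n m)) m' \<in> mcomp X (\<nu>' \<otimes>\<^bsub>G\<^esub> (\<mu> \<otimes>\<^bsub>G\<^esub> \<nu> \<otimes>\<^bsub>G\<^esub> \<sigma>))"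
          using that \<nu> \<sigma> by (intro Y.ap_comp) auto
        then show ?thesis using that \<nu> \<sigma> by (simp add: R.G.m_assoc)
      qed
    qed (use \<nu> \<sigma> in auto)
    have ex: "\<exists>x\<in>carrier X. \<forall>m'\<in>carrier M. \<forall>n\<in>carrier N. ap (g (q n m)) m' = p m' n \<odot>\<^bsub>X\<^esub> x"
      if "m \<in> carrier M" for m
      using that
    proof (induct rule: M.X.comp_induct)
      case zero
      show ?case by (intro bexI[of _ "\<zero>\<^bsub>X\<^esub>"]) (auto simp: g0 p_closed)
    next
      case (comp \<nu> m)
      then show ?case using homogeneous[OF comp] \<sigma> Y.X.X.comp_carrier[of "\<nu> \<otimes>\<^bsub>G\<^esub> \<sigma>"] by blast
    next
      case (add m1 m2)
      then obtain x1 x2 where "x1 \<in> carrier X" "x2 \<in> carrier X"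
        "\<forall>m'\<in>carrier M. \<forall>n\<in>carrier N. ap (g (q n m1)) m' = p m' n \<odot>\<^bsub>X\<^esub> x1"
        "\<forall>m'\<in>carrier M. \<forall>n\<in>carrier N. ap (g (q n m2)) m' = p m' n \<odot>\<^bsub>X\<^esub> x2" by blast
      then show ?case
        using add(1,2)
        by (intro bexI[of _ "x1 \<oplus>\<^bsub>X\<^esub> x2"])
          (auto simp: q_add_r g(2) qI gq Y.ap_add Y.X.smult_r_distr p_closed)
    qed
    \<comment> \<open>The representing elements are the values of the sought element of Y. They are
      unique by \<open>torsion_free_ext\<close>, and so they depend linearly on m.\<close>
    define f where "f m = (SOME x. x \<in> carrier X \<and>
      (\<forall>m'\<in>carrier M. \<forall>n\<in>carrier N. ap (g (q n m)) m' = p m' n \<odot>\<^bsub>X\<^esub> x))" for m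
    have f: "f m \<in> carrier X"
      "\<And>m' n. m' \<in> carrier M \<Longrightarrow> n \<in> carrier N \<Longrightarrow> ap (g (q n m)) m' = p m' n \<odot>\<^bsub>X\<^esub> f m"
      if m: "m \<in> carrier M" for m
    proof -
      have "\<exists>x. x \<in> carrier X \<and> (\<forall>m'\<in>carrier M. \<forall>n\<in>carrier N. ap (g (q n m)) m' = p m' n \<odot>\<^bsub>X\<^esub> x)"
        using ex[OF m] by blast
      from someI_ex[OF this]
      show "f m \<in> carrier X"
        "\<And>m' n. m' \<in> carrier M \<Longrightarrow> n \<in> carrier N \<Longrightarrow> ap (g (q n m)) m' = p m' n \<odot>\<^bsub>X\<^esub> f m"
        unfolding f_def by blast+
    qed
    have f_eq: "f m = x" if "m \<in> carrier M" "x \<in> carrier X"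
      "\<And>m' n. m' \<in> carrier M \<Longrightarrow> n \<in> carrier N \<Longrightarrow> ap (g (q n m)) m' = p m' n \<odot>\<^bsub>X\<^esub> x" for m x
      by (rule ext) (use that f in auto)
    have f_smult: "f (a \<odot>\<^bsub>M\<^esub> m) = a \<odot>\<^bsub>X\<^esub> f m" if a: "a \<in> carrier R" and m: "m \<in> carrier M" for a m
    proof (rule f_eq)
      fix m' n assume mn: "m' \<in> carrier M" "n \<in> carrier N"
      have "ap (g (q n (a \<odot>\<^bsub>M\<^esub> m))) m' = p m' (n \<odot>\<^sub>r\<^bsub>N\<^esub> a) \<odot>\<^bsub>X\<^esub> f m"
        using a m mn by (simp add: NB.rsmult_closed f flip: q_balanced)
      then show "ap (g (q n (a \<odot>\<^bsub>M\<^esub> m))) m' = p m' n \<odot>\<^bsub>X\<^esub> (a \<odot>\<^bsub>X\<^esub> f m)"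
        using a m mn by (simp add: p_rsmult Y.X.smult_assoc p_closed f)
    qed (use a m f Y.X.smult_closed M.smult_closed in auto)
    have "\<exists>y\<in>mcomp Y \<sigma>. \<forall>m\<in>carrier M. ap y m = f m"
    proof (rule Y.ap_ex[OF \<sigma>])
      show "f (m1 \<oplus>\<^bsub>M\<^esub> m2) = f m1 \<oplus>\<^bsub>X\<^esub> f m2" if "m1 \<in> carrier M" "m2 \<in> carrier M" for m1 m2
        by (rule f_eq)
          (use that f in \<open>auto simp: q_add_r g(2) qI gq Y.ap_add Y.X.smult_r_distr p_closed\<close>)
      show "f m \<in> mcomp X (\<nu> \<otimes>\<^bsub>G\<^esub> \<sigma>)" if \<nu>: "\<nu> \<in> carrier G" and m: "m \<in> mcomp M \<nu>" for \<nu> m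
      proof -
        obtain x where x: "x \<in> mcomp X (\<nu> \<otimes>\<^bsub>G\<^esub> \<sigma>)"
          "\<And>m' n. m' \<in> carrier M \<Longrightarrow> n \<in> carrier N \<Longrightarrow> ap (g (q n m)) m' = p m' n \<odot>\<^bsub>X\<^esub> x"
          using homogeneous[OF \<nu> m] by blast
        have "f m = x"
          by (rule f_eq) (use x \<nu> m \<sigma> M.X.comp_carrier Y.X.X.comp_carrier[of "\<nu> \<otimes>\<^bsub>G\<^esub> \<sigma>"] in auto)
        then show ?thesis using x by simp
      qed
    qed (use f f_smult in auto)
    then obtain y where y: "y \<in> mcomp Y \<sigma>" "\<And>m. m \<in> carrier M \<Longrightarrow> ap y m = f m" by blast
    have yc: "y \<in> carrier Y" using \<sigma> y(1) by (rule Y.Y.X.comp_carrier)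
    \<comment> \<open>Evaluated at m', the right side is f(m' q(n, m)) = f(p(m', n) m) = p(m', n)
      f(m), and this is the left side by the choice of f.\<close>
    have gen: "g (q n m) = q n m \<odot>\<^bsub>Y\<^esub> y" if "n \<in> carrier N" "m \<in> carrier M" for n m
    proof (rule Y.ap_ext)
      fix m' assume m': "m' \<in> carrier M"
      have "ap (q n m \<odot>\<^bsub>Y\<^esub> y) m' = f (p m' n \<odot>\<^bsub>M\<^esub> m)"
        using that m' yc y(2) by (simp add: Y.ap_smult q_closed p_q MB.rsmult_closed)
      then show "ap (g (q n m)) m' = ap (q n m \<odot>\<^bsub>Y\<^esub> y) m'"
        using that m' by (simp add: f_smult p_closed f)
    qed (use that gq yc q_closed Y.Y.smult_closed in auto)
    have "g b = b \<odot>\<^bsub>Y\<^esub> y" if "b \<in> swap.I" for b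
      using that
      by (induct rule: swap.trace_induct)
        (use yc in \<open>auto simp: g0 g(2) qI gen Y.Y.smult_l_distr q_closed swap.trace_carrier\<close>)
    then show "\<exists>y\<in>mcomp Y \<sigma>. \<forall>b\<in>swap.I. g b = b \<odot>\<^bsub>Y\<^esub> y" using y(1) by blast
  qed
  ultimately show ?thesis using grY by (simp add: torsion_closed_def)
qed

text \<open>The value is specified by its double evaluation, not written as a term, because Y and Z
  are arbitrary models of HOM and need not consist of functions.\<close>

definition unit_map ::
    "('g, 'r, 'x) gmodule \<Rightarrow> ('y \<Rightarrow> 'm \<Rightarrow> 'x) \<Rightarrow> ('g, 'r, 'z) gmodule \<Rightarrow> ('z \<Rightarrow> 'n \<Rightarrow> 'y) \<Rightarrow> 'x \<Rightarrow> 'z" where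
  "unit_map X ap Z ap' = (\<lambda>x\<in>carrier X. SOME z. z \<in> carrier Z \<and>
     (\<forall>n\<in>carrier N. \<forall>m\<in>carrier M. ap (ap' z n) m = p m n \<odot>\<^bsub>X\<^esub> x))"

text \<open>Existence of the values applies \<open>ap_ex\<close> twice, once for each HOM, with
  homogeneous data. Injectivity is torsion-freeness of X. Surjectivity is representability of the
  balanced map obtained by evaluating a homogeneous element of Z twice.\<close>

lemma unit_map:
  assumes X: "torsion_closed G R I X" and Y: "hom_object G R S M X Y ap" and Z: "hom_object G S R N Y Z ap'"
  shows unit_map_hom: "unit_map X ap Z ap' \<in> graded_hom G R X Z"
    and unit_map_inj: "inj_on (unit_map X ap Z ap') (carrier X)"
    and unit_map_surj: "unit_map X ap Z ap' ` carrier X = carrier Z"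
    and unit_map_ap: "\<lbrakk>x \<in> carrier X; n \<in> carrier N; m \<in> carrier M\<rbrakk> \<Longrightarrow>
      ap (ap' (unit_map X ap Z ap' x) n) m = p m n \<odot>\<^bsub>X\<^esub> x"
    and unit_map_ext: "\<lbrakk>z \<in> carrier Z; z' \<in> carrier Z;
      \<And>n m. n \<in> carrier N \<Longrightarrow> m \<in> carrier M \<Longrightarrow> ap (ap' z n) m = ap (ap' z' n) m\<rbrakk> \<Longrightarrow> z = z'"
proof -
  have grX: "graded_module G R X" and tfX: "torsion_free I X"
    using X by (auto simp: torsion_closed_def)
  interpret X: grmod G R X by (rule grmodI) fact
  interpret Y: hom_object G R S M X Y ap by (rule Y)
  interpret Z: hom_object G S R N Y Z ap' by (rule Z)
  note ext = torsion_free_ext[OF grX tfX]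
  let ?e = "unit_map X ap Z ap'"
  show zext: "z = z'" if "z \<in> carrier Z" "z' \<in> carrier Z"
    "\<And>n m. n \<in> carrier N \<Longrightarrow> m \<in> carrier M \<Longrightarrow> ap (ap' z n) m = ap (ap' z' n) m" for z z'
    using that by (intro Z.ap_ext Y.ap_ext Z.ap_closed)
  have ex_hom: "\<exists>z\<in>mcomp Z \<sigma>. \<forall>n\<in>carrier N. \<forall>m\<in>carrier M. ap (ap' z n) m = p m n \<odot>\<^bsub>X\<^esub> x"
    if \<sigma>: "\<sigma> \<in> carrier G" and x: "x \<in> mcomp X \<sigma>" for \<sigma> x
  proof -
    have xc: "x \<in> carrier X" using \<sigma> x by (rule X.X.comp_carrier)
    \<comment> \<open>For n of degree \<mu> the map sending m to p(m, n)x has degree \<mu>\<sigma>,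
      so it is represented in that component of Y. Inhomogeneous n are reached by sums
      afterwards.\<close>
    have hom: "\<exists>y\<in>mcomp Y (\<mu> \<otimes>\<^bsub>G\<^esub> \<sigma>). \<forall>m\<in>carrier M. ap y m = p m n \<odot>\<^bsub>X\<^esub> x"
      if \<mu>: "\<mu> \<in> carrier G" and n: "n \<in> mcomp N \<mu>" for \<mu> n
    proof (rule Y.ap_ex)
      have nc: "n \<in> carrier N" using \<mu> n by (rule N.X.comp_carrier)
      show "p m n \<odot>\<^bsub>X\<^esub> x \<in> carrier X" if "m \<in> carrier M" for m
        using that nc xc by (intro X.smult_closed p_closed)
      show "p (m \<oplus>\<^bsub>M\<^esub> m') n \<odot>\<^bsub>X\<^esub> x = p m n \<odot>\<^bsub>X\<^esub> x \<oplus>\<^bsub>X\<^esub> p m' n \<odot>\<^bsub>X\<^esub> x"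
        if "m \<in> carrier M" "m' \<in> carrier M" for m m'
        using that nc xc by (simp add: p_add_l X.smult_l_distr p_closed)
      show "p (a \<odot>\<^bsub>M\<^esub> m) n \<odot>\<^bsub>X\<^esub> x = a \<odot>\<^bsub>X\<^esub> (p m n \<odot>\<^bsub>X\<^esub> x)"
        if "a \<in> carrier R" "m \<in> carrier M" for a m
        using that nc xc by (simp add: p_smult X.smult_assoc p_closed)
      show "p m n \<odot>\<^bsub>X\<^esub> x \<in> mcomp X (\<nu> \<otimes>\<^bsub>G\<^esub> (\<mu> \<otimes>\<^bsub>G\<^esub> \<sigma>))" if "\<nu> \<in> carrier G" "m \<in> mcomp M \<nu>" for \<nu> m
        using that \<mu> n \<sigma> x X.smult_comp[OF _ \<sigma> p_comp[OF that(1) \<mu> that(2) n] x] by (simp add: R.G.m_assoc)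
    qed (use \<mu> \<sigma> in auto)
    have "\<exists>y\<in>carrier Y. \<forall>m\<in>carrier M. ap y m = p m n \<odot>\<^bsub>X\<^esub> x" if "n \<in> carrier N" for n
      using that
    proof (induct rule: N.X.comp_induct)
      case zero
      then show ?case using xc by (intro bexI[of _ "\<zero>\<^bsub>Y\<^esub>"]) auto
    next
      case (comp \<mu> n)
      then show ?case using hom[OF comp] \<sigma> Y.Y.X.comp_carrier[of "\<mu> \<otimes>\<^bsub>G\<^esub> \<sigma>"] by blast
    next
      case (add n n')
      then obtain y y' where "y \<in> carrier Y" "y' \<in> carrier Y"
        "\<forall>m\<in>carrier M. ap y m = p m n \<odot>\<^bsub>X\<^esub> x" "\<forall>m\<in>carrier M. ap y' m = p m n' \<odot>\<^bsub>X\<^esub> x" by blast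
      then show ?case
        using add(1,2) xc
        by (intro bexI[of _ "y \<oplus>\<^bsub>Y\<^esub> y'"]) (auto simp: Y.ap_add p_add_r X.smult_l_distr p_closed)
    qed
    then have "\<forall>n. \<exists>y. n \<in> carrier N \<longrightarrow> y \<in> carrier Y \<and> (\<forall>m\<in>carrier M. ap y m = p m n \<odot>\<^bsub>X\<^esub> x)"
      by blast
    then obtain f where f: "\<And>n. n \<in> carrier N \<Longrightarrow> f n \<in> carrier Y"
      "\<And>n m. n \<in> carrier N \<Longrightarrow> m \<in> carrier M \<Longrightarrow> ap (f n) m = p m n \<odot>\<^bsub>X\<^esub> x" by metis
    have "\<exists>z\<in>mcomp Z \<sigma>. \<forall>n\<in>carrier N. ap' z n = f n"
    proof (rule Z.ap_ex[OF \<sigma>])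
      show "f (n \<oplus>\<^bsub>N\<^esub> n') = f n \<oplus>\<^bsub>Y\<^esub> f n'" if "n \<in> carrier N" "n' \<in> carrier N" for n n'
        by (rule Y.ap_ext) (use that xc f in \<open>auto simp: Y.ap_add p_add_r X.smult_l_distr p_closed\<close>)
      show "f (s \<odot>\<^bsub>N\<^esub> n) = s \<odot>\<^bsub>Y\<^esub> f n" if "s \<in> carrier S" "n \<in> carrier N" for s n
        by (rule Y.ap_ext)
          (use that xc f in \<open>auto simp: Y.ap_smult p_balanced MB.rsmult_closed N.smult_closed Y.Y.smult_closed\<close>)
      show "f n \<in> mcomp Y (\<mu> \<otimes>\<^bsub>G\<^esub> \<sigma>)" if \<mu>: "\<mu> \<in> carrier G" and n: "n \<in> mcomp N \<mu>" for \<mu> n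
      proof -
        obtain y where y: "y \<in> mcomp Y (\<mu> \<otimes>\<^bsub>G\<^esub> \<sigma>)" "\<And>m. m \<in> carrier M \<Longrightarrow> ap y m = p m n \<odot>\<^bsub>X\<^esub> x"
          using hom[OF \<mu> n] by blast
        have "f n = y"
          by (rule Y.ap_ext)
            (use y f N.X.comp_carrier[OF \<mu> n] \<mu> \<sigma> Y.Y.X.comp_carrier[of "\<mu> \<otimes>\<^bsub>G\<^esub> \<sigma>"] in auto)
        then show ?thesis using y by simp
      qed
    qed (use f in auto)
    then obtain z where "z \<in> mcomp Z \<sigma>" "\<And>n. n \<in> carrier N \<Longrightarrow> ap' z n = f n" by blast
    then show ?thesis using f(2) by (intro bexI[of _ z]) auto
  qed
  have ex: "\<exists>z\<in>carrier Z. \<forall>n\<in>carrier N. \<forall>m\<in>carrier M. ap (ap' z n) m = p m n \<odot>\<^bsub>X\<^esub> x"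
    if "x \<in> carrier X" for x
    using that
  proof (induct rule: X.X.comp_induct)
    case zero
    then show ?case by (intro bexI[of _ "\<zero>\<^bsub>Z\<^esub>"]) (auto simp: p_closed)
  next
    case (comp \<sigma> x)
    then show ?case using ex_hom[OF comp] Z.Y.X.comp_carrier[of \<sigma>] by blast
  next
    case (add x x')
    then obtain z z' where "z \<in> carrier Z" "z' \<in> carrier Z"
      "\<forall>n\<in>carrier N. \<forall>m\<in>carrier M. ap (ap' z n) m = p m n \<odot>\<^bsub>X\<^esub> x"
      "\<forall>n\<in>carrier N. \<forall>m\<in>carrier M. ap (ap' z' n) m = p m n \<odot>\<^bsub>X\<^esub> x'" by blast
    then show ?case
      using add(1,2)
      by (intro bexI[of _ "z \<oplus>\<^bsub>Z\<^esub> z'"])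
        (auto simp: Z.ap_add Z.ap_closed Y.ap_add X.smult_r_distr p_closed)
  qed
  have e: "?e x \<in> carrier Z"
    "\<And>n m. n \<in> carrier N \<Longrightarrow> m \<in> carrier M \<Longrightarrow> ap (ap' (?e x) n) m = p m n \<odot>\<^bsub>X\<^esub> x"
    if x: "x \<in> carrier X" for x
  proof -
    have "\<exists>z. z \<in> carrier Z \<and> (\<forall>n\<in>carrier N. \<forall>m\<in>carrier M. ap (ap' z n) m = p m n \<odot>\<^bsub>X\<^esub> x)"
      using ex[OF x] by blast
    from someI_ex[OF this] x
    show "?e x \<in> carrier Z"
      "\<And>n m. n \<in> carrier N \<Longrightarrow> m \<in> carrier M \<Longrightarrow> ap (ap' (?e x) n) m = p m n \<odot>\<^bsub>X\<^esub> x"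
      unfolding unit_map_def by simp_all
  qed
  have e_eq: "?e x = z" if "x \<in> carrier X" "z \<in> carrier Z"
    "\<And>n m. n \<in> carrier N \<Longrightarrow> m \<in> carrier M \<Longrightarrow> ap (ap' z n) m = p m n \<odot>\<^bsub>X\<^esub> x" for x z
    by (rule zext) (use that e in auto)
  show "ap (ap' (?e x) n) m = p m n \<odot>\<^bsub>X\<^esub> x" if "x \<in> carrier X" "n \<in> carrier N" "m \<in> carrier M" for x n m
    using e that by blast
  show "?e \<in> graded_hom G R X Z"
  proof (rule graded_homI)
    show "?e (x \<oplus>\<^bsub>X\<^esub> x') = ?e x \<oplus>\<^bsub>Z\<^esub> ?e x'" if "x \<in> carrier X" "x' \<in> carrier X" for x x'
      by (rule e_eq)
        (use that e in \<open>auto simp: Z.ap_add Z.ap_closed Y.ap_add X.smult_r_distr p_closed\<close>)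
    show "?e (a \<odot>\<^bsub>X\<^esub> x) = a \<odot>\<^bsub>Z\<^esub> ?e x" if a: "a \<in> carrier R" and x: "x \<in> carrier X" for a x
    proof (rule e_eq)
      fix n m assume nm: "n \<in> carrier N" "m \<in> carrier M"
      have "ap (ap' (a \<odot>\<^bsub>Z\<^esub> ?e x) n) m = p m (n \<odot>\<^sub>r\<^bsub>N\<^esub> a) \<odot>\<^bsub>X\<^esub> x"
        using nm a x by (simp add: Z.ap_smult e NB.rsmult_closed)
      then show "ap (ap' (a \<odot>\<^bsub>Z\<^esub> ?e x) n) m = p m n \<odot>\<^bsub>X\<^esub> (a \<odot>\<^bsub>X\<^esub> x)"
        using nm a x by (simp add: p_rsmult X.smult_assoc p_closed)
    qed (use a x e X.smult_closed Z.Y.smult_closed in auto)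
    show "?e x \<in> mcomp Z \<sigma>" if \<sigma>: "\<sigma> \<in> carrier G" and x: "x \<in> mcomp X \<sigma>" for \<sigma> x
    proof -
      obtain z where z: "z \<in> mcomp Z \<sigma>"
        "\<And>n m. n \<in> carrier N \<Longrightarrow> m \<in> carrier M \<Longrightarrow> ap (ap' z n) m = p m n \<odot>\<^bsub>X\<^esub> x"
        using ex_hom[OF \<sigma> x] by blast
      have "?e x = z"
        by (rule e_eq) (use z X.X.comp_carrier[OF \<sigma> x] Z.Y.X.comp_carrier[OF \<sigma>] in auto)
      then show ?thesis using z by simp
    qed
  qed (use e in \<open>auto simp: unit_map_def\<close>)
  show "inj_on ?e (carrier X)"
  proof (rule inj_onI)
    fix x x' assume xx: "x \<in> carrier X" "x' \<in> carrier X" "?e x = ?e x'"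
    show "x = x'"
    proof (rule ext)
      fix m n assume "m \<in> carrier M" "n \<in> carrier N"
      then show "p m n \<odot>\<^bsub>X\<^esub> x = p m n \<odot>\<^bsub>X\<^esub> x'"
        using e(2)[OF xx(1), of n m] e(2)[OF xx(2), of n m] xx(3) by simp
    qed (use xx in auto)
  qed
  have "\<exists>x\<in>carrier X. \<forall>m\<in>carrier M. \<forall>n\<in>carrier N. ap (ap' z n) m = p m n \<odot>\<^bsub>X\<^esub> x" if "z \<in> carrier Z" for z
    using that
  proof (induct rule: Z.Y.X.comp_induct)
    case zero
    then show ?case by (intro bexI[of _ "\<zero>\<^bsub>X\<^esub>"]) (auto simp: p_closed)
  next
    case (comp \<sigma> z)
    have zc: "z \<in> carrier Z" using comp by (rule Z.Y.X.comp_carrier)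
    \<comment> \<open>Linearity in m comes from Y, additivity in n from Z. Balancedness holds
      because the S-action on Y is right multiplication on the argument in M and \<open>ap'\<close>
      is S-linear in n.\<close>
    have "\<exists>x\<in>mcomp X \<sigma>. \<forall>m\<in>carrier M. \<forall>n\<in>carrier N. ap (ap' z n) m = p m n \<odot>\<^bsub>X\<^esub> x"
    proof (rule balanced_map_representable[OF X comp(1)])
      show "ap (ap' z n) m \<in> mcomp X (\<nu> \<otimes>\<^bsub>G\<^esub> \<mu> \<otimes>\<^bsub>G\<^esub> \<sigma>)"
        if "\<nu> \<in> carrier G" "\<mu> \<in> carrier G" "m \<in> mcomp M \<nu>" "n \<in> mcomp N \<mu>" for \<nu> \<mu> m n
      proof -
        have "ap (ap' z n) m \<in> mcomp X (\<nu> \<otimes>\<^bsub>G\<^esub> (\<mu> \<otimes>\<^bsub>G\<^esub> \<sigma>))"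
          using that comp by (intro Y.ap_comp Z.ap_comp) auto
        then show ?thesis using that comp by (simp add: R.G.m_assoc)
      qed
    qed (use zc in \<open>auto simp: Y.ap_closed Z.ap_closed Y.ap_add_r Y.ap_smult_r Z.ap_add_r Y.ap_add
        Z.ap_smult_r Y.ap_smult\<close>)
    then show ?case using X.X.comp_carrier[OF comp(1)] by blast
  next
    case (add z z')
    then obtain x x' where "x \<in> carrier X" "x' \<in> carrier X"
      "\<forall>m\<in>carrier M. \<forall>n\<in>carrier N. ap (ap' z n) m = p m n \<odot>\<^bsub>X\<^esub> x"
      "\<forall>m\<in>carrier M. \<forall>n\<in>carrier N. ap (ap' z' n) m = p m n \<odot>\<^bsub>X\<^esub> x'" by blast
    then show ?case
      using add(1,2)
      by (intro bexI[of _ "x \<oplus>\<^bsub>X\<^esub> x'"])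
        (auto simp: Z.ap_add Z.ap_closed Y.ap_add X.smult_r_distr p_closed)
  qed
  then have "z \<in> ?e ` carrier X" if "z \<in> carrier Z" for z
    using e_eq that by (metis imageI)
  then show "?e ` carrier X = carrier Z" using e(1) by blast
qed

end

section \<open>The pairing induced by a map out of the tensor product\<close>

lemma tensor_simps:
  "carrier (tensor G S M N) = carrier (tensor_free M N Mod tensor_rel S M N)"
  "add (tensor G S M N) = mult (tensor_free M N Mod tensor_rel S M N)"
  "smult (tensor G S M N) = (\<lambda>a t. \<Union>c\<in>t. tensor_rel S M N #>\<^bsub>tensor_free M N\<^esub>
     frag_extend (\<lambda>(m, n). frag_of (a \<odot>\<^bsub>M\<^esub> m, n)) c)"
  "mcomp (tensor G S M N) = (\<lambda>\<sigma>. generate (tensor_free M N Mod tensor_rel S M N)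
     {pure_tensor S M N m n | m n. \<exists>\<nu>\<in>carrier G. \<exists>\<mu>\<in>carrier G.
        \<nu> \<otimes>\<^bsub>G\<^esub> \<mu> = \<sigma> \<and> m \<in> mcomp M \<nu> \<and> n \<in> mcomp N \<mu>})"
  "rsmult (tensor G S M N) = (\<lambda>t b. \<Union>c\<in>t. tensor_rel S M N #>\<^bsub>tensor_free M N\<^esub>
     frag_extend (\<lambda>(m, n). frag_of (m, n \<odot>\<^sub>r\<^bsub>N\<^esub> b)) c)"
  by (simp_all add: tensor_def Let_def)

lemma regular_bimodule_simps [simp]:
  "carrier (regular_bimodule R) = carrier R" "add (regular_bimodule R) = add R"
  "smult (regular_bimodule R) = mult R" "mcomp (regular_bimodule R) = rcomp R"
  "rsmult (regular_bimodule R) = mult R"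
  by (simp_all add: regular_bimodule_def)

locale tensor_context = MB: bimod G R S M + NB: bimod G S R N
  for G :: "'g monoid" and R :: "('g, 'r) gring" and S :: "('g, 's) gring"
    and M :: "('g, 'r, 's, 'm) gbimodule" and N :: "('g, 's, 'r, 'n) gbimodule" +
  fixes \<phi> :: "('m \<times> 'n \<Rightarrow>\<^sub>0 int) set \<Rightarrow> 'r"
  assumes phi_hom: "\<phi> \<in> graded_bimodule_hom G R R (tensor G S M N) (regular_bimodule R)"
begin

abbreviation "F \<equiv> tensor_free M N"
abbreviation "K \<equiv> tensor_rel S M N"
abbreviation "T \<equiv> tensor G S M N"

definition tensor_gens :: "('m \<times> 'n \<Rightarrow>\<^sub>0 int) set" where
  "tensor_gens = {frag_of (m \<oplus>\<^bsub>M\<^esub> m', n) - frag_of (m, n) - frag_of (m', n) | m m' n.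
         m \<in> carrier M \<and> m' \<in> carrier M \<and> n \<in> carrier N} \<union>
      {frag_of (m, n \<oplus>\<^bsub>N\<^esub> n') - frag_of (m, n) - frag_of (m, n') | m n n'.
         m \<in> carrier M \<and> n \<in> carrier N \<and> n' \<in> carrier N} \<union>
      {frag_of (m \<odot>\<^sub>r\<^bsub>M\<^esub> s, n) - frag_of (m, s \<odot>\<^bsub>N\<^esub> n) | m s n.
         m \<in> carrier M \<and> s \<in> carrier S \<and> n \<in> carrier N}"

lemma tensor_gens_cases:
  assumes "c \<in> tensor_gens"
  obtains m m' n where "m \<in> carrier M" "m' \<in> carrier M" "n \<in> carrier N"
      "c = frag_of (m \<oplus>\<^bsub>M\<^esub> m', n) - frag_of (m, n) - frag_of (m', n)"
    | m n n' where "m \<in> carrier M" "n \<in> carrier N" "n' \<in> carrier N"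
      "c = frag_of (m, n \<oplus>\<^bsub>N\<^esub> n') - frag_of (m, n) - frag_of (m, n')"
    | m s n where "m \<in> carrier M" "s \<in> carrier S" "n \<in> carrier N"
      "c = frag_of (m \<odot>\<^sub>r\<^bsub>M\<^esub> s, n) - frag_of (m, s \<odot>\<^bsub>N\<^esub> n)"
  using assms unfolding tensor_gens_def Un_iff mem_Collect_eq
  by (elim disjE exE conjE) (rule that; assumption)+

lemma tensor_rel_eq: "K = generate F tensor_gens"
  by (simp add: tensor_rel_def tensor_gens_def)

sublocale F: comm_group F
  by (rule abelian_free_Abelian_group)

lemma gens_carrier: "tensor_gens \<subseteq> carrier F"
proof -
  have diff: "x - y \<in> carrier F" if "x \<in> carrier F" "y \<in> carrier F" for x y
    using that keys_diff[of x y] by auto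
  have "frag_of (m, n) \<in> carrier F" if "m \<in> carrier M" "n \<in> carrier N" for m n
    using that by (simp only: frag_of_in_free_Abelian_group) simp
  then show ?thesis
    unfolding tensor_gens_def
    by (auto simp del: carrier_free_Abelian_group_iff
        intro!: diff MB.rsmult_closed NB.M.smult_closed)
qed

lemma normal: "K \<lhd> F"
  unfolding tensor_rel_eq by (rule F.subgroup_imp_normal[OF F.generate_is_subgroup[OF gens_carrier]])

lemma K_subgroup: "subgroup K F"
  unfolding tensor_rel_eq by (rule F.generate_is_subgroup[OF gens_carrier])

lemma K_carrier: "K \<subseteq> carrier F"
  using subgroup.subset[OF K_subgroup] .

lemma coset_closed: "c \<in> carrier F \<Longrightarrow> K #>\<^bsub>F\<^esub> c \<in> carrier T"
  using F.rcosetsI[OF K_carrier] by (simp add: tensor_simps FactGroup_def)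

lemma coset_add: "\<lbrakk>c \<in> carrier F; d \<in> carrier F\<rbrakk> \<Longrightarrow> (K #>\<^bsub>F\<^esub> c) \<oplus>\<^bsub>T\<^esub> (K #>\<^bsub>F\<^esub> d) = K #>\<^bsub>F\<^esub> (c + d)"
  using normal.rcos_sum[OF normal, of c d] by (simp add: tensor_simps FactGroup_def)

lemma coset_eqI:
  assumes "c \<in> carrier F" "d \<in> carrier F" "c - d \<in> K"
  shows "K #>\<^bsub>F\<^esub> c = K #>\<^bsub>F\<^esub> d"
proof -
  have "c \<in> K #>\<^bsub>F\<^esub> d"
    unfolding r_coset_def using assms(3) by (intro UN_I[of "c - d"]) auto
  then show ?thesis using F.repr_independence[OF _ assms(2) K_subgroup] by simp
qed

text \<open>The scalar actions on the tensor product are unions of cosets over all representatives.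
  If the induced map on the free group sends relators into the subgroup \<open>K\<close> of
  relations, all these cosets coincide and the union is a single coset.\<close>

lemma coset_extend:
  assumes f: "\<And>m n. m \<in> carrier M \<Longrightarrow> n \<in> carrier N \<Longrightarrow> f (m, n) \<in> carrier F"
    and gens: "\<And>c. c \<in> tensor_gens \<Longrightarrow> frag_extend f c \<in> K"
    and c: "c \<in> carrier F"
  shows "(\<Union>d\<in>K #>\<^bsub>F\<^esub> c. K #>\<^bsub>F\<^esub> frag_extend f d) = K #>\<^bsub>F\<^esub> frag_extend f c"
proof -
  have fK: "frag_extend f k \<in> K" if "k \<in> K" for k
    using that[unfolded tensor_rel_eq]
  proof induct
    case one
    then show ?case using subgroup.one_closed[OF K_subgroup] by simp
  next
    case (incl h)
    then show ?case by (rule gens)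
  next
    case (inv h)
    have *: "inv\<^bsub>F\<^esub> x = - x" if "x \<in> carrier F" for x
      using that by (intro inv_free_Abelian_group) simp
    have "inv\<^bsub>F\<^esub> h = - h" using inv gens_carrier by (intro *) blast
    moreover have "inv\<^bsub>F\<^esub> frag_extend f h = - frag_extend f h"
      using gens[OF inv] K_carrier by (intro *) blast
    ultimately show ?case
      using subgroup.m_inv_closed[OF K_subgroup gens[OF inv]] by (simp add: frag_extend_minus)
  next
    case (eng h1 h2)
    then show ?case using subgroup.m_closed[OF K_subgroup, of "frag_extend f h1" "frag_extend f h2"]
      by (simp add: frag_extend_add)
  qed
  have fF: "frag_extend f d \<in> carrier F" if "d \<in> carrier F" for d
  proof -
    have "Poly_Mapping.keys (f x) \<subseteq> carrier M \<times> carrier N" if "x \<in> Poly_Mapping.keys d" for x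
    proof -
      have "x \<in> carrier M \<times> carrier N" using that \<open>d \<in> carrier F\<close> by auto
      then show ?thesis using f[of "fst x" "snd x"] by (cases x) simp
    qed
    then have "Poly_Mapping.keys (frag_extend f d) \<subseteq> carrier M \<times> carrier N"
      by (rule order_trans[OF keys_frag_extend UN_least])
    then show ?thesis by simp
  qed
  have "K #>\<^bsub>F\<^esub> frag_extend f d = K #>\<^bsub>F\<^esub> frag_extend f c" if d: "d \<in> K #>\<^bsub>F\<^esub> c" for d
  proof -
    obtain k where k: "k \<in> K" "d = k + c" using d by (auto simp: r_coset_def)
    have kF: "k \<in> carrier F" using k(1) K_carrier by blast
    have "d \<in> carrier F" using F.m_closed[OF kF c] k(2) by simp
    moreover have "frag_extend f d - frag_extend f c \<in> K"
      using fK[OF k(1)] k(2) by (simp add: frag_extend_add)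
    ultimately show ?thesis using c by (intro coset_eqI fF)
  qed
  moreover have "c \<in> K #>\<^bsub>F\<^esub> c"
    using F.rcos_self[OF c K_subgroup] .
  ultimately show ?thesis by blast
qed

definition pairing :: "'m \<Rightarrow> 'n \<Rightarrow> 'r" where
  "pairing m n = \<phi> (pure_tensor S M N m n)"

lemma frag_carrier: "\<lbrakk>m \<in> carrier M; n \<in> carrier N\<rbrakk> \<Longrightarrow> frag_of (m, n) \<in> carrier F"
  by simp

lemma phi_closed: "t \<in> carrier T \<Longrightarrow> \<phi> t \<in> carrier R"
  and phi_add: "\<lbrakk>t \<in> carrier T; u \<in> carrier T\<rbrakk> \<Longrightarrow> \<phi> (t \<oplus>\<^bsub>T\<^esub> u) = \<phi> t \<oplus>\<^bsub>R\<^esub> \<phi> u"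
  and phi_smult: "\<lbrakk>a \<in> carrier R; t \<in> carrier T\<rbrakk> \<Longrightarrow> \<phi> (a \<odot>\<^bsub>T\<^esub> t) = a \<otimes>\<^bsub>R\<^esub> \<phi> t"
  and phi_rsmult: "\<lbrakk>a \<in> carrier R; t \<in> carrier T\<rbrakk> \<Longrightarrow> \<phi> (t \<odot>\<^sub>r\<^bsub>T\<^esub> a) = \<phi> t \<otimes>\<^bsub>R\<^esub> a"
  and phi_comp: "\<lbrakk>\<nu> \<in> carrier G; t \<in> mcomp T \<nu>\<rbrakk> \<Longrightarrow> \<phi> t \<in> rcomp R \<nu>"
  using phi_hom by (auto simp: graded_bimodule_hom_def image_subset_iff)

lemma phi_coset_add:
  "\<lbrakk>c \<in> carrier F; d \<in> carrier F\<rbrakk> \<Longrightarrow> \<phi> (K #>\<^bsub>F\<^esub> (c + d)) = \<phi> (K #>\<^bsub>F\<^esub> c) \<oplus>\<^bsub>R\<^esub> \<phi> (K #>\<^bsub>F\<^esub> d)"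
  using phi_add[OF coset_closed coset_closed] by (simp add: coset_add del: carrier_free_Abelian_group_iff)

lemma gens_in_K: "c \<in> tensor_gens \<Longrightarrow> c \<in> K"
  unfolding tensor_rel_eq by (rule generate.incl)

lemma pairing_closed: "\<lbrakk>m \<in> carrier M; n \<in> carrier N\<rbrakk> \<Longrightarrow> pairing m n \<in> carrier R"
  unfolding pairing_def pure_tensor_def by (intro phi_closed coset_closed frag_carrier)

lemma pairing_add_l:
  assumes "m \<in> carrier M" "m' \<in> carrier M" "n \<in> carrier N"
  shows "pairing (m \<oplus>\<^bsub>M\<^esub> m') n = pairing m n \<oplus>\<^bsub>R\<^esub> pairing m' n"
proof -
  have "frag_of (m \<oplus>\<^bsub>M\<^esub> m', n) - (frag_of (m, n) + frag_of (m', n)) \<in> tensor_gens"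
    using assms unfolding tensor_gens_def diff_diff_add[symmetric] by blast
  then have "K #>\<^bsub>F\<^esub> frag_of (m \<oplus>\<^bsub>M\<^esub> m', n) = K #>\<^bsub>F\<^esub> (frag_of (m, n) + frag_of (m', n))"
    using assms F.m_closed[OF frag_carrier[of m n] frag_carrier[of m' n]]
    by (intro coset_eqI gens_in_K frag_carrier) auto
  then show ?thesis
    unfolding pairing_def pure_tensor_def using assms by (simp add: phi_coset_add)
qed

lemma pairing_add_r:
  assumes "m \<in> carrier M" "n \<in> carrier N" "n' \<in> carrier N"
  shows "pairing m (n \<oplus>\<^bsub>N\<^esub> n') = pairing m n \<oplus>\<^bsub>R\<^esub> pairing m n'"
proof -
  have "frag_of (m, n \<oplus>\<^bsub>N\<^esub> n') - (frag_of (m, n) + frag_of (m, n')) \<in> tensor_gens"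
    using assms unfolding tensor_gens_def diff_diff_add[symmetric] by blast
  then have "K #>\<^bsub>F\<^esub> frag_of (m, n \<oplus>\<^bsub>N\<^esub> n') = K #>\<^bsub>F\<^esub> (frag_of (m, n) + frag_of (m, n'))"
    using assms F.m_closed[OF frag_carrier[of m n] frag_carrier[of m n']]
    by (intro coset_eqI gens_in_K frag_carrier) auto
  then show ?thesis
    unfolding pairing_def pure_tensor_def using assms by (simp add: phi_coset_add)
qed

lemma pairing_balanced:
  assumes "m \<in> carrier M" "n \<in> carrier N" "s \<in> carrier S"
  shows "pairing (m \<odot>\<^sub>r\<^bsub>M\<^esub> s) n = pairing m (s \<odot>\<^bsub>N\<^esub> n)"
proof -
  have "frag_of (m \<odot>\<^sub>r\<^bsub>M\<^esub> s, n) - frag_of (m, s \<odot>\<^bsub>N\<^esub> n) \<in> tensor_gens"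
    using assms unfolding tensor_gens_def by blast
  then have "K #>\<^bsub>F\<^esub> frag_of (m \<odot>\<^sub>r\<^bsub>M\<^esub> s, n) = K #>\<^bsub>F\<^esub> frag_of (m, s \<odot>\<^bsub>N\<^esub> n)"
    using assms by (intro coset_eqI gens_in_K frag_carrier MB.rsmult_closed NB.M.smult_closed)
  then show ?thesis by (simp add: pairing_def pure_tensor_def)
qed

text \<open>A pair of additive maps compatible with the S-actions sends each relator to a relator of
  the same kind. It is applied with a scalar multiplication on one factor and the identity on the
  other.\<close>

lemma tensor_gens_extend:
  assumes u: "\<And>m. m \<in> carrier M \<Longrightarrow> u m \<in> carrier M"
      "\<And>m m'. m \<in> carrier M \<Longrightarrow> m' \<in> carrier M \<Longrightarrow> u (m \<oplus>\<^bsub>M\<^esub> m') = u m \<oplus>\<^bsub>M\<^esub> u m'"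
      "\<And>m s. m \<in> carrier M \<Longrightarrow> s \<in> carrier S \<Longrightarrow> u (m \<odot>\<^sub>r\<^bsub>M\<^esub> s) = u m \<odot>\<^sub>r\<^bsub>M\<^esub> s"
    and v: "\<And>n. n \<in> carrier N \<Longrightarrow> v n \<in> carrier N"
      "\<And>n n'. n \<in> carrier N \<Longrightarrow> n' \<in> carrier N \<Longrightarrow> v (n \<oplus>\<^bsub>N\<^esub> n') = v n \<oplus>\<^bsub>N\<^esub> v n'"
      "\<And>n s. n \<in> carrier N \<Longrightarrow> s \<in> carrier S \<Longrightarrow> v (s \<odot>\<^bsub>N\<^esub> n) = s \<odot>\<^bsub>N\<^esub> v n"
    and c: "c \<in> tensor_gens"
  shows "frag_extend (\<lambda>(m, n). frag_of (u m, v n)) c \<in> tensor_gens"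
  using c
proof (cases rule: tensor_gens_cases)
  case (1 m m' n)
  then show ?thesis
    unfolding tensor_gens_def using u(1)[OF 1(1)] u(1)[OF 1(2)] v(1)[OF 1(3)]
    by (simp add: frag_extend_diff u(2)) blast
next
  case (2 m n n')
  then show ?thesis
    unfolding tensor_gens_def using u(1)[OF 2(1)] v(1)[OF 2(2)] v(1)[OF 2(3)]
    by (simp add: frag_extend_diff v(2)) blast
next
  case (3 m s n)
  then show ?thesis
    unfolding tensor_gens_def using u(1)[OF 3(1)] v(1)[OF 3(3)]
    by (simp add: frag_extend_diff u(3) v(3)) blast
qed

lemma pairing_smult:
  assumes "m \<in> carrier M" "n \<in> carrier N" "a \<in> carrier R"
  shows "pairing (a \<odot>\<^bsub>M\<^esub> m) n = a \<otimes>\<^bsub>R\<^esub> pairing m n"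
proof -
  let ?f = "\<lambda>(m, n). frag_of (a \<odot>\<^bsub>M\<^esub> m, n)"
  have "frag_extend ?f c \<in> tensor_gens" if "c \<in> tensor_gens" for c
    using assms that
    by (intro tensor_gens_extend) (auto simp: MB.M.smult_closed MB.M.smult_r_distr MB.smult_rsmult)
  then have "a \<odot>\<^bsub>T\<^esub> (K #>\<^bsub>F\<^esub> frag_of (m, n)) = K #>\<^bsub>F\<^esub> frag_extend ?f (frag_of (m, n))"
    unfolding tensor_simps
    by (intro coset_extend) (use assms gens_in_K in \<open>auto intro: MB.M.smult_closed\<close>)
  then show ?thesis
    unfolding pairing_def pure_tensor_def
    using phi_smult[OF assms(3) coset_closed[OF frag_carrier[OF assms(1,2)]]] by simp
qed

lemma pairing_rsmult:
  assumes "m \<in> carrier M" "n \<in> carrier N" "a \<in> carrier R"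
  shows "pairing m (n \<odot>\<^sub>r\<^bsub>N\<^esub> a) = pairing m n \<otimes>\<^bsub>R\<^esub> a"
proof -
  let ?f = "\<lambda>(m, n). frag_of (m, n \<odot>\<^sub>r\<^bsub>N\<^esub> a)"
  have "frag_extend ?f c \<in> tensor_gens" if "c \<in> tensor_gens" for c
    using assms that
    by (intro tensor_gens_extend) (auto simp: NB.rsmult_closed NB.rsmult_l_distr NB.smult_rsmult)
  then have "(K #>\<^bsub>F\<^esub> frag_of (m, n)) \<odot>\<^sub>r\<^bsub>T\<^esub> a = K #>\<^bsub>F\<^esub> frag_extend ?f (frag_of (m, n))"
    unfolding tensor_simps
    by (intro coset_extend) (use assms gens_in_K in \<open>auto intro: NB.rsmult_closed\<close>)
  then show ?thesis
    unfolding pairing_def pure_tensor_def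
    using phi_rsmult[OF assms(3) coset_closed[OF frag_carrier[OF assms(1,2)]]] by simp
qed

lemma pairing_comp:
  assumes "\<nu> \<in> carrier G" "\<mu> \<in> carrier G" "m \<in> mcomp M \<nu>" "n \<in> mcomp N \<mu>"
  shows "pairing m n \<in> rcomp R (\<nu> \<otimes>\<^bsub>G\<^esub> \<mu>)"
proof -
  have "pure_tensor S M N m n \<in> mcomp T (\<nu> \<otimes>\<^bsub>G\<^esub> \<mu>)"
    unfolding tensor_simps by (rule generate.incl) (use assms in blast)
  then show ?thesis unfolding pairing_def using assms by (intro phi_comp) auto
qed

text \<open>Elements of the free group are integer combinations built by differences, while the span
  on the right uses sums only. The gap is closed by writing the negative of a value as the value at
  (-1)m.\<close>

lemma image_phi:
  "\<phi> ` carrier T = add_span R {pairing m n | m n. m \<in> carrier M \<and> n \<in> carrier N}"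
  (is "?l = add_span R ?B")
proof
  have B: "?B \<subseteq> carrier R" using pairing_closed by auto
  have zeroF: "0 \<in> carrier F" using F.one_closed by simp
  have phi0: "\<phi> (K #>\<^bsub>F\<^esub> 0) = \<zero>\<^bsub>R\<^esub>"
  proof -
    have "\<phi> (K #>\<^bsub>F\<^esub> 0) \<oplus>\<^bsub>R\<^esub> \<phi> (K #>\<^bsub>F\<^esub> 0) = \<phi> (K #>\<^bsub>F\<^esub> 0)"
      using phi_coset_add[OF zeroF zeroF] by simp
    then show ?thesis
      using phi_closed[OF coset_closed[OF zeroF]] by (simp add: MB.M.R.add.r_cancel_one)
  qed
  have neg: "\<ominus>\<^bsub>R\<^esub> b \<in> add_span R ?B" if b: "b \<in> ?B" for b
  proof -
    obtain m n where mn: "m \<in> carrier M" "n \<in> carrier N" "b = pairing m n" using b by auto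
    then have "\<ominus>\<^bsub>R\<^esub> b = pairing ((\<ominus>\<^bsub>R\<^esub> \<one>\<^bsub>R\<^esub>) \<odot>\<^bsub>M\<^esub> m) n"
      using pairing_smult[of m n "\<ominus>\<^bsub>R\<^esub> \<one>\<^bsub>R\<^esub>"] pairing_closed[of m n] by (simp add: MB.M.R.l_minus)
    moreover have "(\<ominus>\<^bsub>R\<^esub> \<one>\<^bsub>R\<^esub>) \<odot>\<^bsub>M\<^esub> m \<in> carrier M"
      using mn by (simp add: MB.M.smult_closed)
    ultimately show ?thesis
      using mn(2) by (intro MB.M.R.add_span_incl[OF B]) blast
  qed
  have coset: "c \<in> carrier F \<and> \<phi> (K #>\<^bsub>F\<^esub> c) \<in> add_span R ?B"
    if "Poly_Mapping.keys c \<subseteq> carrier M \<times> carrier N" for c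
    using that
  proof (induct c rule: frag_induction)
    case zero
    then show ?case using zeroF phi0 by (simp add: add_span.zero)
  next
    case (one x)
    then show ?case
      using MB.M.R.add_span_incl[OF B, of "\<phi> (K #>\<^bsub>F\<^esub> frag_of x)"]
      by (cases x) (auto simp: pairing_def pure_tensor_def)
  next
    case (diff a b)
    then have ab: "a \<in> carrier F" "b \<in> carrier F" and abF: "a - b \<in> carrier F"
      using keys_diff[of a b] by auto
    have "\<phi> (K #>\<^bsub>F\<^esub> a) = \<phi> (K #>\<^bsub>F\<^esub> (a - b)) \<oplus>\<^bsub>R\<^esub> \<phi> (K #>\<^bsub>F\<^esub> b)"
      using phi_coset_add[OF abF ab(2)] by simp
    then have "\<phi> (K #>\<^bsub>F\<^esub> (a - b)) = \<phi> (K #>\<^bsub>F\<^esub> a) \<oplus>\<^bsub>R\<^esub> \<ominus>\<^bsub>R\<^esub> \<phi> (K #>\<^bsub>F\<^esub> b)"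
      using phi_closed[OF coset_closed[OF abF]] phi_closed[OF coset_closed[OF ab(2)]]
      by (simp add: MB.M.R.a_assoc MB.M.R.r_neg)
    then show ?case
      using diff abF MB.M.R.add_span_add[OF B] MB.M.R.add_span_neg[OF B neg] by simp
  qed
  show "?l \<subseteq> add_span R ?B"
  proof
    fix r assume "r \<in> ?l"
    then obtain t where t: "t \<in> carrier T" "r = \<phi> t" by auto
    then obtain c where "c \<in> carrier F" "t = K #>\<^bsub>F\<^esub> c"
      by (auto simp: tensor_simps FactGroup_def RCOSETS_def)
    then show "r \<in> add_span R ?B" using coset t by simp
  qed
  show "add_span R ?B \<subseteq> ?l"
  proof
    fix r assume "r \<in> add_span R ?B"
    then have "\<exists>c\<in>carrier F. r = \<phi> (K #>\<^bsub>F\<^esub> c)"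
    proof induct
      case zero
      then show ?case using zeroF phi0 by metis
    next
      case (add b x)
      then obtain m n c where mn: "m \<in> carrier M" "n \<in> carrier N" "b = pairing m n"
        and c: "c \<in> carrier F" "x = \<phi> (K #>\<^bsub>F\<^esub> c)" by blast
      have "b \<oplus>\<^bsub>R\<^esub> x = \<phi> (K #>\<^bsub>F\<^esub> (frag_of (m, n) + c))"
        using mn c phi_coset_add[OF frag_carrier[OF mn(1,2)] c(1)] by (simp add: pairing_def pure_tensor_def)
      moreover have "frag_of (m, n) + c \<in> carrier F"
        using F.m_closed[OF frag_carrier[OF mn(1,2)] c(1)] by simp
      ultimately show ?case by blast
    qed
    then show "r \<in> ?l" using coset_closed by blast
  qed
qed

end

section \<open>The equivalence\<close>

lemma gr_cat_simps [simp]: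
  "Arr (gr_cat G R) = graded_hom G R" "Idt (gr_cat G R) X = (\<lambda>x\<in>carrier X. x)"
  "Cmp (gr_cat G R) X Y Z g f = compose (carrier X) g f"
  by (simp_all add: gr_cat_def)

lemma full_subcat_simps [simp]:
  "Obj (full_subcat C P) = Obj C \<inter> P" "Arr (full_subcat C P) = Arr C"
  "Idt (full_subcat C P) = Idt C" "Cmp (full_subcat C P) = Cmp C"
  by (simp_all add: full_subcat_def)

lemma is_functor_full_subcat:
  assumes "is_functor C D F" "\<And>X. X \<in> Obj C \<Longrightarrow> X \<in> P \<Longrightarrow> Fobj F X \<in> Q"
  shows "is_functor (full_subcat C P) (full_subcat D Q) F"
  using assms by (simp add: is_functor_def)

lemma graded_hom_compose:
  assumes X: "graded_module G R X" "graded_module G R Y" "graded_module G R Z"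
    and f: "f \<in> graded_hom G R X Y" and g: "g \<in> graded_hom G R Y Z"
  shows "compose (carrier X) g f \<in> graded_hom G R X Z"
proof -
  interpret X: grmod G R X by (rule grmodI) fact
  interpret f: grhom G R X Y f using X f by (intro grhomI)
  interpret g: grhom G R Y Z g using X g by (intro grhomI)
  show ?thesis
    by (rule graded_homI)
      (auto simp: compose_def X.smult_closed X.X.comp_carrier intro: f.hom_comp g.hom_comp)
qed

text \<open>The inverse preserves degrees because f commutes with coordinates: the preimage of a
  homogeneous element and the corresponding component of that preimage have the same image, hence
  agree.\<close>

lemma is_iso_gr_cat:
  assumes X: "graded_module G R X" "graded_module G R Y" and f: "f \<in> graded_hom G R X Y"
    and inj: "inj_on f (carrier X)" and surj: "f ` carrier X = carrier Y"
  shows "is_iso (gr_cat G R) X Y f"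
proof -
  interpret f: grhom G R X Y f using X f by (intro grhomI)
  define g where "g = (\<lambda>y\<in>carrier Y. inv_into (carrier X) f y)"
  have g: "g y \<in> carrier X" "f (g y) = y" if "y \<in> carrier Y" for y
    using that surj by (auto simp: g_def intro: inv_into_into f_inv_into_f)
  have g_eq: "g y = x" if "x \<in> carrier X" "f x = y" for x y
    using that inj f.hom_closed[of x] by (auto simp: g_def)
  have "g \<in> graded_hom G R Y X"
  proof (rule graded_homI)
    show "g (y \<oplus>\<^bsub>Y\<^esub> y') = g y \<oplus>\<^bsub>X\<^esub> g y'" if "y \<in> carrier Y" "y' \<in> carrier Y" for y y'
      using that g by (intro g_eq) auto
    show "g (a \<odot>\<^bsub>Y\<^esub> y) = a \<odot>\<^bsub>X\<^esub> g y" if "a \<in> carrier R" "y \<in> carrier Y" for a y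
      using that g f.X.smult_closed by (intro g_eq) auto
    show "g y \<in> mcomp X \<nu>" if \<nu>: "\<nu> \<in> carrier G" and y: "y \<in> mcomp Y \<nu>" for \<nu> y
    proof -
      have yc: "y \<in> carrier Y" using \<nu> y by (rule f.Y.X.comp_carrier)
      have "g y = f.X.X.pr \<nu> (g y)"
        using \<nu> y yc g by (intro g_eq) (auto simp: f.hom_pr f.Y.X.pr_same)
      then show ?thesis using \<nu> yc g f.X.X.pr_comp[of \<nu> "g y"] by simp
    qed
  qed (use g in \<open>auto simp: g_def\<close>)
  moreover have "compose (carrier X) g f = (\<lambda>x\<in>carrier X. x)"
    unfolding compose_def by (rule restrict_ext) (simp add: g_eq)
  moreover have "compose (carrier Y) f g = (\<lambda>y\<in>carrier Y. y)"
    unfolding compose_def by (rule restrict_ext) (simp add: g)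
  ultimately show ?thesis using f unfolding is_iso_def by auto
qed

text \<open>The record \<open>cat\<close> carries no laws, so composition, associativity and
  identities in D appear as hypotheses. The inverse transformation is chosen object by object, and
  its naturality follows by composing the given square with inverses on both sides.\<close>

lemma naturally_isomorphic_sym:
  assumes nat: "naturally_isomorphic C D F H" and F: "is_functor C D F" and H: "is_functor C D H"
    and comp: "\<And>X Y Z f g. X \<in> Obj D \<Longrightarrow> Y \<in> Obj D \<Longrightarrow> Z \<in> Obj D \<Longrightarrow>
      f \<in> Arr D X Y \<Longrightarrow> g \<in> Arr D Y Z \<Longrightarrow> Cmp D X Y Z g f \<in> Arr D X Z"
    and assoc: "\<And>W X Y Z f g h. W \<in> Obj D \<Longrightarrow> X \<in> Obj D \<Longrightarrow> Y \<in> Obj D \<Longrightarrow> Z \<in> Obj D \<Longrightarrow>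
      f \<in> Arr D W X \<Longrightarrow> g \<in> Arr D X Y \<Longrightarrow> h \<in> Arr D Y Z \<Longrightarrow>
      Cmp D W X Z (Cmp D X Y Z h g) f = Cmp D W Y Z h (Cmp D W X Y g f)"
    and unit: "\<And>X Y f. X \<in> Obj D \<Longrightarrow> Y \<in> Obj D \<Longrightarrow> f \<in> Arr D X Y \<Longrightarrow> Cmp D X X Y f (Idt D X) = f"
      "\<And>X Y f. X \<in> Obj D \<Longrightarrow> Y \<in> Obj D \<Longrightarrow> f \<in> Arr D X Y \<Longrightarrow> Cmp D X Y Y (Idt D Y) f = f"
  shows "naturally_isomorphic C D H F"
proof -
  obtain \<eta> where iso: "\<And>X. X \<in> Obj C \<Longrightarrow> is_iso D (Fobj F X) (Fobj H X) (\<eta> X)"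
    and natural: "\<And>X Y f. X \<in> Obj C \<Longrightarrow> Y \<in> Obj C \<Longrightarrow> f \<in> Arr C X Y \<Longrightarrow>
      Cmp D (Fobj F X) (Fobj F Y) (Fobj H Y) (\<eta> Y) (Farr F X Y f) =
      Cmp D (Fobj F X) (Fobj H X) (Fobj H Y) (Farr H X Y f) (\<eta> X)"
    using nat unfolding naturally_isomorphic_def by blast
  have "\<forall>X. \<exists>\<epsilon>. X \<in> Obj C \<longrightarrow> \<epsilon> \<in> Arr D (Fobj H X) (Fobj F X) \<and>
      Cmp D (Fobj F X) (Fobj H X) (Fobj F X) \<epsilon> (\<eta> X) = Idt D (Fobj F X) \<and>
      Cmp D (Fobj H X) (Fobj F X) (Fobj H X) (\<eta> X) \<epsilon> = Idt D (Fobj H X)"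
    using iso unfolding is_iso_def by blast
  then obtain \<epsilon> where \<epsilon>: "\<And>X. X \<in> Obj C \<Longrightarrow> \<epsilon> X \<in> Arr D (Fobj H X) (Fobj F X)"
    "\<And>X. X \<in> Obj C \<Longrightarrow> Cmp D (Fobj F X) (Fobj H X) (Fobj F X) (\<epsilon> X) (\<eta> X) = Idt D (Fobj F X)"
    "\<And>X. X \<in> Obj C \<Longrightarrow> Cmp D (Fobj H X) (Fobj F X) (Fobj H X) (\<eta> X) (\<epsilon> X) = Idt D (Fobj H X)"
    by metis
  have \<eta>: "\<eta> X \<in> Arr D (Fobj F X) (Fobj H X)" if "X \<in> Obj C" for X
    using iso[OF that] by (simp add: is_iso_def)
  have Fo: "Fobj F X \<in> Obj D" "Fobj H X \<in> Obj D" if "X \<in> Obj C" for X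
    using F H that by (simp_all add: is_functor_def)
  have Fa: "Farr F X Y f \<in> Arr D (Fobj F X) (Fobj F Y)" "Farr H X Y f \<in> Arr D (Fobj H X) (Fobj H Y)"
    if "X \<in> Obj C" "Y \<in> Obj C" "f \<in> Arr C X Y" for X Y f
    using F H that by (simp_all add: is_functor_def)
  show ?thesis
    unfolding naturally_isomorphic_def
  proof (intro exI[of _ \<epsilon>] conjI ballI)
    fix X assume X: "X \<in> Obj C"
    show "is_iso D (Fobj H X) (Fobj F X) (\<epsilon> X)"
      unfolding is_iso_def using \<epsilon>[OF X] \<eta>[OF X] by blast
    fix Y f assume Y: "Y \<in> Obj C" and f: "f \<in> Arr C X Y"
    let ?FX = "Fobj F X" and ?FY = "Fobj F Y" and ?HX = "Fobj H X" and ?HY = "Fobj H Y"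
    note [simp] = Fo[OF X] Fo[OF Y] Fa[OF X Y f] \<epsilon>(1)[OF X] \<epsilon>(1)[OF Y] \<eta>[OF X] \<eta>[OF Y]
    let ?Ff = "Farr F X Y f" and ?Hf = "Farr H X Y f"
    have "Cmp D ?HX ?HY ?FY (\<epsilon> Y) ?Hf =
        Cmp D ?HX ?HY ?FY (\<epsilon> Y) (Cmp D ?HX ?HX ?HY ?Hf (Cmp D ?HX ?FX ?HX (\<eta> X) (\<epsilon> X)))"
      using \<epsilon>(3)[OF X] by (simp add: unit(1))
    also have "\<dots> = Cmp D ?HX ?HY ?FY (\<epsilon> Y) (Cmp D ?HX ?FX ?HY (Cmp D ?FX ?HX ?HY ?Hf (\<eta> X)) (\<epsilon> X))"
      by (simp add: assoc)
    also have "\<dots> = Cmp D ?HX ?HY ?FY (\<epsilon> Y) (Cmp D ?HX ?FX ?HY (Cmp D ?FX ?FY ?HY (\<eta> Y) ?Ff) (\<epsilon> X))"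
      by (simp add: natural[OF X Y f])
    also have "\<dots> = Cmp D ?HX ?HY ?FY (\<epsilon> Y) (Cmp D ?HX ?FY ?HY (\<eta> Y) (Cmp D ?HX ?FX ?FY ?Ff (\<epsilon> X)))"
      by (simp add: assoc)
    also have "\<dots> = Cmp D ?HX ?FY ?FY (Cmp D ?FY ?HY ?FY (\<epsilon> Y) (\<eta> Y)) (Cmp D ?HX ?FX ?FY ?Ff (\<epsilon> X))"
      by (rule assoc[symmetric]) (auto intro: comp)
    also have "\<dots> = Cmp D ?HX ?FX ?FY ?Ff (\<epsilon> X)"
      using \<epsilon>(2)[OF Y] by (simp add: unit(2) comp)
    finally show "Cmp D ?HX ?HY ?FY (\<epsilon> Y) ?Hf = Cmp D ?HX ?FX ?FY ?Ff (\<epsilon> X)" .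
  qed
qed

section \<open>The functor HOM on modules over the universe\<close>

locale coded_bimod = bimod G R S M
  for G :: "'g monoid" and R :: "('g, 'r) gring" and S :: "('g, 's) gring"
    and M :: "('g, 'r, 's, 'm) gbimodule" +
  fixes code :: "('m \<Rightarrow> 'u) \<Rightarrow> 'u"
  assumes code_inj: "inj_on code (carrier M \<rightarrow>\<^sub>E UNIV)"
begin

definition decode :: "('g, 'r, 'u) gmodule \<Rightarrow> 'u \<Rightarrow> 'm \<Rightarrow> 'u" where
  "decode X = inv_into (carrier (HOM G R M X)) code"

abbreviation "T \<equiv> HOM_functor G R M code"

context
  fixes X :: "('g, 'r, 'u) gmodule"
  assumes X: "graded_module G R X"
begin

interpretation hom_context G R S M X
  by (intro hom_context.intro grmodI X) unfold_locales

lemma inj_code: "inj_on code (carrier (HOM G R M X))"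
proof (rule inj_on_subset[OF code_inj], rule subsetI)
  fix f assume "f \<in> carrier H"
  then show "f \<in> carrier M \<rightarrow>\<^sub>E UNIV"
    using HOM_D(1)[of f] by (simp add: PiE_iff)
qed

lemma decode_code: "f \<in> carrier (HOM G R M X) \<Longrightarrow> decode X (code f) = f"
  unfolding decode_def by (rule inv_into_f_f[OF inj_code])

lemma Fobj_T: "Fobj T X = transport code (HOM G R M X)"
  by (simp add: HOM_functor_def)

text \<open>With \<open>decode\<close> as evaluation, the coded module has the abstract interface of
  HOM, through which the results on closed objects and on the unit apply to it.\<close>

lemma Fobj_hom_object: "hom_object G R S M X (Fobj T X) (decode X)"
proof -
  note tr = transport_inj[OF HOM_graded_module inj_code]
  interpret Y: grmod G S "transport code H" by (rule grmodI[OF tr(3)])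
  have dec: "decode X y \<in> carrier H" "code (decode X y) = y" if "y \<in> carrier (transport code H)" for y
    using that by (auto simp: decode_code)
  have smult: "(\<lambda>m\<in>carrier M. f (m \<odot>\<^sub>r\<^bsub>M\<^esub> s)) \<in> carrier H" if "f \<in> carrier H" "s \<in> carrier S" for f s
    using HOM_smult_closed that .
  show ?thesis
    unfolding Fobj_T
  proof unfold_locales
    fix y assume y: "y \<in> carrier (transport code H)"
    show "decode X y m \<in> carrier X" if "m \<in> carrier M" for m
      using HOM_D(2)[OF dec(1)[OF y] that] .
    show "decode X y (m \<oplus>\<^bsub>M\<^esub> m') = decode X y m \<oplus>\<^bsub>X\<^esub> decode X y m'"
      if "m \<in> carrier M" "m' \<in> carrier M" for m m'
      using HOM_D(3)[OF dec(1)[OF y] that] .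
    show "decode X y (a \<odot>\<^bsub>M\<^esub> m) = a \<odot>\<^bsub>X\<^esub> decode X y m"
      if "m \<in> carrier M" "a \<in> carrier R" for m a
      using HOM_D(4)[OF dec(1)[OF y] that(2,1)] .
    show "decode X (s \<odot>\<^bsub>transport code H\<^esub> y) m = decode X y (m \<odot>\<^sub>r\<^bsub>M\<^esub> s)"
      if m: "m \<in> carrier M" and s: "s \<in> carrier S" for m s
    proof -
      have "s \<odot>\<^bsub>transport code H\<^esub> y = code (s \<odot>\<^bsub>H\<^esub> decode X y)"
        using tr(2)[OF s dec(1)[OF y]] dec(2)[OF y] by simp
      then show ?thesis using m smult[OF dec(1)[OF y] s] by (simp add: decode_code)
    qed
    fix y' assume y': "y' \<in> carrier (transport code H)"
    show "decode X (y \<oplus>\<^bsub>transport code H\<^esub> y') m = decode X y m \<oplus>\<^bsub>X\<^esub> decode X y' m"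
      if m: "m \<in> carrier M" for m
    proof -
      have "y \<oplus>\<^bsub>transport code H\<^esub> y' = code (decode X y \<oplus>\<^bsub>H\<^esub> decode X y')"
        using tr(1)[OF dec(1)[OF y] dec(1)[OF y']] dec(2)[OF y] dec(2)[OF y'] by simp
      then show ?thesis
        using m HOM_add_closed[OF dec(1)[OF y] dec(1)[OF y']] by (simp add: decode_code)
    qed
    assume eq: "\<And>m. m \<in> carrier M \<Longrightarrow> decode X y m = decode X y' m"
    have "decode X y = decode X y'"
      by (rule extensionalityI[of _ "carrier M"]) (use HOM_D(1) dec y y' eq in auto)
    then show "y = y'" using dec(2)[OF y] dec(2)[OF y'] by metis
  next
    fix \<sigma> \<nu> y m assume \<sigma>: "\<sigma> \<in> carrier G" and \<nu>: "\<nu> \<in> carrier G"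
      and y: "y \<in> mcomp (transport code H) \<sigma>" and m: "m \<in> mcomp M \<nu>"
    obtain f where f: "f \<in> HOM_deg G R M X \<sigma>" "y = code f" using y by auto
    then show "decode X y m \<in> mcomp X (\<nu> \<otimes>\<^bsub>G\<^esub> \<sigma>)"
      using HOM_deg_comp[OF f(1) \<nu> m] HOM_deg_closed[OF \<sigma> f(1)] by (simp add: decode_code)
  next
    fix \<sigma> f assume \<sigma>: "\<sigma> \<in> carrier G" and f: "f \<in> HOM_deg G R M X \<sigma>"
    then show "\<exists>y\<in>mcomp (transport code H) \<sigma>. \<forall>m\<in>carrier M. decode X y m = f m"
      using HOM_deg_closed[OF \<sigma> f] by (intro bexI[of _ "code f"]) (auto simp: decode_code)
  qed
qed

lemma Fobj_graded_module: "graded_module G S (Fobj T X)"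
proof -
  interpret hom_object G R S M X "Fobj T X" "decode X" by (rule Fobj_hom_object)
  show ?thesis by unfold_locales
qed

lemma HOM_compose:
  assumes X': "graded_module G R X'" and h: "h \<in> graded_hom G R X X'" and f: "f \<in> carrier (HOM G R M X)"
  shows "compose (carrier M) h f \<in> carrier (HOM G R M X')"
proof -
  interpret X': hom_context G R S M X'
    by (intro hom_context.intro grmodI X') unfold_locales
  interpret h: grhom G R X X' h using X X' h by (intro grhomI)
  show ?thesis using f
  proof (induct rule: HOM_induct)
    case zero
    have "compose (carrier M) h (\<lambda>m\<in>carrier M. \<zero>\<^bsub>X\<^esub>) = (\<lambda>m\<in>carrier M. \<zero>\<^bsub>X'\<^esub>)"
      unfolding compose_def by (rule restrict_ext) simp
    then show ?case by (simp only: X'.HOM_zero_closed)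
  next
    case (deg \<sigma> f)
    note f = linear_mapsD[OF HOM_deg_linear[OF deg(2)]]
    have "compose (carrier M) h f \<in> HOM_deg G R M X' \<sigma>"
    proof (intro X'.HOM_degI X'.linear_mapsI)
      fix \<nu> m assume m: "\<nu> \<in> carrier G" "m \<in> mcomp M \<nu>"
      then show "compose (carrier M) h f m \<in> mcomp X' (\<nu> \<otimes>\<^bsub>G\<^esub> \<sigma>)"
        using deg M.X.comp_carrier[OF m] h.hom_comp[OF _ HOM_deg_comp[OF deg(2) m]] by (simp add: compose_def)
    qed (use f in \<open>auto simp: compose_def M.smult_closed\<close>)
    then show ?case using X'.HOM_deg_closed deg by blast
  next
    case (add f f')
    have "compose (carrier M) h (\<lambda>m\<in>carrier M. f m \<oplus>\<^bsub>X\<^esub> f' m) =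
      (\<lambda>m\<in>carrier M. compose (carrier M) h f m \<oplus>\<^bsub>X'\<^esub> compose (carrier M) h f' m)"
      unfolding compose_def
      by (rule restrict_ext) (simp add: HOM_D(2)[OF add(1)] HOM_D(2)[OF add(2)])
    then show ?case by (simp only: X'.HOM_add_closed[OF add(3,4)])
  qed
qed

end

text \<open>The second claim describes the functor on arrows through evaluation: applying the
  functor to h composes values with h. The encoding disappears from view.\<close>

lemma Farr_closed:
  assumes X: "graded_module G R X" "graded_module G R X'" and h: "h \<in> graded_hom G R X X'"
    and y: "y \<in> carrier (Fobj T X)"
  shows "Farr T X X' h y \<in> carrier (Fobj T X')"
    and "m \<in> carrier M \<Longrightarrow> decode X' (Farr T X X' h y) m = h (decode X y m)"
proof -
  have yT: "y \<in> code ` carrier (HOM G R M X)" using y by (simp add: Fobj_T[OF X(1)])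
  then have dec: "decode X y \<in> carrier (HOM G R M X)" using decode_code[OF X(1)] by auto
  have eq: "Farr T X X' h y = code (compose (carrier M) h (decode X y))"
    using yT by (simp add: HOM_functor_def decode_def)
  note comp = HOM_compose[OF X h dec]
  show "Farr T X X' h y \<in> carrier (Fobj T X')"
    using comp by (simp add: eq Fobj_T[OF X(2)])
  have "decode X' (Farr T X X' h y) = compose (carrier M) h (decode X y)"
    unfolding eq by (rule decode_code[OF X(2) comp])
  then show "decode X' (Farr T X X' h y) m = h (decode X y m)" if "m \<in> carrier M"
    using that by (simp add: compose_def)
qed

lemma Farr_extensional: "graded_module G R X \<Longrightarrow> Farr T X X' h \<in> extensional (carrier (Fobj T X))"
  by (simp add: Fobj_T) (simp add: HOM_functor_def)

text \<open>Every equation between elements of a coded HOM is checked after evaluation. For degrees,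
  \<open>ap_ex\<close> produces a homogeneous element with the same values, and extensionality
  identifies it with the image.\<close>

lemma is_functor_HOM: "is_functor (gr_cat G R) (gr_cat G S) T"
  unfolding is_functor_def Obj_gr_cat mem_Collect_eq Ball_def gr_cat_simps
proof (intro conjI allI impI)
  fix X :: "('g, 'r, 'u) gmodule" assume X: "graded_module G R X"
  show "graded_module G S (Fobj T X)" by (rule Fobj_graded_module[OF X])
  interpret X: hom_object G R S M X "Fobj T X" "decode X" by (rule Fobj_hom_object[OF X])
  show "Farr T X X (\<lambda>x\<in>carrier X. x) = (\<lambda>y\<in>carrier (Fobj T X). y)"
  proof (rule extensionalityI[OF Farr_extensional[OF X]])
    have id: "(\<lambda>x\<in>carrier X. x) \<in> graded_hom G R X X"
      by (rule graded_homI) (auto simp: X.X.smult_closed X.X.X.comp_carrier)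
    fix y assume y: "y \<in> carrier (Fobj T X)"
    note F = Farr_closed[OF X X id y]
    show "Farr T X X (\<lambda>x\<in>carrier X. x) y = (\<lambda>y\<in>carrier (Fobj T X). y) y"
      by (rule X.ap_ext) (use y F(1) in \<open>auto simp: F(2) X.ap_closed\<close>)
  qed simp
next
  fix X X' :: "('g, 'r, 'u) gmodule" and h
  assume X: "graded_module G R X" and X': "graded_module G R X'" and h: "h \<in> graded_hom G R X X'"
  interpret X: hom_object G R S M X "Fobj T X" "decode X" by (rule Fobj_hom_object[OF X])
  interpret X': hom_object G R S M X' "Fobj T X'" "decode X'" by (rule Fobj_hom_object[OF X'])
  interpret h: grhom G R X X' h using X X' h by (rule grhomI)
  note F = Farr_closed[OF X X' h]
  show "Farr T X X' h \<in> graded_hom G S (Fobj T X) (Fobj T X')"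
  proof (rule graded_homI)
    show "Farr T X X' h (y \<oplus>\<^bsub>Fobj T X\<^esub> y') = Farr T X X' h y \<oplus>\<^bsub>Fobj T X'\<^esub> Farr T X X' h y'"
      if "y \<in> carrier (Fobj T X)" "y' \<in> carrier (Fobj T X)" for y y'
      by (rule X'.ap_ext) (use that in \<open>auto simp: F X.ap_add X'.ap_add X.ap_closed\<close>)
    show "Farr T X X' h (s \<odot>\<^bsub>Fobj T X\<^esub> y) = s \<odot>\<^bsub>Fobj T X'\<^esub> Farr T X X' h y"
      if "s \<in> carrier S" "y \<in> carrier (Fobj T X)" for s y
      by (rule X'.ap_ext)
        (use that in \<open>auto simp: F X.ap_smult X'.ap_smult X.Y.smult_closed X'.Y.smult_closed rsmult_closed\<close>)
    show "Farr T X X' h y \<in> mcomp (Fobj T X') \<sigma>" if \<sigma>: "\<sigma> \<in> carrier G" and y: "y \<in> mcomp (Fobj T X) \<sigma>" for \<sigma> y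
    proof -
      have yc: "y \<in> carrier (Fobj T X)" using \<sigma> y by (rule X.Y.X.comp_carrier)
      have "\<exists>z\<in>mcomp (Fobj T X') \<sigma>. \<forall>m\<in>carrier M. decode X' z m = h (decode X y m)"
      proof (rule X'.ap_ex[OF \<sigma>])
        show "h (decode X y m) \<in> mcomp X' (\<nu> \<otimes>\<^bsub>G\<^esub> \<sigma>)" if "\<nu> \<in> carrier G" "m \<in> mcomp M \<nu>" for \<nu> m
          using that \<sigma> y by (intro h.hom_comp X.ap_comp) auto
      qed (use yc in \<open>auto simp: X.ap_closed X.ap_add_r X.ap_smult_r\<close>)
      then obtain z where z: "z \<in> mcomp (Fobj T X') \<sigma>" "\<And>m. m \<in> carrier M \<Longrightarrow> decode X' z m = h (decode X y m)"
        by blast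
      have "Farr T X X' h y = z"
        by (rule X'.ap_ext) (use yc z X'.Y.X.comp_carrier[OF \<sigma> z(1)] in \<open>auto simp: F\<close>)
      then show ?thesis using z by simp
    qed
  qed (use F Farr_extensional[OF X] in auto)
  fix X'' :: "('g, 'r, 'u) gmodule" and k
  assume X'': "graded_module G R X''" and k: "k \<in> graded_hom G R X' X''"
  interpret X'': hom_object G R S M X'' "Fobj T X''" "decode X''" by (rule Fobj_hom_object[OF X''])
  note K = Farr_closed[OF X' X'' k]
  note KH = Farr_closed[OF X X'' graded_hom_compose[OF X X' X'' h k]]
  show "Farr T X X'' (compose (carrier X) k h) =
      compose (carrier (Fobj T X)) (Farr T X' X'' k) (Farr T X X' h)"
  proof (rule extensionalityI[OF Farr_extensional[OF X]])
    fix y assume y: "y \<in> carrier (Fobj T X)"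
    show "Farr T X X'' (compose (carrier X) k h) y =
        compose (carrier (Fobj T X)) (Farr T X' X'' k) (Farr T X X' h) y"
      by (rule X''.ap_ext) (use y in \<open>auto simp: KH K F compose_eq X.ap_closed\<close>)
  qed simp
qed

end

section \<open>The Morita pairing over a fixed universe and the resulting equivalence\<close>

locale morita_universe = pairing_context G R S M N p q +
    M: coded_bimod G R S M codeM + N: coded_bimod G S R N codeN
  for G :: "'g monoid" and R :: "('g, 'r) gring" and S :: "('g, 's) gring"
    and M :: "('g, 'r, 's, 'm) gbimodule" and N :: "('g, 's, 'r, 'n) gbimodule"
    and p :: "'m \<Rightarrow> 'n \<Rightarrow> 'r" and q :: "'n \<Rightarrow> 'm \<Rightarrow> 's"
    and codeM :: "('m \<Rightarrow> 'u) \<Rightarrow> 'u" and codeN :: "('n \<Rightarrow> 'u) \<Rightarrow> 'u" +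
  assumes R_small: "\<exists>e :: 'r \<Rightarrow> 'u. inj_on e (carrier R)"
    and S_small: "\<exists>e :: 's \<Rightarrow> 'u. inj_on e (carrier S)"

lemma morita_universe_swap:
  "morita_universe G R S M N p q codeM codeN \<Longrightarrow> morita_universe G S R N M q p codeN codeM"
  by (simp add: morita_universe_def morita_universe_axioms_def pairing_context_swap)

context morita_universe
begin

abbreviation "F' \<equiv> HOM_functor G R M codeM"
abbreviation "G' \<equiv> HOM_functor G S N codeN"
abbreviation "J \<equiv> pairing_context.trace_ideal S N M q"
abbreviation "C \<equiv> quotient_cat G R (loc_of_ideal G R I) :: (('g, 'r, 'u) gmodule, 'u \<Rightarrow> 'u) cat"
abbreviation "D \<equiv> quotient_cat G S (loc_of_ideal G S J) :: (('g, 's, 'u) gmodule, 'u \<Rightarrow> 'u) cat"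

text \<open>The embedding of R into \<open>'u\<close> is what allows the test sequence from I to R
  to be formed among the objects of the category.\<close>

lemma closed_iff:
  fixes X :: "('g, 'r, 'u) gmodule"
  shows "X \<in> closed_objects G R (loc_of_ideal G R I) \<longleftrightarrow> torsion_closed G R I X"
  using R_small gideal.closed_objects_iff[OF trace_gideal] by blast

lemma Fobj_torsion_closed:
  fixes X :: "('g, 'r, 'u) gmodule"
  assumes "torsion_closed G R I X" shows "torsion_closed G S J (Fobj F' X)"
  using hom_object_torsion_closed[OF assms M.Fobj_hom_object] assms by (simp add: torsion_closed_def)

lemma Obj_C: "Obj C = {X. torsion_closed G R I X}"
  by (auto simp: quotient_cat_def closed_iff Obj_gr_cat torsion_closed_def)

lemma C_simps [simp]:
  "Arr C = graded_hom G R" "Idt C X = (\<lambda>x\<in>carrier X. x)" "Cmp C X Y Z g f = compose (carrier X) g f"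
  by (simp_all add: quotient_cat_def)

lemma functor_quotient: "is_functor C D F'"
proof -
  interpret swap: morita_universe G S R N M q p codeN codeM
    by (rule morita_universe_swap) (rule morita_universe_axioms)
  show ?thesis
    unfolding quotient_cat_def
    by (rule is_functor_full_subcat[OF M.is_functor_HOM])
      (simp add: closed_iff swap.closed_iff Fobj_torsion_closed)
qed

text \<open>Elements of the double HOM are determined by double evaluation. Both paths around the
  naturality square evaluate at (n, m) to p(m, n) f(x), because f is R-linear.\<close>

lemma unit_naturally_isomorphic: "naturally_isomorphic C C id_functor (comp_functor G' F')"
proof -
  define \<eta> where "\<eta> X = unit_map X (M.decode X) (Fobj G' (Fobj F' X)) (N.decode (Fobj F' X))"
    for X :: "('g, 'r, 'u) gmodule"
  have hom: "hom_object G R S M X (Fobj F' X) (M.decode X)"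
    "hom_object G S R N (Fobj F' X) (Fobj G' (Fobj F' X)) (N.decode (Fobj F' X))"
    and gr: "graded_module G R X" "graded_module G S (Fobj F' X)" "graded_module G R (Fobj G' (Fobj F' X))"
    if "torsion_closed G R I X" for X :: "('g, 'r, 'u) gmodule"
  proof -
    show X: "graded_module G R X" using that by (simp add: torsion_closed_def)
    show Y: "graded_module G S (Fobj F' X)" by (rule M.Fobj_graded_module[OF X])
    show "hom_object G R S M X (Fobj F' X) (M.decode X)" by (rule M.Fobj_hom_object[OF X])
    show "hom_object G S R N (Fobj F' X) (Fobj G' (Fobj F' X)) (N.decode (Fobj F' X))"
      by (rule N.Fobj_hom_object[OF Y])
    show "graded_module G R (Fobj G' (Fobj F' X))" by (rule N.Fobj_graded_module[OF Y])
  qed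
  have iso: "is_iso C X (Fobj G' (Fobj F' X)) (\<eta> X)" if X: "torsion_closed G R I X" for X :: "('g, 'r, 'u) gmodule"
  proof -
    note u = unit_map_hom[OF X hom[OF X]] unit_map_inj[OF X hom[OF X]] unit_map_surj[OF X hom[OF X]]
    have "is_iso (gr_cat G R) X (Fobj G' (Fobj F' X)) (\<eta> X)"
      unfolding \<eta>_def by (rule is_iso_gr_cat[OF gr(1,3)[OF X] u])
    then show ?thesis by (simp add: is_iso_def)
  qed
  have natural: "compose (carrier X) (\<eta> X') f = compose (carrier X) (Farr G' (Fobj F' X) (Fobj F' X') (Farr F' X X' f)) (\<eta> X)"
    if X: "torsion_closed G R I X" and X': "torsion_closed G R I X'" and f: "f \<in> graded_hom G R X X'"
    for X X' :: "('g, 'r, 'u) gmodule" and f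
    unfolding compose_def
  proof (rule restrict_ext)
    fix x assume x: "x \<in> carrier X"
    interpret f: grhom G R X X' f using gr(1)[OF X] gr(1)[OF X'] f by (rule grhomI)
    interpret Y: hom_object G S R N "Fobj F' X" "Fobj G' (Fobj F' X)" "N.decode (Fobj F' X)"
      by (rule hom[OF X])
    have Ff: "Farr F' X X' f \<in> graded_hom G S (Fobj F' X) (Fobj F' X')"
      using M.is_functor_HOM gr(1)[OF X] gr(1)[OF X'] f by (simp add: is_functor_def Obj_gr_cat)
    have e: "\<eta> X x \<in> carrier (Fobj G' (Fobj F' X))"
      using unit_map_surj[OF X hom[OF X]] x unfolding \<eta>_def by blast
    have e': "\<eta> X' (f x) \<in> carrier (Fobj G' (Fobj F' X'))"
      using unit_map_surj[OF X' hom[OF X']] f.hom_closed[OF x] unfolding \<eta>_def by blast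
    note N = N.Farr_closed[OF gr(2)[OF X] gr(2)[OF X'] Ff e]
    show "\<eta> X' (f x) = Farr G' (Fobj F' X) (Fobj F' X') (Farr F' X X' f) (\<eta> X x)"
    proof (rule unit_map_ext[OF X' hom[OF X'] e' N(1)])
      fix n m assume n: "n \<in> carrier N" and m: "m \<in> carrier M"
      have "M.decode X' (N.decode (Fobj F' X') (\<eta> X' (f x)) n) m = p m n \<odot>\<^bsub>X'\<^esub> f x"
        unfolding \<eta>_def using x n m by (intro unit_map_ap[OF X' hom[OF X']]) auto
      also have "\<dots> = f (M.decode X (N.decode (Fobj F' X) (\<eta> X x) n) m)"
        using x n m unit_map_ap[OF X hom[OF X], of x n m] by (simp add: \<eta>_def p_closed)
      also have "\<dots> = M.decode X' (N.decode (Fobj F' X')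
          (Farr G' (Fobj F' X) (Fobj F' X') (Farr F' X X' f) (\<eta> X x)) n) m"
        using M.Farr_closed(2)[OF gr(1)[OF X] gr(1)[OF X'] f Y.ap_closed[OF e n] m] N(2)[OF n] by simp
      finally show "M.decode X' (N.decode (Fobj F' X') (\<eta> X' (f x)) n) m =
        M.decode X' (N.decode (Fobj F' X')
          (Farr G' (Fobj F' X) (Fobj F' X') (Farr F' X X' f) (\<eta> X x)) n) m" .
    qed
  qed
  show ?thesis
    unfolding naturally_isomorphic_def Obj_C
    by (intro exI[of _ \<eta>]) (simp add: id_functor_def comp_functor_def iso natural)
qed

text \<open>The unit of the context with R and S exchanged goes from the identity of D to the
  composite of the functors. The definition of an equivalence asks for the opposite direction, so
  this transformation is inverted.\<close>

lemma equivalence: "equivalence_via C D F' G'"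
proof -
  interpret swap: morita_universe G S R N M q p codeN codeM
    by (rule morita_universe_swap) (rule morita_universe_axioms)
  note functors = functor_quotient swap.functor_quotient
  have id: "is_functor D D id_functor"
    by (simp add: is_functor_def id_functor_def)
  have comp: "is_functor D D (comp_functor F' G')"
    using functors by (simp add: is_functor_def comp_functor_def)
  have gr: "graded_module G S X" if "X \<in> Obj D" for X
    using that by (simp add: swap.Obj_C torsion_closed_def)
  have closed: "f x \<in> carrier Y" if "f \<in> graded_hom G S X Y" "x \<in> carrier X" for f X Y x
    using that by (auto simp: graded_hom_def linear_maps_def)
  have ext: "f \<in> extensional (carrier X)" if "f \<in> graded_hom G S X Y" for f X Y
    using that by (auto simp: graded_hom_def linear_maps_def PiE_def)
  have "naturally_isomorphic D D (comp_functor F' G') id_functor"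
  proof (rule naturally_isomorphic_sym[OF swap.unit_naturally_isomorphic id comp])
    show "Cmp D X Y Z g f \<in> Arr D X Z"
      if "X \<in> Obj D" "Y \<in> Obj D" "Z \<in> Obj D" "f \<in> Arr D X Y" "g \<in> Arr D Y Z" for X Y Z f g
      using that graded_hom_compose[OF gr gr gr] by simp
    show "Cmp D W X Z (Cmp D X Y Z h g) f = Cmp D W Y Z h (Cmp D W X Y g f)"
      if "f \<in> Arr D W X" for W X Y Z f g h
      unfolding swap.C_simps compose_def
      by (rule restrict_ext) (use closed[of f W X] that in auto)
    show "Cmp D X X Y f (Idt D X) = f" if "f \<in> Arr D X Y" for X Y f
      using ext[of f X Y] that by (intro extensionalityI[of _ "carrier X"]) (auto simp: compose_def)
    show "Cmp D X Y Y (Idt D Y) f = f" if "f \<in> Arr D X Y" for X Y f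
      using ext[of f X Y] closed[of f X Y] that
      by (intro extensionalityI[of _ "carrier X"]) (auto simp: compose_def)
  qed
  then show ?thesis
    unfolding equivalence_via_def using functors unit_naturally_isomorphic by blast
qed

end

lemma (in gideal) graded_ideal: "graded_ideal G R I"
proof -
  have "internal_direct_sum (R\<lparr>carrier := I\<rparr>) (carrier G) (\<lambda>\<sigma>. I \<inter> rcomp R \<sigma>)"
    by (rule R.direct_sum_sub)
      (use ideal_pr additive_subgroup.a_inv_closed[OF ideal.axioms(1)[OF ideal]] in auto)
  then show ?thesis using ideal by (simp add: graded_ideal_def)
qed

theorem mainTheorem11:
  fixes G :: "'g monoid" and R :: "('g, 'r) gring" and S :: "('g, 's) gring"
    and M :: "('g, 'r, 's, 'm) gbimodule" and N :: "('g, 's, 'r, 'n) gbimodule"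
    and \<phi> :: "('m \<times> 'n \<Rightarrow>\<^sub>0 int) set \<Rightarrow> 'r" and \<psi> :: "('n \<times> 'm \<Rightarrow>\<^sub>0 int) set \<Rightarrow> 's"
    and codeM :: "('m \<Rightarrow> 'u) \<Rightarrow> 'u" and codeN :: "('n \<Rightarrow> 'u) \<Rightarrow> 'u"
  assumes "graded_Morita_context G R S M N \<phi> \<psi>"
    and "adequate_universe R S M N codeM codeN"
  shows "let I = \<phi> ` carrier (tensor G S M N);
             J = \<psi> ` carrier (tensor G R N M);
             F' = HOM_functor G R M codeM;
             G' = HOM_functor G S N codeN
         in graded_ideal G R I \<and> graded_ideal G S J \<and>
            is_functor (gr_cat G R) (gr_cat G S) F' \<and>
            is_functor (gr_cat G S) (gr_cat G R) G' \<and>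
            equivalence_via (quotient_cat G R (loc_of_ideal G R I))
              (quotient_cat G S (loc_of_ideal G S J)) F' G'"
proof -
  interpret ctx: graded_Morita_context G R S M N \<phi> \<psi> by fact
  have MB: "bimod G R S M" and NB: "bimod G S R N"
    by (intro bimodI; unfold_locales)+
  interpret P: tensor_context G R S M N \<phi>
    by (intro tensor_context.intro MB NB tensor_context_axioms.intro ctx.phi_hom)
  interpret Q: tensor_context G S R N M \<psi>
    by (intro tensor_context.intro MB NB tensor_context_axioms.intro ctx.psi_hom)
  have assoc: "P.pairing m n \<odot>\<^bsub>M\<^esub> m' = m \<odot>\<^sub>r\<^bsub>M\<^esub> Q.pairing n m'"
    "Q.pairing n m \<odot>\<^bsub>N\<^esub> n' = n \<odot>\<^sub>r\<^bsub>N\<^esub> P.pairing m n'"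
    if "m \<in> carrier M" "m' \<in> carrier M" "n \<in> carrier N" "n' \<in> carrier N" for m m' n n'
    unfolding P.pairing_def Q.pairing_def by (rule ctx.phi_psi[OF that(1-3)], rule ctx.psi_phi[OF that(1,3,4)])
  have gr: "grring G R" "grring G S" "grmod G R M" "grmod G S N"
    by unfold_locales
  have pairing: "pairing_context G R S M N P.pairing Q.pairing"
  proof (intro pairing_context.intro[OF gr MB NB] pairing_context_axioms.intro)
    show "P.pairing m n \<odot>\<^bsub>M\<^esub> m' = m \<odot>\<^sub>r\<^bsub>M\<^esub> Q.pairing n m'"
      if "m \<in> carrier M" "m' \<in> carrier M" "n \<in> carrier N" for m m' n
      using assoc(1)[OF that that(3)] .
    show "Q.pairing n m \<odot>\<^bsub>N\<^esub> n' = n \<odot>\<^sub>r\<^bsub>N\<^esub> P.pairing m n'"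
      if "m \<in> carrier M" "n \<in> carrier N" "n' \<in> carrier N" for m n n'
      using assoc(2)[OF that(1,1,2,3)] .
  qed (fact P.pairing_closed P.pairing_add_l P.pairing_add_r P.pairing_balanced P.pairing_smult
    P.pairing_rsmult P.pairing_comp Q.pairing_closed Q.pairing_add_l Q.pairing_add_r
    Q.pairing_balanced Q.pairing_smult Q.pairing_rsmult Q.pairing_comp)+
  have universe: "coded_bimod G R S M codeM" "coded_bimod G S R N codeN"
    "\<exists>e :: 'r \<Rightarrow> 'u. inj_on e (carrier R)" "\<exists>e :: 's \<Rightarrow> 'u. inj_on e (carrier S)"
    using assms(2) MB NB
    by (simp_all add: adequate_universe_def coded_bimod_def coded_bimod_axioms_def)
  interpret morita_universe G R S M N P.pairing Q.pairing codeM codeN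
    using pairing universe by (simp add: morita_universe_def morita_universe_axioms_def)
  interpret swap: morita_universe G S R N M Q.pairing P.pairing codeN codeM
    by (rule morita_universe_swap) (rule morita_universe_axioms)
  \<comment> \<open>The statement speaks of images of the tensor products, the equivalence of trace
    ideals; \<open>image_phi\<close> identifies them on both sides.\<close>
  have "\<phi> ` carrier (tensor G S M N) = I" "\<psi> ` carrier (tensor G R N M) = swap.I"
    by (simp_all add: P.image_phi Q.image_phi trace_ideal_def swap.trace_ideal_def)
  then show ?thesis
    using gideal.graded_ideal[OF trace_gideal] gideal.graded_ideal[OF swap.trace_gideal]
      M.is_functor_HOM N.is_functor_HOM equivalence
    by simp
qed

end
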